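(* Let $k\ge2$ be an integer, $N\ge1$, $\chi$ a Dirichlet character modulo $N$, and let $f,g\in M_k(\Gamma_0(N),\chi)$ both be cusp forms. Let $\Gamma=\mathrm{SL}_2(\mathbb{Z})$, let $r=[\Gamma:\Gamma_0(N)]$, let $(\gamma_j)_{1\le j\le r}$ be a system of right coset representatives, $\Gamma=\bigsqcup_{j=1}^r\Gamma_0(N)\gamma_j$, and set $f_j=f|_k\gamma_j$, $g_j=g|_k\gamma_j$. Then \begin{align*}6r(2i)^{k-1}\langle f,g\rangle_{\Gamma_0(N)}&=\sum_{1\le j\le r}\int_0^{i\infty}\int_{-1}^1f_j(\tau)\overline{g_j(\tau_2)}(\tau-\overline{\tau_2})^{k-2}\,d\tau\,d\overline{\tau_2}\\ &=\sum_{1\le j\le r}\ \sum_{0\le n\le k-2}(-1)^n\binom{k-2}{n}I_{k-2-n}(0,i\infty,f_j)\,\overline{I_n(-1,1,g_j)}\;,\end{align*} where $\tau$ runs from $0$ to $i\infty$, $\tau_2$ runs from $-1$ to $1$, and $$I_n(A,B,F)=\int_A^B\tau^nF(\tau)\,d\tau\;.$$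
   Context: $\mathfrak{H}$ is the upper half-plane, and for $\gamma=\begin{pmatrix}a&b\\c&d\end{pmatrix}\in\mathrm{SL}_2(\mathbb{Z})$, $(f|_k\gamma)(\tau)=(c\tau+d)^{-k}f(\gamma\tau)$. Forms in $M_k(\Gamma_0(N),\chi)$ satisfy $f|_k\gamma=\chi(d)f$ for $\gamma\in\Gamma_0(N)$. The Petersson product is normalized as $$\langle f,g\rangle_{\Gamma_0(N)}=\frac{1}{[\Gamma:\Gamma_0(N)]}\int_{\Gamma_0(N)\backslash\mathfrak{H}}f(\tau)\overline{g(\tau)}\,y^k\,\frac{dx\,dy}{y^2},\qquad \tau=x+iy.$$ All line integrals between points of the completed upper half-plane (here the cusps $0,i\infty,-1,1$) are along paths in $\mathfrak{H}$ joining these points, for instance hyperbolic geodesics. *)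

theory Defs
  imports "HOL-Complex_Analysis.Complex_Analysis" "HOL-Algebra.Coset"
begin

definition uhp :: "complex set" where
  "uhp = {\<tau>. Im \<tau> > 0}"


subsection \<open>The modular group, $\Gamma_0(N)$ and their action\<close>

definition SL2Z :: "(int ^ 2 ^ 2) monoid" where
  "SL2Z = \<lparr>carrier = {A. det A = 1}, mult = (**), one = mat 1\<rparr>"

definition Gamma0 :: "nat \<Rightarrow> (int ^ 2 ^ 2) set" where
  "Gamma0 N = {A \<in> carrier SL2Z. int N dvd A $ 2 $ 1}"

text \<open>In HOL-Algebra, \<open>rcosets\<close> is the set of right cosets $\Gamma_0(N)\gamma$.\<close>

definition Gamma0_index :: "nat \<Rightarrow> nat" where
  "Gamma0_index N = card (rcosets\<^bsub>SL2Z\<^esub> (Gamma0 N))"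

definition aut_factor :: "int ^ 2 ^ 2 \<Rightarrow> complex \<Rightarrow> complex" where
  "aut_factor A \<tau> = of_int (A $ 2 $ 1) * \<tau> + of_int (A $ 2 $ 2)"

definition mobius :: "int ^ 2 ^ 2 \<Rightarrow> complex \<Rightarrow> complex" where
  "mobius A \<tau> = (of_int (A $ 1 $ 1) * \<tau> + of_int (A $ 1 $ 2)) / aut_factor A \<tau>"

definition slash :: "nat \<Rightarrow> (complex \<Rightarrow> complex) \<Rightarrow> int ^ 2 ^ 2 \<Rightarrow> complex \<Rightarrow> complex" where
  "slash k f A \<tau> = aut_factor A \<tau> powi (- int k) * f (mobius A \<tau>)"


subsection \<open>Modular forms and cusp forms with character\<close>

definition dirichlet_character :: "nat \<Rightarrow> (int \<Rightarrow> complex) \<Rightarrow> bool" where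
  "dirichlet_character N chi \<longleftrightarrow>
     (\<forall>a b. chi (a * b) = chi a * chi b) \<and>
     (\<forall>a. chi (a + int N) = chi a) \<and>
     (\<forall>a. chi a \<noteq> 0 \<longleftrightarrow> coprime a (int N))"

text \<open>For \<open>f\<close> transforming under $\Gamma_0(N)$ with a character modulo \<open>N\<close>, every
  $f|_k\gamma$ with $\gamma\in\mathrm{SL}_2(\mathbb{Z})$ has period \<open>N\<close>, because
  $\gamma T^N\gamma^{-1}\equiv I$ modulo \<open>N\<close>. Its expansion at the cusp $\gamma(i\infty)$ is
  therefore written in $e^{2\pi i\tau/N}$, whatever the width of that cusp.\<close>

definition q_expansion :: "nat \<Rightarrow> (complex \<Rightarrow> complex) \<Rightarrow> (nat \<Rightarrow> complex) \<Rightarrow> bool" where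
  "q_expansion N F a \<longleftrightarrow>
     (\<forall>\<tau>\<in>uhp. (\<lambda>n. a n * exp (2 * of_real pi * \<i> * of_nat n * \<tau> / of_nat N)) sums F \<tau>)"

definition modular_forms :: "nat \<Rightarrow> nat \<Rightarrow> (int \<Rightarrow> complex) \<Rightarrow> (complex \<Rightarrow> complex) set" where
  "modular_forms k N chi =
     {f. f holomorphic_on uhp \<and>
         (\<forall>A\<in>Gamma0 N. \<forall>\<tau>\<in>uhp. slash k f A \<tau> = chi (A $ 2 $ 2) * f \<tau>) \<and>
         (\<forall>A\<in>carrier SL2Z. \<exists>a. q_expansion N (slash k f A) a)}"

definition cusp_forms :: "nat \<Rightarrow> nat \<Rightarrow> (int \<Rightarrow> complex) \<Rightarrow> (complex \<Rightarrow> complex) set" where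
  "cusp_forms k N chi =
     {f \<in> modular_forms k N chi.
        \<forall>A\<in>carrier SL2Z. \<exists>a. q_expansion N (slash k f A) a \<and> a 0 = 0}"


subsection \<open>Integration over a quotient of the upper half-plane\<close>

text \<open>The overlap condition excludes \<open>mat 1\<close> and \<open>- mat 1\<close>, the two matrices that act
  trivially. Up to null sets a fundamental domain meets each orbit exactly once; boundary points
  are unrestricted.\<close>

definition fundamental_domain :: "(int ^ 2 ^ 2) set \<Rightarrow> complex set \<Rightarrow> bool" where
  "fundamental_domain G D \<longleftrightarrow>
     D \<in> sets lebesgue \<and> D \<subseteq> uhp \<and>
     negligible (uhp - (\<Union>A\<in>G. mobius A ` D)) \<and>
     (\<forall>A\<in>G. A \<noteq> mat 1 \<and> A \<noteq> - mat 1 \<longrightarrow> negligible (D \<inter> mobius A ` D))"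

text \<open>$\int_{G\backslash\mathfrak{H}}\varphi\,dx\,dy/y^2$: the common value of the integrals over all
  fundamental domains of \<open>G\<close>.\<close>

definition quotient_integral :: "(int ^ 2 ^ 2) set \<Rightarrow> (complex \<Rightarrow> complex) \<Rightarrow> complex" where
  "quotient_integral G \<phi> =
     (THE I. \<forall>D. fundamental_domain G D \<longrightarrow>
        (LINT \<tau>:D|lebesgue. \<phi> \<tau> / of_real ((Im \<tau>)\<^sup>2)) = I)"

definition petersson :: "nat \<Rightarrow> nat \<Rightarrow> (complex \<Rightarrow> complex) \<Rightarrow> (complex \<Rightarrow> complex) \<Rightarrow> complex" where
  "petersson k N f g =
     1 / of_nat (Gamma0_index N) *
     quotient_integral (Gamma0 N) (\<lambda>\<tau>. f \<tau> * cnj (g \<tau>) * of_real (Im \<tau> ^ k))"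


subsection \<open>Line integrals between cusps\<close>

datatype cusp = Rat_cusp rat | Inf_cusp

text \<open>A path has to end at a cusp without becoming tangent to the boundary, i.e. inside some
  sector \<open>\<bar>Re \<tau> - a\<bar> \<le> C * Im \<tau>\<close>, with \<open>a = 0\<close> at infinity. Geodesics do. Without such a
  condition the integral of \<open>\<tau> ^ n * F \<tau>\<close> for a cusp form \<open>F\<close> can fail to converge for \<open>n > 0\<close>, since
  \<open>\<bar>Re \<tau>\<bar>\<close> may grow exponentially in \<open>Im \<tau>\<close>.\<close>

fun tends_to_cusp :: "(real \<Rightarrow> complex) \<Rightarrow> cusp \<Rightarrow> real filter \<Rightarrow> bool" where
  "tends_to_cusp p (Rat_cusp a) Fl \<longleftrightarrow>
     (p \<longlongrightarrow> of_rat a) Fl \<and>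
     (\<exists>C. \<forall>\<^sub>F t in Fl. \<bar>Re (p t) - of_rat a\<bar> \<le> C * Im (p t))"
| "tends_to_cusp p Inf_cusp Fl \<longleftrightarrow>
     filterlim (\<lambda>t. Im (p t)) at_top Fl \<and>
     (\<exists>C. \<forall>\<^sub>F t in Fl. \<bar>Re (p t)\<bar> \<le> C * Im (p t))"

text \<open>Paths are parametrised by the open unit interval; the cusps are only limits.\<close>

definition cusp_path :: "cusp \<Rightarrow> cusp \<Rightarrow> (real \<Rightarrow> complex) \<Rightarrow> bool" where
  "cusp_path A B p \<longleftrightarrow>
     p ` {0<..<1} \<subseteq> uhp \<and>
     (\<forall>s t. 0 < s \<and> s < t \<and> t < 1 \<longrightarrow> p piecewise_C1_differentiable_on {s..t}) \<and>
     tends_to_cusp p A (at_right 0) \<and> tends_to_cusp p B (at_left 1)"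

text \<open>$\int_A^B F(\tau)\,d\tau$: the common value of the (improper) integrals along all paths in the
  upper half-plane from \<open>A\<close> to \<open>B\<close>.\<close>

definition line_integral :: "cusp \<Rightarrow> cusp \<Rightarrow> (complex \<Rightarrow> complex) \<Rightarrow> complex" where
  "line_integral A B F =
     (THE I. \<forall>p. cusp_path A B p \<longrightarrow>
        ((\<lambda>(s, t). contour_integral (subpath s t p) F) \<longlongrightarrow> I) (at_right 0 \<times>\<^sub>F at_left 1))"

text \<open>$\int_A^B F(\tau)\,d\overline{\tau}$, using
  $\int F\,d\overline{\tau}=\overline{\int\overline{F}\,d\tau}$.\<close>

definition line_integral_cnj :: "cusp \<Rightarrow> cusp \<Rightarrow> (complex \<Rightarrow> complex) \<Rightarrow> complex" where
  "line_integral_cnj A B F = cnj (line_integral A B (\<lambda>\<tau>. cnj (F \<tau>)))"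

definition moment :: "nat \<Rightarrow> cusp \<Rightarrow> cusp \<Rightarrow> (complex \<Rightarrow> complex) \<Rightarrow> complex" where
  "moment n A B F = line_integral A B (\<lambda>\<tau>. \<tau> ^ n * F \<tau>)"

end

theory Submission
  imports Defs
begin

text \<open>
  Let $P(\tau,z)=\sum_j f_j(\tau)\overline{g_j(z)}$. It has weight $k$ in both variables under the
  full modular group, so by unfolding $r\langle f,g\rangle$ is the integral of
  $P(\tau,\tau)y^{k-2}\,dx\,dy$ over the standard fundamental domain $F$ of $\mathrm{SL}_2(\mathbb{Z})$.
  The kernel $P(\tau,z)(\tau-\overline z)^{k-2}$ is a finite sum of products $u(\tau)\overline{w(z)}$
  with holomorphic $u,w$; taking primitives gives a function $\Psi(\tau,z)$, extended to the cusps by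
  sectorial limits, whose second differences (the pairing of two paths) are invariant. The form
  $\omega=\partial_\tau\Psi(\tau,z)|_{z=\tau}\,d\tau$ has $d\omega=2i\,P(\tau,\tau)(2iy)^{k-2}\,dx\,dy$ and is
  periodic, so Green's formula reduces the integral over $F$ to the arc from $\rho=e^{2\pi i/3}$ to
  $\rho+1$; folding that arc by $\tau\mapsto-1/\tau$ leaves the pairing of the path $\rho\to i$ with
  $i\infty\to0$. Averaging over the stabilisers of $i$ and $\rho$ (this is the factor $6$) turns it
  into the pairing of $0\to i\infty$ with $-1\to1$.
\<close>

text \<open>Otherwise every matrix entry also parses as a power series coefficient.\<close>

no_notation fps_nth (infixl "$" 75)

section \<open>The modular group acting on the upper half-plane\<close>

text \<open>The weight \<open>k\<close> and the factor \<open>(\<tau> - cnj z) ^ (k - 2)\<close>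
  leave weight two in each variable, which the differentials compensate; so double integrals of the
  kernel over paths are invariant although the primitives are not. Under the group a primitive
  changes by terms that depend on one variable only, and second differences kill exactly these. The
  primitive in the second variable is normalised to vanish at infinity: this makes the form in
  Green's formula periodic and lets it decay, so that neither the sides nor the top of the domain
  contribute. The 6 is 2 times 3: inversion doubles the pairing, the element of order three triples
  the result, and the three cusp paths so obtained form a closed triangle, for which the interior
  base point \<open>\<rho>\<close> may be replaced by a cusp. A second obstacle is of a different
  kind: the quotient integral and the line integrals are definite descriptions. Each value therefore
  needs a proof that all fundamental domains or all sectorial paths agree, together with one actual
  domain or path.\<close>

definition sl2 :: "int \<Rightarrow> int \<Rightarrow> int \<Rightarrow> int \<Rightarrow> int ^ 2 ^ 2" where
  "sl2 a b c d = vector [vector [a, b], vector [c, d]]"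

lemma sl2_nth [simp]:
  "sl2 a b c d $ 1 $ 1 = a" "sl2 a b c d $ 1 $ 2 = b"
  "sl2 a b c d $ 2 $ 1 = c" "sl2 a b c d $ 2 $ 2 = d"
  by (simp_all add: sl2_def)

lemma mat2_eq_iff:
  fixes A B :: "int ^ 2 ^ 2"
  shows "A = B \<longleftrightarrow> A$1$1 = B$1$1 \<and> A$1$2 = B$1$2 \<and> A$2$1 = B$2$1 \<and> A$2$2 = B$2$2"
  by (auto simp: vec_eq_iff forall_2)

lemma mat2_mult_nth:
  fixes A B :: "int ^ 2 ^ 2"
  shows "(A ** B) $ i $ j = A$i$1 * B$1$j + A$i$2 * B$2$j"
  by (simp add: matrix_matrix_mult_def sum_2)

lemma mat2_one_nth [simp]:
  "(mat 1 :: int^2^2) $ 1 $ 1 = 1" "(mat 1 :: int^2^2) $ 1 $ 2 = 0"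
  "(mat 1 :: int^2^2) $ 2 $ 1 = 0" "(mat 1 :: int^2^2) $ 2 $ 2 = 1"
  by (simp_all add: mat_def)

lemma SL2Z_iff: "A \<in> carrier SL2Z \<longleftrightarrow> A$1$1 * A$2$2 - A$1$2 * A$2$1 = 1"
  by (simp add: SL2Z_def det_2)

lemma SL2Z_mult_closed: "A \<in> carrier SL2Z \<Longrightarrow> B \<in> carrier SL2Z \<Longrightarrow> A ** B \<in> carrier SL2Z"
  by (simp add: SL2Z_def det_mul)

text \<open>The adjugate, so it is involutive on all integer matrices and inverts those of
  determinant one.\<close>

definition sl2_inv :: "int ^ 2 ^ 2 \<Rightarrow> int ^ 2 ^ 2" where
  "sl2_inv A = sl2 (A$2$2) (- A$1$2) (- A$2$1) (A$1$1)"

lemma sl2_inv_closed: "A \<in> carrier SL2Z \<Longrightarrow> sl2_inv A \<in> carrier SL2Z"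
  by (simp add: SL2Z_iff sl2_inv_def algebra_simps)

lemma sl2_inv_inv [simp]: "sl2_inv (sl2_inv A) = A"
  by (simp add: mat2_eq_iff sl2_inv_def)

lemma sl2_inv_left: "A \<in> carrier SL2Z \<Longrightarrow> sl2_inv A ** A = mat 1"
  and sl2_inv_right: "A \<in> carrier SL2Z \<Longrightarrow> A ** sl2_inv A = mat 1"
  by (simp_all add: SL2Z_iff mat2_eq_iff mat2_mult_nth sl2_inv_def algebra_simps)

lemma SL2Z_left_cancel:
  assumes "A \<in> carrier SL2Z" shows "sl2_inv A ** (A ** B) = B" "A ** (sl2_inv A ** B) = B"
  using assms by (simp_all add: matrix_mul_assoc sl2_inv_left sl2_inv_right)

lemma Gamma0_SL2Z: "A \<in> Gamma0 N \<Longrightarrow> A \<in> carrier SL2Z"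
  by (simp add: Gamma0_def)

lemma Gamma0_mult_closed: "A \<in> Gamma0 N \<Longrightarrow> B \<in> Gamma0 N \<Longrightarrow> A ** B \<in> Gamma0 N"
  by (simp add: Gamma0_def SL2Z_mult_closed mat2_mult_nth)

lemma Gamma0_inv_closed: "A \<in> Gamma0 N \<Longrightarrow> sl2_inv A \<in> Gamma0 N"
  by (simp add: Gamma0_def sl2_inv_closed) (simp add: sl2_inv_def)

lemma one_in_Gamma0: "mat 1 \<in> Gamma0 N"
  by (simp add: Gamma0_def SL2Z_iff)

lemma minus_in_Gamma0_iff [simp]: "- A \<in> Gamma0 N \<longleftrightarrow> A \<in> Gamma0 N"
  by (simp add: Gamma0_def SL2Z_iff)

lemma aut_factor_nonzero:
  assumes "A \<in> carrier SL2Z" "\<tau> \<in> uhp" shows "aut_factor A \<tau> \<noteq> 0"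
proof
  assume *: "aut_factor A \<tau> = 0"
  have "of_int (A$2$1) * Im \<tau> = Im (aut_factor A \<tau>)" by (simp add: aut_factor_def)
  hence "A$2$1 = 0" using * assms by (simp add: uhp_def)
  moreover from this have "A$2$2 = 0" using * by (simp add: aut_factor_def)
  ultimately show False using assms by (simp add: SL2Z_iff)
qed

lemma SL2Z_of_int:
  assumes "A \<in> carrier SL2Z"
  shows "of_int (A$1$1) * of_int (A$2$2) - of_int (A$1$2) * of_int (A$2$1) = (1::'a::comm_ring_1)"
  using assms unfolding SL2Z_iff of_int_mult[symmetric] of_int_diff[symmetric] by simp

lemma Im_mobius:
  assumes "A \<in> carrier SL2Z"
  shows "Im (mobius A \<tau>) = Im \<tau> / (cmod (aut_factor A \<tau>))\<^sup>2"
proof -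
  note d = SL2Z_of_int[OF assms, where 'a = real]
  have "Im (mobius A \<tau>) = (Im \<tau> * (of_int (A$1$1) * of_int (A$2$2) - of_int (A$1$2) * of_int (A$2$1)))
          / (cmod (aut_factor A \<tau>))\<^sup>2"
    unfolding mobius_def Im_divide cmod_power2 by (simp add: aut_factor_def algebra_simps)
  thus ?thesis by (simp only: d mult_1_right)
qed

lemma mobius_uhp: 
  assumes "A \<in> carrier SL2Z" "\<tau> \<in> uhp" shows "mobius A \<tau> \<in> uhp"
  using assms Im_mobius[OF assms(1), of \<tau>] aut_factor_nonzero[OF assms] by (simp add: uhp_def)

lemma aut_factor_mult:
  assumes "B \<in> carrier SL2Z" "\<tau> \<in> uhp"
  shows "aut_factor (A ** B) \<tau> = aut_factor A (mobius B \<tau>) * aut_factor B \<tau>"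
  using aut_factor_nonzero[OF assms] unfolding mobius_def
  by (simp add: field_simps aut_factor_def[of A] aut_factor_def[of "A**B"])
     (simp add: aut_factor_def mat2_mult_nth algebra_simps)

lemma mobius_mult:
  assumes "A \<in> carrier SL2Z" "B \<in> carrier SL2Z" "\<tau> \<in> uhp"
  shows "mobius (A ** B) \<tau> = mobius A (mobius B \<tau>)"
proof -
  have nz: "aut_factor B \<tau> \<noteq> 0" "aut_factor A (mobius B \<tau>) \<noteq> 0"
    using aut_factor_nonzero[OF assms(2,3)] aut_factor_nonzero[OF assms(1) mobius_uhp[OF assms(2,3)]] by auto
  have "of_int ((A**B)$1$1) * \<tau> + of_int ((A**B)$1$2)
      = (of_int (A$1$1) * mobius B \<tau> + of_int (A$1$2)) * aut_factor B \<tau>"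
    using nz(1) unfolding mobius_def
    by (simp add: field_simps) (simp add: aut_factor_def mat2_mult_nth algebra_simps)
  thus ?thesis
    unfolding mobius_def[of "A**B"] mobius_def[of A] aut_factor_mult[OF assms(2,3)] using nz by simp
qed

lemma mobius_one [simp]: "mobius (mat 1) \<tau> = \<tau>"
  by (simp add: mobius_def aut_factor_def)

lemma mobius_minus [simp]: "mobius (- A) \<tau> = mobius A \<tau>"
proof -
  have "mobius (- A) \<tau> = - (of_int (A $ 1 $ 1) * \<tau> + of_int (A $ 1 $ 2)) / - aut_factor A \<tau>"
    by (simp add: mobius_def aut_factor_def)
  thus ?thesis by (simp add: mobius_def del: minus_add_distrib)
qed

lemma mobius_inv_cancel:
  assumes "A \<in> carrier SL2Z" "\<tau> \<in> uhp"
  shows "mobius (sl2_inv A) (mobius A \<tau>) = \<tau>" "mobius A (mobius (sl2_inv A) \<tau>) = \<tau>"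
  using mobius_mult[OF sl2_inv_closed[OF assms(1)] assms(1,2)]
        mobius_mult[OF assms(1) sl2_inv_closed[OF assms(1)] assms(2)] assms(1)
  by (simp_all add: sl2_inv_left sl2_inv_right)

lemma inj_on_mobius: "A \<in> carrier SL2Z \<Longrightarrow> inj_on (mobius A) uhp"
  by (metis inj_onI mobius_inv_cancel(1))

text \<open>The two automorphy factors are merely required to be nonzero, because the second point
  will be a conjugate in the lower half-plane: this identity determines the weight of
  \<open>\<tau> - cnj z\<close>.\<close>

lemma mobius_diff:
  assumes "A \<in> carrier SL2Z" "aut_factor A \<tau> \<noteq> 0" "aut_factor A z \<noteq> 0"
  shows "mobius A \<tau> - mobius A z = (\<tau> - z) / (aut_factor A \<tau> * aut_factor A z)"
proof -
  note d = SL2Z_of_int[OF assms(1), where 'a = complex]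
  have "mobius A \<tau> - mobius A z = ((of_int (A$1$1) * of_int (A$2$2) - of_int (A$1$2) * of_int (A$2$1)) * (\<tau> - z)) 
     / (aut_factor A \<tau> * aut_factor A z)"
    using assms(2,3) unfolding mobius_def
    by (simp add: field_simps) (simp add: aut_factor_def algebra_simps)
  thus ?thesis by (simp only: d mult_1_left)
qed

lemma cnj_aut_factor: "cnj (aut_factor A \<tau>) = aut_factor A (cnj \<tau>)"
  and cnj_mobius: "cnj (mobius A \<tau>) = mobius A (cnj \<tau>)"
  by (simp_all add: aut_factor_def mobius_def)

lemma mobius_has_field_derivative:
  assumes "A \<in> carrier SL2Z" "\<tau> \<in> uhp"
  shows "(mobius A has_field_derivative 1 / (aut_factor A \<tau>)\<^sup>2) (at \<tau> within S)"
proof -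
  note nz = aut_factor_nonzero[OF assms]
  note d = SL2Z_of_int[OF assms(1), where 'a = complex]
  have "((\<lambda>\<tau>. of_int (A$1$1) * \<tau> + of_int (A$1$2)) has_field_derivative of_int (A$1$1)) (at \<tau> within S)"
    by (auto intro!: derivative_eq_intros)
  moreover have "(aut_factor A has_field_derivative of_int (A$2$1)) (at \<tau> within S)"
    unfolding aut_factor_def[abs_def] by (auto intro!: derivative_eq_intros)
  ultimately have "(mobius A has_field_derivative
      (of_int (A$1$1) * aut_factor A \<tau> - (of_int (A$1$1) * \<tau> + of_int (A$1$2)) * of_int (A$2$1))
        / (aut_factor A \<tau> * aut_factor A \<tau>)) (at \<tau> within S)"
    unfolding mobius_def[abs_def] using nz by (rule DERIV_divide)
  moreover have "of_int (A$1$1) * aut_factor A \<tau> - (of_int (A$1$1) * \<tau> + of_int (A$1$2)) * of_int (A$2$1)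
      = of_int (A$1$1) * of_int (A$2$2) - of_int (A$1$2) * of_int (A$2$1)"
    by (simp add: aut_factor_def algebra_simps)
  ultimately show ?thesis by (simp only: d power2_eq_square)
qed

lemma open_uhp: "open uhp" and convex_uhp: "convex uhp"
  by (simp_all add: uhp_def open_halfspace_Im_gt convex_halfspace_Im_gt)

lemma slash_mult:
  assumes "A \<in> carrier SL2Z" "B \<in> carrier SL2Z" "\<tau> \<in> uhp"
  shows "slash k f (A ** B) \<tau> = slash k (slash k f A) B \<tau>"
  unfolding slash_def mobius_mult[OF assms] aut_factor_mult[OF assms(2,3)] power_int_mult_distrib
  by (simp only: mult_ac)

lemma slash_mobius:
  assumes "A \<in> carrier SL2Z" "\<tau> \<in> uhp"
  shows "F (mobius A \<tau>) = aut_factor A \<tau> ^ k * slash k F A \<tau>"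
  unfolding slash_def using aut_factor_nonzero[OF assms] by (simp add: power_int_minus)

lemma holomorphic_slash:
  assumes "f holomorphic_on uhp" "A \<in> carrier SL2Z" shows "slash k f A holomorphic_on uhp"
proof -
  have "mobius A holomorphic_on uhp"
    unfolding holomorphic_on_def field_differentiable_def
    by (blast intro: mobius_has_field_derivative[OF assms(2)])
  moreover have "(f \<circ> mobius A) holomorphic_on uhp"
    by (rule holomorphic_on_compose_gen[OF _ assms(1)]) (use calculation mobius_uhp[OF assms(2)] in auto)
  moreover have "aut_factor A holomorphic_on uhp"
    unfolding aut_factor_def[abs_def] by (intro holomorphic_intros)
  ultimately show ?thesis unfolding slash_def[abs_def] o_def
    by (intro holomorphic_on_mult holomorphic_on_power_int) (use aut_factor_nonzero[OF assms(2)] in auto)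
qed

lemma countable_int_mat: "countable (G :: (int^2^2) set)"
  by (rule countableI_type)

section \<open>Primitives and their limits at cusps\<close>

definition primitive_on_uhp :: "(complex \<Rightarrow> complex) \<Rightarrow> (complex \<Rightarrow> complex) \<Rightarrow> bool" where
  "primitive_on_uhp \<Phi> F \<longleftrightarrow> (\<forall>\<tau>\<in>uhp. (\<Phi> has_field_derivative F \<tau>) (at \<tau>))"

text \<open>Quantifying over every filter and every sectorial approach gives one notion that serves
  both ends of an integration path and, with \<open>at_top\<close>, the approaches that are moved by
  a matrix.\<close>

definition cusp_limit :: "(complex \<Rightarrow> complex) \<Rightarrow> cusp \<Rightarrow> complex \<Rightarrow> bool" where
  "cusp_limit \<Phi> c L \<longleftrightarrow>
     (\<forall>p Fl. (\<forall>\<^sub>F t in Fl. p t \<in> uhp) \<longrightarrow> tends_to_cusp p c Fl \<longrightarrow> ((\<lambda>t. \<Phi> (p t)) \<longlongrightarrow> L) Fl)"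

lemma cusp_limitD:
  "cusp_limit \<Phi> c L \<Longrightarrow> \<forall>\<^sub>F t in Fl. p t \<in> uhp \<Longrightarrow> tends_to_cusp p c Fl \<Longrightarrow> ((\<lambda>t. \<Phi> (p t)) \<longlongrightarrow> L) Fl"
  by (simp add: cusp_limit_def)

lemma primitive_on_uhpD: "primitive_on_uhp \<Phi> F \<Longrightarrow> \<tau> \<in> uhp \<Longrightarrow> (\<Phi> has_field_derivative F \<tau>) (at \<tau> within S)"
  by (simp add: primitive_on_uhp_def has_field_derivative_at_within)

text \<open>On a compact subpath the integral is a difference of values of the primitive; the two
  ends tend to their cusps independently of each other.\<close>

lemma cusp_path_integral_tendsto:
  assumes prim: "primitive_on_uhp \<Phi> F" and LA: "cusp_limit \<Phi> A LA" and LB: "cusp_limit \<Phi> B LB"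
    and p: "cusp_path A B p"
  shows "((\<lambda>(s, t). contour_integral (subpath s t p) F) \<longlongrightarrow> LB - LA) (at_right 0 \<times>\<^sub>F at_left 1)"
proof -
  have img: "\<And>t. 0 < t \<Longrightarrow> t < 1 \<Longrightarrow> p t \<in> uhp"
    and C1: "\<And>s t. 0 < s \<Longrightarrow> s < t \<Longrightarrow> t < 1 \<Longrightarrow> p piecewise_C1_differentiable_on {s..t}"
    and tc: "tends_to_cusp p A (at_right 0)" "tends_to_cusp p B (at_left 1)"
    using p by (auto simp: cusp_path_def)
  have "\<forall>\<^sub>F t in at_right (0::real). p t \<in> uhp"
    by (rule eventually_mono[OF eventually_at_right_real[OF zero_less_one]]) (auto intro: img)
  hence 1: "((\<lambda>t. \<Phi> (p t)) \<longlongrightarrow> LA) (at_right 0)" using LA tc by (blast intro: cusp_limitD)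
  have "\<forall>\<^sub>F t in at_left (1::real). p t \<in> uhp"
    by (rule eventually_mono[OF eventually_at_left_real[OF zero_less_one]]) (auto intro: img)
  hence 2: "((\<lambda>t. \<Phi> (p t)) \<longlongrightarrow> LB) (at_left 1)" using LB tc by (blast intro: cusp_limitD)
  \<comment> \<open>The two parameters vary independently, so \<open>s < t\<close> has to be forced;
    keeping them on opposite sides of 1/2 does it.\<close>
  have ev: "\<forall>\<^sub>F x in at_right 0 \<times>\<^sub>F at_left 1. 0 < fst x \<and> fst x < (1/2::real) \<and> 1/2 < snd x \<and> snd x < (1::real)"
    unfolding eventually_prod_filter
    using eventually_at_right_real[of 0 "1/2::real"] eventually_at_left_real[of "1/2::real" 1]
    by (intro exI[of _ "\<lambda>x. x \<in> {0<..<1/2}"] exI[of _ "\<lambda>x. x \<in> {1/2<..<1}"]) auto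
  have "((\<lambda>x. \<Phi> (p (snd x)) - \<Phi> (p (fst x))) \<longlongrightarrow> LB - LA) (at_right 0 \<times>\<^sub>F at_left 1)"
    by (intro tendsto_diff filterlim_compose[OF 1] filterlim_compose[OF 2] filterlim_fst filterlim_snd)
  moreover have "\<forall>\<^sub>F x in at_right 0 \<times>\<^sub>F at_left 1.
       \<Phi> (p (snd x)) - \<Phi> (p (fst x)) = (case x of (s, t) \<Rightarrow> contour_integral (subpath s t p) F)"
    using ev
  proof eventually_elim
    case (elim x)
    obtain s t where x: "x = (s, t)" by force
    have st: "0 < s" "s < t" "t < 1" using elim x by auto
    have "subpath s t p = p \<circ> (\<lambda>x. (t - s) *\<^sub>R x + s)"
      by (auto simp: subpath_def)
    moreover have "(p \<circ> (\<lambda>x. (t - s) *\<^sub>R x + s)) piecewise_C1_differentiable_on {0..1}"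
    proof (rule piecewise_C1_differentiable_compose)
      show "(\<lambda>x. (t - s) *\<^sub>R x + s) piecewise_C1_differentiable_on {0..1}"
        by (intro C1_differentiable_imp_piecewise C1_differentiable_on_add C1_differentiable_on_scaleR 
            C1_differentiable_on_ident C1_differentiable_on_const)
      have "(\<lambda>x. (t - s) *\<^sub>R x + s) ` {0..1} = {s..t}"
        using st image_affinity_atLeastAtMost[of "t - s" s 0 1] by simp
      thus "p piecewise_C1_differentiable_on (\<lambda>x. (t - s) *\<^sub>R x + s) ` {0..1}"
        using C1 st by simp
      show "finite ({0..1} \<inter> (\<lambda>x. (t - s) *\<^sub>R x + s) -` {x})" for x
      proof (rule finite_subset)
        show "{0..1} \<inter> (\<lambda>x. (t - s) *\<^sub>R x + s) -` {x} \<subseteq> {(x - s) / (t - s)}"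
          using st by (auto simp: field_simps)
      qed simp
    qed
    ultimately have vp: "valid_path (subpath s t p)" by (simp add: valid_path_def)
    have "path_image (subpath s t p) = p ` {s..t}"
      using st by (simp add: path_image_subpath)
    also have "\<dots> \<subseteq> uhp" using img st by auto
    finally have "path_image (subpath s t p) \<subseteq> uhp" .
    from contour_integral_primitive[OF primitive_on_uhpD[OF prim] vp this]
    show ?case using contour_integral_unique by (simp add: x)
  qed
  ultimately show ?thesis by (rule Lim_transform_eventually)
qed

text \<open>The path \<open>p\<close> secures uniqueness: without any path from \<open>A\<close> to
  \<open>B\<close>, every number would satisfy the defining condition.\<close>

lemma line_integral_eq:
  assumes "primitive_on_uhp \<Phi> F" "cusp_limit \<Phi> A LA" "cusp_limit \<Phi> B LB" "cusp_path A B p"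
  shows "line_integral A B F = LB - LA"
  unfolding line_integral_def
proof (rule the_equality)
  show "\<forall>p. cusp_path A B p \<longrightarrow>
      ((\<lambda>(s, t). contour_integral (subpath s t p) F) \<longlongrightarrow> LB - LA) (at_right 0 \<times>\<^sub>F at_left 1)"
    using cusp_path_integral_tendsto[OF assms(1-3)] by blast
next
  fix I assume "\<forall>p. cusp_path A B p \<longrightarrow>
      ((\<lambda>(s, t). contour_integral (subpath s t p) F) \<longlongrightarrow> I) (at_right 0 \<times>\<^sub>F at_left 1)"
  moreover have "at_right (0::real) \<times>\<^sub>F at_left (1::real) \<noteq> bot"
    by (simp add: prod_filter_eq_bot trivial_limit_at_right_real trivial_limit_at_left_real)
  ultimately show "I = LB - LA"
    using assms(4) cusp_path_integral_tendsto[OF assms] tendsto_unique by blast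
qed

lemma cusp_path_0_infinity: "cusp_path (Rat_cusp 0) Inf_cusp (\<lambda>t. \<i> * of_real (t / (1 - t)))"
proof -
  have "(\<lambda>t::real. \<i> * of_real (t / (1 - t)) :: complex) C1_differentiable_on {s..t}" if "t < 1" for s t
    unfolding C1_differentiable_on_def
  proof (intro exI conjI ballI)
    fix x assume x: "x \<in> {s..t}"
    have "((\<lambda>t::real. t / (1 - t)) has_real_derivative 1 / (1 - x)^2) (at x)"
      using x that by (auto intro!: derivative_eq_intros simp: power2_eq_square)
    thus "((\<lambda>t::real. \<i> * of_real (t / (1 - t)) :: complex) has_vector_derivative \<i> * of_real (1 / (1 - x)^2)) (at x)"
      by (intro has_vector_derivative_mult_right has_vector_derivative_of_real)
  qed (use that in \<open>auto intro!: continuous_intros\<close>)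
  moreover have "((\<lambda>t::real. \<i> * of_real (t / (1 - t)) :: complex) \<longlongrightarrow> of_rat 0) (at_right 0)"
    by (auto intro!: tendsto_eq_intros)
  moreover have "filterlim (\<lambda>t::real. t / (1 - t)) at_top (at_left 1)"
    by real_asymp
  moreover have "\<forall>\<^sub>F t in at_right 0. (0::real) \<le> 1 * (t / (1 - t))"
    using eventually_at_right_real[of "0::real" 1] by (rule eventually_mono) auto
  moreover have "\<forall>\<^sub>F t in at_left 1. (0::real) \<le> 1 * (t / (1 - t))"
    using eventually_at_left_real[of "0::real" 1] by (rule eventually_mono) auto
  ultimately show ?thesis
    by (auto simp: cusp_path_def uhp_def simp del: of_real_divide
        intro!: C1_differentiable_imp_piecewise exI[of _ "1::real"])
qed

text \<open>A parabola is taken instead of the geodesic: it is polynomial, and it leaves both cusps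
  with nonzero slope and so stays in a sector. On each half of the interval the constant 4
  works.\<close>

lemma cusp_path_minus1_1: "cusp_path (Rat_cusp (-1)) (Rat_cusp 1) (\<lambda>t. Complex (2 * t - 1) (t * (1 - t)))"
proof -
  have C: "(\<lambda>t. Complex (2 * t - 1) (t * (1 - t))) = (\<lambda>t. of_real (2 * t - 1) + \<i> * of_real (t * (1 - t)))"
    by (auto simp: complex_eq_iff)
  have "(\<lambda>t::real. Complex (2 * t - 1) (t * (1 - t))) C1_differentiable_on {s..t}" for s t
    unfolding C C1_differentiable_on_def
  proof (intro exI conjI ballI)
    fix x :: real
    have "((\<lambda>t. 2 * t - 1) has_real_derivative 2) (at x)" "((\<lambda>t. t * (1 - t)) has_real_derivative 1 - 2 * x) (at x)"
      by (auto intro!: derivative_eq_intros)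
    thus "((\<lambda>t. of_real (2 * t - 1) + \<i> * of_real (t * (1 - t)) :: complex) has_vector_derivative
        of_real 2 + \<i> * of_real (1 - 2 * x)) (at x)"
      by (intro has_vector_derivative_add has_vector_derivative_mult_right has_vector_derivative_of_real)
  qed (intro continuous_intros)
  moreover have "((\<lambda>t::real. Complex (2 * t - 1) (t * (1 - t))) \<longlongrightarrow> of_rat (-1)) (at_right 0)"
    unfolding C by (auto intro!: tendsto_eq_intros)
  moreover have "((\<lambda>t::real. Complex (2 * t - 1) (t * (1 - t))) \<longlongrightarrow> of_rat 1) (at_left 1)"
    unfolding C by (auto intro!: tendsto_eq_intros)
  moreover have "\<forall>\<^sub>F t in at_right 0. \<bar>2 * t - 1 - (-1)\<bar> \<le> 4 * (t * (1 - t :: real))"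
    using eventually_at_right_real[of "0::real" "1/2", OF half_gt_zero[OF zero_less_one]] 
    by (rule eventually_mono) auto
  moreover have "\<forall>\<^sub>F t in at_left 1. \<bar>2 * t - 1 - 1\<bar> \<le> 4 * (t * (1 - t :: real))"
  proof (rule eventually_mono[OF eventually_at_left_real[of "1/2::real" 1]])
    fix t :: real assume "t \<in> {1/2<..<1}"
    hence "t \<le> 1" "0 \<le> (1 - t) * (4 * t - 2)" by auto
    thus "\<bar>2 * t - 1 - 1\<bar> \<le> 4 * (t * (1 - t))" by (simp add: algebra_simps)
  qed simp
  ultimately show ?thesis
    by (auto simp: cusp_path_def uhp_def intro!: C1_differentiable_imp_piecewise)
qed

text \<open>The polynomial factor makes room for powers of \<open>\<tau>\<close> and for automorphy
  factors, which grow with the real part; inside a sector the exponential absorbs it. The height 1/2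
  lies below the lower arc of the standard domain, so the bound holds on all of that domain.\<close>

definition rapid_decay :: "(complex \<Rightarrow> complex) \<Rightarrow> bool" where
  "rapid_decay F \<longleftrightarrow> (\<exists>C c n. C \<ge> 0 \<and> c > 0 \<and>
     (\<forall>\<tau>. Im \<tau> \<ge> 1/2 \<longrightarrow> norm (F \<tau>) \<le> C * (1 + norm \<tau>) ^ n * exp (- c * Im \<tau>)))"

text \<open>The bound is summable in \<open>m\<close>: with \<open>K = 0\<close> it yields convergence along the imaginary axis, and
  with general \<open>K\<close> it carries the limit over to a whole sector.\<close>

lemma rapid_decay_unit_box:
  assumes "rapid_decay F" "primitive_on_uhp \<Phi> F" "K \<ge> 0"
  obtains D where "\<forall>\<^sub>F m in sequentially. \<forall>\<tau>. real m \<le> Im \<tau> \<longrightarrow> Im \<tau> \<le> real m + 1 \<longrightarrow> \<bar>Re \<tau>\<bar> \<le> K * Im \<tau> \<longrightarrow>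
      norm (\<Phi> \<tau> - \<Phi> (\<i> * of_nat m)) \<le> D / (1 + real m) ^ 2"
proof -
  obtain C c n where C: "C \<ge> 0" "c > 0"
    and bd: "\<And>\<tau>. Im \<tau> \<ge> 1/2 \<Longrightarrow> norm (F \<tau>) \<le> C * (1 + norm \<tau>) ^ n * exp (- c * Im \<tau>)"
    using assms(1) by (auto simp: rapid_decay_def)
  \<comment> \<open>Three powers beyond \<open>n\<close>: the integrand is then bounded by an
    inverse cube, the segment has length of order \<open>m\<close>, and an inverse square
    remains.\<close>
  have "((\<lambda>y::real. (1 + y) ^ (n + 3) * exp (- c * y)) \<longlongrightarrow> 0) at_top"
    using C by real_asymp
  hence "\<forall>\<^sub>F y in at_top. (1 + y) ^ (n + 3) * exp (- c * y) < 1"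
    by (rule order_tendstoD) simp
  then obtain Y where Y: "\<And>y. y \<ge> Y \<Longrightarrow> (1 + y) ^ (n + 3) * exp (- c * y) < 1"
    by (auto simp: eventually_at_top_linorder)
  define D where "D = C * (K + 1) ^ n"
  have D0: "D \<ge> 0" using C assms by (simp add: D_def)
  have FB: "norm (F \<tau>) \<le> D / (1 + Im \<tau>) ^ 3" if "Im \<tau> \<ge> Y" "Im \<tau> \<ge> 1/2" "\<bar>Re \<tau>\<bar> \<le> K * Im \<tau>" for \<tau>
  proof -
    have "1 + norm \<tau> \<le> 1 + (\<bar>Re \<tau>\<bar> + \<bar>Im \<tau>\<bar>)" using cmod_le[of \<tau>] by simp
    also have "\<dots> \<le> (K + 1) * (1 + Im \<tau>)" using that assms by (simp add: algebra_simps)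
    finally have "(1 + norm \<tau>) ^ n \<le> ((K + 1) * (1 + Im \<tau>)) ^ n" by (intro power_mono) auto
    hence "norm (F \<tau>) \<le> C * ((K + 1) * (1 + Im \<tau>)) ^ n * exp (- c * Im \<tau>)"
      using bd[OF that(2)] C by (elim order_trans) (intro mult_right_mono mult_left_mono, auto)
    also have "\<dots> = D * ((1 + Im \<tau>) ^ (n + 3) * exp (- c * Im \<tau>)) / (1 + Im \<tau>) ^ 3"
      using that by (simp add: D_def power_mult_distrib power_add)
    also have "\<dots> \<le> D * 1 / (1 + Im \<tau>) ^ 3"
      using Y[OF that(1)] that D0 by (intro divide_right_mono mult_left_mono) auto
    finally show ?thesis by simp
  qed
  have "norm (\<Phi> \<tau> - \<Phi> (\<i> * of_nat m)) \<le> (D * (K + 1)) / (1 + real m) ^ 2"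
    if m: "real m \<ge> Y" "m \<ge> 1" and \<tau>: "real m \<le> Im \<tau>" "Im \<tau> \<le> real m + 1" "\<bar>Re \<tau>\<bar> \<le> K * Im \<tau>" for m \<tau>
  proof -
    define S where "S = closed_segment (\<i> * of_nat m) \<tau>"
    have S: "Im z \<ge> real m" "\<bar>Re z\<bar> \<le> K * Im z" if "z \<in> S" for z
    proof -
      \<comment> \<open>The sector above height \<open>m\<close> is an intersection of half-planes,
        hence convex, and contains the whole segment.\<close>
      let ?R = "{z. Im z \<ge> real m} \<inter> {z. Re z - K * Im z \<le> 0} \<inter> {z. - Re z - K * Im z \<le> 0}"
      have "convex {z. Im z \<ge> real m}" by (rule convex_halfspace_Im_ge)
      moreover have "convex {z. Re z - K * Im z \<le> 0}" "convex {z. - Re z - K * Im z \<le> 0}"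
        using convex_halfspace_le[of "Complex 1 (-K)" 0] convex_halfspace_le[of "Complex (-1) (-K)" 0]
        by (simp_all add: inner_complex_def)
      ultimately have "convex ?R" by (intro convex_Int)
      moreover have "\<i> * of_nat m \<in> ?R"
        using assms by auto
      moreover have "\<tau> \<in> ?R"
        using \<tau> by auto
      ultimately have "S \<subseteq> ?R"
        unfolding S_def by (intro closed_segment_subset)
      hence "z \<in> ?R"
        using that by blast
      thus "Im z \<ge> real m" "\<bar>Re z\<bar> \<le> K * Im z" by auto
    qed
    have nb: "norm (\<Phi> \<tau> - \<Phi> (\<i> * of_nat m)) \<le> D / (1 + real m) ^ 3 * norm (\<tau> - \<i> * of_nat m)"
    proof (rule field_differentiable_bound)
      show "convex S" by (simp add: S_def)
      show "\<i> * of_nat m \<in> S" "\<tau> \<in> S" by (simp_all add: S_def)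
      fix z assume z: "z \<in> S"
      have "z \<in> uhp" using S[OF z] m by (simp add: uhp_def)
      thus "(\<Phi> has_field_derivative F z) (at z within S)" by (rule primitive_on_uhpD[OF assms(2)])
      have "norm (F z) \<le> D / (1 + Im z) ^ 3" using S[OF z] m by (intro FB) auto
      also have "\<dots> \<le> D / (1 + real m) ^ 3" 
        using S[OF z] m D0 by (intro divide_left_mono power_mono mult_pos_pos) auto
      finally show "norm (F z) \<le> D / (1 + real m) ^ 3" .
    qed
    have "norm (\<tau> - \<i> * of_nat m) \<le> (K + 1) * (1 + real m)"
    proof -
      have "norm (\<tau> - \<i> * of_nat m) \<le> \<bar>Re \<tau>\<bar> + \<bar>Im \<tau> - real m\<bar>"
        using cmod_le[of "\<tau> - \<i> * of_nat m"] by simp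
      also have "\<dots> \<le> K * Im \<tau> + 1" using \<tau> by simp
      also have "\<dots> \<le> K * (1 + real m) + 1 * (1 + real m)"
        using \<tau> assms(3) by (intro add_mono mult_left_mono) auto
      finally show ?thesis by (simp add: algebra_simps)
    qed
    hence "D / (1 + real m) ^ 3 * norm (\<tau> - \<i> * of_nat m) \<le> D / (1 + real m) ^ 3 * ((K + 1) * (1 + real m))"
      using D0 by (intro mult_left_mono) auto
    also have "\<dots> = (D * (K + 1)) / (1 + real m) ^ 2"
      by (simp add: power3_eq_cube power2_eq_square)
    finally show ?thesis using nb by (rule order_trans[rotated])
  qed
  moreover have "\<forall>\<^sub>F m in sequentially. real m \<ge> Y \<and> m \<ge> 1"
    using eventually_ge_at_top[of "nat \<lceil>Y\<rceil>"] eventually_ge_at_top[of "1::nat"]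
    by eventually_elim linarith
  ultimately show ?thesis
    by (intro that[of "D * (K + 1)"]) (auto elim!: eventually_mono)
qed

text \<open>Along the points \<open>\<i> * m\<close> the increments are summable, so the telescoping
  series converges. Every other point of a sector is compared with the one at the integer part of
  its height.\<close>

lemma rapid_decay_limit_infinity:
  assumes F: "rapid_decay F" and \<Phi>: "primitive_on_uhp \<Phi> F"
  shows "\<exists>L. cusp_limit \<Phi> Inf_cusp L"
proof -
  obtain D where D: "\<forall>\<^sub>F m in sequentially. \<forall>\<tau>. real m \<le> Im \<tau> \<longrightarrow> Im \<tau> \<le> real m + 1 \<longrightarrow> \<bar>Re \<tau>\<bar> \<le> 0 * Im \<tau> \<longrightarrow>
      norm (\<Phi> \<tau> - \<Phi> (\<i> * of_nat m)) \<le> D / (1 + real m) ^ 2"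
    using rapid_decay_unit_box[OF F \<Phi>, of 0] by auto
  have "summable (\<lambda>m. D * inverse (real (Suc m) ^ 2))"
    using inverse_power_summable[OF order_refl, where 'a = real]
    by (intro summable_mult) (subst summable_Suc_iff)
  moreover have "\<forall>\<^sub>F m in sequentially. norm (\<Phi> (\<i> * of_nat (Suc m)) - \<Phi> (\<i> * of_nat m)) \<le> D * inverse (real (Suc m) ^ 2)"
    using D 
  proof eventually_elim
    case (elim m)
    from elim[rule_format, of "\<i> * of_nat (Suc m)"] show ?case by (simp add: divide_inverse add_ac)
  qed
  ultimately have "summable (\<lambda>m. \<Phi> (\<i> * of_nat (Suc m)) - \<Phi> (\<i> * of_nat m))"
    by (rule summable_comparison_test_ev[rotated])
  then obtain s where "(\<lambda>n. \<Sum>m<n. \<Phi> (\<i> * of_nat (Suc m)) - \<Phi> (\<i> * of_nat m)) \<longlonglongrightarrow> s"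
    by (auto simp: summable_def sums_def)
  hence "(\<lambda>n. (\<Phi> (\<i> * of_nat n) - \<Phi> (\<i> * of_nat 0)) + \<Phi> (\<i> * of_nat 0)) \<longlonglongrightarrow> s + \<Phi> (\<i> * of_nat 0)"
    by (subst (asm) sum_lessThan_telescope) (intro tendsto_add tendsto_const)
  then obtain L where L: "(\<lambda>n. \<Phi> (\<i> * of_nat n)) \<longlonglongrightarrow> L" by auto
  have "((\<lambda>t. \<Phi> (p t)) \<longlongrightarrow> L) Fl" if "tends_to_cusp p Inf_cusp Fl" for p Fl
  proof -
    from that obtain K0 where top: "filterlim (\<lambda>t. Im (p t)) at_top Fl"
      and K0: "\<forall>\<^sub>F t in Fl. \<bar>Re (p t)\<bar> \<le> K0 * Im (p t)" by auto
    \<comment> \<open>The sector constant of an approach may be negative, whereas the box estimate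
      requires \<open>K \<ge> 0\<close>.\<close>
    define K where "K = max K0 0"
    obtain E where E: "\<forall>\<^sub>F m in sequentially. \<forall>\<tau>. real m \<le> Im \<tau> \<longrightarrow> Im \<tau> \<le> real m + 1 \<longrightarrow> \<bar>Re \<tau>\<bar> \<le> K * Im \<tau> \<longrightarrow>
        norm (\<Phi> \<tau> - \<Phi> (\<i> * of_nat m)) \<le> E / (1 + real m) ^ 2"
      using rapid_decay_unit_box[OF F \<Phi>, of K] by (auto simp: K_def)
    define m where "m = (\<lambda>t. nat \<lfloor>Im (p t)\<rfloor>)"
    have m: "filterlim m sequentially Fl"
      unfolding m_def by (intro filterlim_compose[OF filterlim_nat_sequentially] filterlim_compose[OF filterlim_floor_sequentially] top)
    have "\<forall>\<^sub>F t in Fl. norm (\<Phi> (p t) - \<Phi> (\<i> * of_nat (m t))) \<le> E / (1 + real (m t)) ^ 2"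
      using K0 
        eventually_compose_filterlim[OF E m] filterlim_at_top_dense[THEN iffD1, OF top, rule_format, of 0]
    proof eventually_elim
      case (elim t)
      have "\<bar>Re (p t)\<bar> \<le> K * Im (p t)"
        by (rule order_trans[OF elim(1) mult_right_mono]) (use elim in \<open>auto simp: K_def\<close>)
      moreover have "real (m t) \<le> Im (p t)" "Im (p t) \<le> real (m t) + 1" 
        using elim unfolding m_def by linarith+
      ultimately show ?case using elim by (intro elim(2)[rule_format]) auto
    qed
    moreover have "((\<lambda>t. E / (1 + real (m t)) ^ 2) \<longlongrightarrow> 0) Fl"
      by (rule filterlim_compose[OF _ m]) real_asymp
    ultimately have "((\<lambda>t. \<Phi> (p t) - \<Phi> (\<i> * of_nat (m t))) \<longlongrightarrow> 0) Fl"
      by (rule Lim_null_comparison)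
    from tendsto_add[OF this filterlim_compose[OF L m]] show ?thesis by simp
  qed
  thus ?thesis unfolding cusp_limit_def by blast
qed

text \<open>The matrix sends infinity to \<open>a\<close>. Composing with it turns
  \<open>\<Phi>\<close> into a primitive of the transformed integrand, to which the limit at
  infinity applies.\<close>

lemma rapid_decay_limit_integer:
  fixes a :: int
  assumes \<Phi>: "primitive_on_uhp \<Phi> F"
    and F: "rapid_decay (\<lambda>\<tau>. F (mobius (sl2 a (-1) 1 0) \<tau>) / (aut_factor (sl2 a (-1) 1 0) \<tau>)\<^sup>2)"
  shows "\<exists>L. cusp_limit \<Phi> (Rat_cusp (of_int a)) L"
proof -
  define A where "A = sl2 a (-1) 1 0"
  have A: "A \<in> carrier SL2Z" by (simp add: A_def SL2Z_iff)
  have "primitive_on_uhp (\<Phi> \<circ> mobius A) (\<lambda>\<tau>. F (mobius A \<tau>) * (1 / (aut_factor A \<tau>)\<^sup>2))"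
    unfolding primitive_on_uhp_def
    by (intro ballI DERIV_chain primitive_on_uhpD[OF \<Phi>] mobius_has_field_derivative mobius_uhp A)
  then obtain L where L: "cusp_limit (\<Phi> \<circ> mobius A) Inf_cusp L"
    using rapid_decay_limit_infinity[OF F] by (auto simp: A_def)
  have "((\<lambda>t. \<Phi> (p t)) \<longlongrightarrow> L) Fl"
    if p: "\<forall>\<^sub>F t in Fl. p t \<in> uhp" "tends_to_cusp p (Rat_cusp (of_int a)) Fl" for p Fl
  proof -
    from p obtain C where lim: "(p \<longlongrightarrow> of_int a) Fl"
      and C: "\<forall>\<^sub>F t in Fl. \<bar>Re (p t) - of_int a\<bar> \<le> C * Im (p t)" by auto
    define q where "q = (\<lambda>t. mobius (sl2_inv A) (p t))"
    have aut: "aut_factor (sl2_inv A) \<tau> = of_int a - \<tau>" for \<tau>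
      by (simp add: aut_factor_def sl2_inv_def A_def)
    have Im_q: "Im (q t) = Im (p t) / (cmod (p t - of_int a))\<^sup>2" for t
      unfolding q_def Im_mobius[OF sl2_inv_closed[OF A]] aut by (simp add: norm_minus_commute)
    have Re_q: "\<bar>Re (q t)\<bar> = \<bar>Re (p t) - of_int a\<bar> / (cmod (p t - of_int a))\<^sup>2" for t
    proof -
      have "q t = 1 / (of_int a - p t)" by (simp add: q_def mobius_def aut) (simp add: sl2_inv_def A_def)
      thus ?thesis by (simp add: Re_divide cmod_power2 power2_commute abs_divide)
        (simp add: abs_minus_commute)
    qed
    have q: "\<forall>\<^sub>F t in Fl. q t \<in> uhp"
      using p(1) by eventually_elim (simp add: q_def mobius_uhp sl2_inv_closed A)
    \<comment> \<open>Inversion divides the height and the horizontal distance from \<open>a\<close>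
      by the same number, so the sector constant is unchanged.\<close>
    have "\<forall>\<^sub>F t in Fl. \<bar>Re (q t)\<bar> \<le> C * Im (q t)"
      using C by eventually_elim (simp add: Re_q Im_q divide_right_mono)
    moreover have "filterlim (\<lambda>t. Im (q t)) at_top Fl"
    proof (rule filterlim_at_top_mono)
      have "((\<lambda>t. Im (p t)) \<longlongrightarrow> 0) Fl" using tendsto_Im[OF lim] by simp
      moreover have "\<forall>\<^sub>F t in Fl. Im (p t) > 0" using p(1) by (simp add: uhp_def)
      ultimately have "filterlim (\<lambda>t. Im (p t)) (at_right 0) Fl"
        by (auto simp: filterlim_at elim: eventually_mono)
      hence "filterlim (\<lambda>t. inverse (Im (p t))) at_top Fl"
        by (rule filterlim_compose[OF filterlim_inverse_at_top_right])
      thus "filterlim (\<lambda>t. inverse (C\<^sup>2 + 1) * inverse (Im (p t))) at_top Fl"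
        by (intro filterlim_tendsto_pos_mult_at_top[OF tendsto_const])
           (simp_all add: add_nonneg_pos)
      \<comment> \<open>Here the sector condition is essential: it bounds the squared distance from
        \<open>a\<close> by \<open>C\<^sup>2 + 1\<close> times the squared height, whereas for a
        tangential approach the inverted height can stay bounded.\<close>
      show "\<forall>\<^sub>F t in Fl. inverse (C\<^sup>2 + 1) * inverse (Im (p t)) \<le> Im (q t)"
        using p(1) C
      proof eventually_elim
        case (elim t)
        have y: "Im (p t) > 0" using elim by (simp add: uhp_def)
        have "\<bar>Re (p t) - of_int a\<bar>\<^sup>2 \<le> (C * Im (p t))\<^sup>2"
          using elim by (intro power_mono) auto
        hence *: "(cmod (p t - of_int a))\<^sup>2 \<le> (C\<^sup>2 + 1) * (Im (p t))\<^sup>2"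
          by (simp add: cmod_power2 power_mult_distrib algebra_simps)
        have "p t - of_int a \<noteq> 0" using y by (auto simp: complex_eq_iff)
        hence "(cmod (p t - of_int a))\<^sup>2 > 0" by simp
        hence "Im (p t) / ((C\<^sup>2 + 1) * (Im (p t))\<^sup>2) \<le> Im (q t)"
          unfolding Im_q using y * by (intro divide_left_mono mult_pos_pos) (auto simp: add_nonneg_pos)
        moreover have "y / (d * y\<^sup>2) = inverse d * inverse y" if "y > 0" for d y :: real
          using that by (simp add: power2_eq_square divide_inverse)
        ultimately show ?case using y by metis
      qed
    qed
    ultimately have "tends_to_cusp q Inf_cusp Fl" by auto
    from cusp_limitD[OF L q this] have "((\<lambda>t. \<Phi> (mobius A (q t))) \<longlongrightarrow> L) Fl" by simp
    moreover have "\<forall>\<^sub>F t in Fl. \<Phi> (mobius A (q t)) = \<Phi> (p t)"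
      using p(1) by eventually_elim (simp add: q_def mobius_inv_cancel A)
    ultimately show ?thesis by (rule Lim_transform_eventually)
  qed
  thus ?thesis unfolding cusp_limit_def by blast
qed

section \<open>Cusp forms\<close>

text \<open>The decay of all translates is recorded instead of their expansions, since these
  estimates are what enters the analysis; the constants may depend on \<open>A\<close>.\<close>

definition cuspidal :: "nat \<Rightarrow> (complex \<Rightarrow> complex) \<Rightarrow> bool" where
  "cuspidal k F \<longleftrightarrow> F holomorphic_on uhp \<and>
     (\<forall>A\<in>carrier SL2Z. \<exists>C c. C \<ge> 0 \<and> c > 0 \<and>
        (\<forall>\<tau>. Im \<tau> \<ge> 1/2 \<longrightarrow> norm (slash k F A \<tau>) \<le> C * exp (- c * Im \<tau>)))"

lemma norm_linear_le: "norm (of_int a * \<tau> + of_int b :: complex) \<le> (\<bar>of_int a\<bar> + \<bar>of_int b\<bar>) * (1 + norm \<tau>)"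
proof -
  have "norm (of_int a * \<tau> + of_int b :: complex) \<le> \<bar>of_int a\<bar> * norm \<tau> + \<bar>of_int b\<bar>"
    by (rule order_trans[OF norm_triangle_ineq]) (simp add: norm_mult)
  also have "\<dots> \<le> (\<bar>of_int a\<bar> + \<bar>of_int b\<bar>) * (1 + norm \<tau>)" by (simp add: algebra_simps)
  finally show ?thesis .
qed

text \<open>Of the \<open>k\<close> automorphy factors, \<open>n\<close> clear the denominator of
  \<open>mobius A \<tau> ^ n\<close> and two cancel the square; the remaining
  \<open>k - 2 - n\<close> stand in the numerator and grow only polynomially.\<close>

lemma cuspidal_rapid_decay:
  assumes F: "cuspidal k F" and n: "n + 2 \<le> k" and A: "A \<in> carrier SL2Z"
  shows "rapid_decay (\<lambda>\<tau>. mobius A \<tau> ^ n * F (mobius A \<tau>) / (aut_factor A \<tau>)\<^sup>2)"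
proof -
  obtain C c where C: "C \<ge> 0" "c > 0"
    and bd: "\<And>\<tau>. Im \<tau> \<ge> 1/2 \<Longrightarrow> norm (slash k F A \<tau>) \<le> C * exp (- c * Im \<tau>)"
    using F A by (auto simp: cuspidal_def)
  define P Q :: real where "P = \<bar>of_int (A$1$1)\<bar> + \<bar>of_int (A$1$2)\<bar>" and "Q = \<bar>of_int (A$2$1)\<bar> + \<bar>of_int (A$2$2)\<bar>"
  define m where "m = k - 2 - n"
  have k: "k = n + m + 2" using n by (simp add: m_def)
  have P: "P \<ge> 0" "Q \<ge> 0" by (simp_all add: P_def Q_def)
  have "norm (mobius A \<tau> ^ n * F (mobius A \<tau>) / (aut_factor A \<tau>)\<^sup>2)
      \<le> (P ^ n * Q ^ m * C) * (1 + norm \<tau>) ^ (n + m) * exp (- c * Im \<tau>)" if \<tau>: "Im \<tau> \<ge> 1/2" for \<tau>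
  proof -
    have u: "\<tau> \<in> uhp" using \<tau> by (simp add: uhp_def)
    define num where "num = of_int (A$1$1) * \<tau> + of_int (A$1$2)"
    have nz: "aut_factor A \<tau> \<noteq> 0" by (rule aut_factor_nonzero[OF A u])
    have "mobius A \<tau> ^ n * F (mobius A \<tau>) / (aut_factor A \<tau>)\<^sup>2 = num ^ n * aut_factor A \<tau> ^ m * slash k F A \<tau>"
      using nz by (subst slash_mobius[OF A u, of F k]) (simp add: mobius_def num_def[symmetric] power_divide k power_add power2_eq_square)
    also have "norm \<dots> \<le> (P * (1 + norm \<tau>)) ^ n * (Q * (1 + norm \<tau>)) ^ m * (C * exp (- c * Im \<tau>))"
      unfolding norm_mult norm_power num_def aut_factor_def P_def Q_def
      by (intro mult_mono power_mono norm_linear_le bd[OF \<tau>]) (use C in auto)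
    finally show ?thesis by (simp add: power_mult_distrib power_add mult_ac)
  qed
  thus ?thesis unfolding rapid_decay_def using C P
    by (intro exI[of _ "P ^ n * Q ^ m * C"] exI[of _ c] exI[of _ "n + m"]) auto
qed

definition cusp_value :: "(complex \<Rightarrow> complex) \<Rightarrow> cusp \<Rightarrow> complex" where
  "cusp_value \<Phi> c = (SOME L. cusp_limit \<Phi> c L)"

lemma cuspidal_limits:
  assumes F: "cuspidal k F" and n: "n + 2 \<le> k" and \<Phi>: "primitive_on_uhp \<Phi> (\<lambda>\<tau>. \<tau> ^ n * F \<tau>)"
  shows "cusp_limit \<Phi> Inf_cusp (cusp_value \<Phi> Inf_cusp)"
    and "cusp_limit \<Phi> (Rat_cusp (of_int a)) (cusp_value \<Phi> (Rat_cusp (of_int a)))"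
proof -
  have "mat 1 \<in> carrier SL2Z" "sl2 a (-1) 1 0 \<in> carrier SL2Z" by (simp_all add: SL2Z_iff)
  note cuspidal_rapid_decay[OF F n this(1)] cuspidal_rapid_decay[OF F n this(2)]
  hence "\<exists>L. cusp_limit \<Phi> Inf_cusp L" "\<exists>L. cusp_limit \<Phi> (Rat_cusp (of_int a)) L"
    using rapid_decay_limit_infinity[OF _ \<Phi>] rapid_decay_limit_integer[OF \<Phi>, of a]
    by (simp_all add: aut_factor_def[of "mat 1"])
  thus "cusp_limit \<Phi> Inf_cusp (cusp_value \<Phi> Inf_cusp)"
    and "cusp_limit \<Phi> (Rat_cusp (of_int a)) (cusp_value \<Phi> (Rat_cusp (of_int a)))"
    unfolding cusp_value_def by (auto intro: someI_ex)
qed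

text \<open>Convergence at \<open>\<i> / 4\<close> bounds the coefficients geometrically. At height
  1/2 or more this leaves a geometric series of ratio at most \<open>q0 < 1\<close>, and since the
  constant term vanishes the sum carries a factor \<open>r\<close>, that is, the
  exponential.\<close>

lemma q_expansion_decay:
  assumes q: "q_expansion N F a" and a0: "a 0 = 0" and N: "N \<ge> 1"
  shows "\<exists>C c. C \<ge> 0 \<and> c > 0 \<and> (\<forall>\<tau>. Im \<tau> \<ge> 1/2 \<longrightarrow> norm (F \<tau>) \<le> C * exp (- c * Im \<tau>))"
proof -
  define c where "c = 2 * pi / real N"
  have c: "c > 0" using N by (simp add: c_def)
  define e where "e = (\<lambda>(n::nat) \<tau>. exp (2 * of_real pi * \<i> * of_nat n * \<tau> / of_nat N) :: complex)"
  have norm_e: "norm (e n \<tau>) = exp (- c * Im \<tau>) ^ n" for n \<tau>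
    unfolding e_def norm_exp_eq_Re exp_of_nat_mult[symmetric] by (simp add: c_def Re_divide_of_nat)
  have sums: "(\<lambda>n. a n * e n \<tau>) sums F \<tau>" if "\<tau> \<in> uhp" for \<tau>
    using q that by (simp add: q_expansion_def e_def)
  have "(\<lambda>n. a n * e n (\<i> / 4)) \<longlonglongrightarrow> 0"
    by (rule summable_LIMSEQ_zero[OF sums_summable[OF sums]]) (simp add: uhp_def)
  hence "Bseq (\<lambda>n. a n * e n (\<i> / 4))" by (intro convergent_imp_Bseq convergentI)
  then obtain M where M: "\<And>n. norm (a n * e n (\<i> / 4)) \<le> M" unfolding Bseq_def by blast
  have M0: "M \<ge> 0" using norm_ge_zero M order_trans by blast
  define q0 where "q0 = exp (- c * (1/4))"
  have q0: "0 < q0" "q0 < 1" using c by (simp_all add: q0_def)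
  have "norm (F \<tau>) \<le> M / (q0 * (1 - q0)) * exp (- c * Im \<tau>)" if \<tau>: "Im \<tau> \<ge> 1/2" for \<tau>
  proof -
    define r where "r = exp (- c * (Im \<tau> - 1/4))"
    have r: "0 < r" "r \<le> q0" using c \<tau> by (simp_all add: r_def q0_def)
    have er: "exp (- c * Im \<tau>) = q0 * r"
      by (simp add: r_def q0_def exp_add[symmetric] algebra_simps)
    have nb: "norm (a n * e n \<tau>) \<le> M * r ^ n" for n
    proof -
      have "norm (a n * e n \<tau>) = norm (a n * e n (\<i> / 4)) * r ^ n"
        unfolding norm_mult norm_e er by (simp add: q0_def power_mult_distrib)
      also have "\<dots> \<le> M * r ^ n" using M r by (intro mult_right_mono) auto
      finally show ?thesis .
    qed
    have "\<tau> \<in> uhp" using \<tau> by (simp add: uhp_def)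
    from sums[OF this] have "(\<lambda>n. a (Suc n) * e (Suc n) \<tau>) sums F \<tau>"
      by (subst sums_Suc_iff) (simp add: a0)
    hence F: "F \<tau> = (\<Sum>n. a (Suc n) * e (Suc n) \<tau>)" by (rule sums_unique)
    have gs: "(\<lambda>n. M * r * r ^ n) sums (M * r * (1 / (1 - r)))"
      using r q0 by (intro sums_mult geometric_sums) auto
    have "norm (F \<tau>) \<le> (\<Sum>n. M * r * r ^ n)"
      unfolding F using nb[of "Suc _"] by (intro norm_suminf_le sums_summable[OF gs]) (simp add: mult_ac del: of_nat_Suc)
    also have "\<dots> = M * r * (1 / (1 - r))" using sums_unique[OF gs] by simp
    also have "\<dots> \<le> M * r * (1 / (1 - q0))"
      using r q0 M0 by (intro mult_left_mono divide_left_mono) auto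
    also have "\<dots> = M / (q0 * (1 - q0)) * exp (- c * Im \<tau>)"
      unfolding er using q0 by simp
    finally show ?thesis .
  qed
  moreover have "M / (q0 * (1 - q0)) \<ge> 0" using M0 q0 by simp
  ultimately show ?thesis using c by blast
qed

text \<open>Slashing by \<open>A\<close> and then by \<open>B\<close> is slashing by their product,
  so the expansions of \<open>f\<close> at all cusps already contain those of its translate.\<close>

lemma cusp_forms_cuspidal:
  assumes "f \<in> cusp_forms k N chi" "N \<ge> 1" "A \<in> carrier SL2Z"
  shows "cuspidal k (slash k f A)"
  unfolding cuspidal_def
proof (intro conjI ballI)
  show "slash k f A holomorphic_on uhp"
    using assms by (intro holomorphic_slash) (auto simp: cusp_forms_def modular_forms_def)
next
  fix B assume B: "B \<in> carrier SL2Z"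
  obtain a where "q_expansion N (slash k f (A ** B)) a" "a 0 = 0"
    using assms SL2Z_mult_closed[OF assms(3) B] unfolding cusp_forms_def by blast
  from q_expansion_decay[OF this assms(2)]
  show "\<exists>C c. C \<ge> 0 \<and> c > 0 \<and> (\<forall>\<tau>. 1/2 \<le> Im \<tau> \<longrightarrow> norm (slash k (slash k f A) B \<tau>) \<le> C * exp (- c * Im \<tau>))"
    using slash_mult[OF assms(3) B] by (auto simp: uhp_def)
qed

section \<open>Change of variables for the modular action\<close>

definition vec_of_complex :: "complex \<Rightarrow> real ^ 2" where
  "vec_of_complex z = vector [Re z, Im z]"

definition complex_of_vec :: "real ^ 2 \<Rightarrow> complex" where
  "complex_of_vec v = Complex (v $ 1) (v $ 2)"

lemma vec_of_complex_nth [simp]: "vec_of_complex z $ 1 = Re z" "vec_of_complex z $ 2 = Im z"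
  by (simp_all add: vec_of_complex_def)

lemma complex_of_vec_sel [simp]: "Re (complex_of_vec v) = v $ 1" "Im (complex_of_vec v) = v $ 2"
  by (simp_all add: complex_of_vec_def)

lemma complex_vec_inverse [simp]:
  "complex_of_vec (vec_of_complex z) = z" "vec_of_complex (complex_of_vec v) = v"
  by (simp_all add: complex_eq_iff vec_eq_iff forall_2)

lemma bounded_linear_vec_of_complex: "bounded_linear vec_of_complex"
  and bounded_linear_complex_of_vec: "bounded_linear complex_of_vec"
  by (auto intro!: linear_conv_bounded_linear[THEN iffD1] linearI simp: vec_eq_iff forall_2 complex_eq_iff)

lemma measurable_complex_of_vec: "complex_of_vec \<in> borel \<rightarrow>\<^sub>M borel"
  by (intro borel_measurable_continuous_onI linear_continuous_on bounded_linear_complex_of_vec)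

lemma lborel_distr_complex_of_vec: "distr lborel borel complex_of_vec = lborel"
proof (rule lborel_eqI[symmetric])
  fix l u :: complex assume le: "\<And>b. b \<in> Basis \<Longrightarrow> l \<bullet> b \<le> u \<bullet> b"
  have B: "Basis = {axis 1 1, axis 2 1 :: real^2}" by (auto simp: Basis_vec_def UNIV_2)
  have lu: "Re l \<le> Re u" "Im l \<le> Im u" using le[of 1] le[of \<i>] by (auto simp: Basis_complex_def)
  have "complex_of_vec -` box l u = box (vec_of_complex l) (vec_of_complex u)"
    unfolding set_eq_iff by (auto simp: mem_box_cart forall_2 in_box_complex_iff)
  hence "emeasure (distr lborel borel complex_of_vec) (box l u) = emeasure lborel (box (vec_of_complex l) (vec_of_complex u))"
    using measurable_complex_of_vec by (subst emeasure_distr) auto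
  also have "\<dots> = ennreal (\<Prod>b\<in>Basis. (vec_of_complex u - vec_of_complex l) \<bullet> b)"
    using lu by (intro emeasure_lborel_box) (auto simp: B inner_axis)
  also have "(\<Prod>b\<in>Basis. (vec_of_complex u - vec_of_complex l) \<bullet> b) = (\<Prod>b\<in>Basis. (u - l) \<bullet> b)"
  proof -
    have "axis 1 1 \<noteq> (axis 2 1 :: real^2)" by (simp add: axis_eq_axis)
    hence "(\<Prod>b\<in>Basis. (vec_of_complex u - vec_of_complex l) \<bullet> b) = (Re u - Re l) * (Im u - Im l)"
      by (simp add: inner_axis B)
    thus ?thesis by (simp add: Basis_complex_def complex_eq_iff)
  qed
  finally show "emeasure (distr lborel borel complex_of_vec) (box l u) = ennreal (\<Prod>b\<in>Basis. (u - l) \<bullet> b)"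
    by simp
qed simp

text \<open>Completed measures are compared, since a fundamental domain is only assumed to be
  Lebesgue measurable.\<close>

lemma lebesgue_distr_complex_of_vec: "lebesgue = distr lebesgue lebesgue complex_of_vec"
proof -
  have 1: "distr lebesgue lborel complex_of_vec = (lborel :: complex measure)"
    using measurable_complex_of_vec lborel_distr_complex_of_vec
    by (subst distr_completion) (auto cong: distr_cong)
  show ?thesis
    using completion.completion_distr_eq[of complex_of_vec lborel lborel] measurable_complex_of_vec
    by (simp add: 1 measurable_completion)
qed

lemma measurable_complex_of_vec_lebesgue: "complex_of_vec \<in> lebesgue \<rightarrow>\<^sub>M lebesgue"
proof -
  have "completion lborel \<in> UNIV" by simp
  have 1: "distr lebesgue lborel complex_of_vec = (lborel :: complex measure)"
    using measurable_complex_of_vec lborel_distr_complex_of_vec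
    by (subst distr_completion) (auto cong: distr_cong)
  show ?thesis
    by (rule completion.measurable_completion2) (use measurable_complex_of_vec in \<open>auto simp: 1 measurable_completion\<close>)
qed

lemma set_integral_complex_of_vec:
  fixes h :: "complex \<Rightarrow> complex"
  assumes h: "(\<lambda>x. indicat_real S x *\<^sub>R h x) \<in> borel_measurable lebesgue"
  shows "set_integrable lebesgue (complex_of_vec -` S) (vec_of_complex \<circ> h \<circ> complex_of_vec) \<longleftrightarrow> set_integrable lebesgue S h"
    and "set_lebesgue_integral lebesgue (complex_of_vec -` S) (vec_of_complex \<circ> h \<circ> complex_of_vec)
          = vec_of_complex (set_lebesgue_integral lebesgue S h)"
proof -
  let ?H = "\<lambda>x. indicat_real S (complex_of_vec x) *\<^sub>R h (complex_of_vec x)"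
  have eq: "(\<lambda>x. indicat_real (complex_of_vec -` S) x *\<^sub>R (vec_of_complex \<circ> h \<circ> complex_of_vec) x)
      = (\<lambda>x. vec_of_complex (?H x))"
    by (auto simp: fun_eq_iff indicator_def linear_0[OF bounded_linear.linear[OF bounded_linear_vec_of_complex]])
  have 1: "integrable lebesgue ?H \<longleftrightarrow> set_integrable lebesgue S h"
    unfolding set_integrable_def
    using integrable_distr_eq[OF measurable_complex_of_vec_lebesgue h]
    by (simp add: lebesgue_distr_complex_of_vec[symmetric])
  have 2: "integrable lebesgue (\<lambda>x. vec_of_complex (?H x)) \<longleftrightarrow> integrable lebesgue ?H"
    using integrable_bounded_linear[OF bounded_linear_vec_of_complex, of lebesgue ?H]
      integrable_bounded_linear[OF bounded_linear_complex_of_vec, of lebesgue "\<lambda>x. vec_of_complex (?H x)"] by auto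
  show A: "set_integrable lebesgue (complex_of_vec -` S) (vec_of_complex \<circ> h \<circ> complex_of_vec) \<longleftrightarrow> set_integrable lebesgue S h"
    using 1 2 unfolding set_integrable_def[of _ "_ -` _"] eq by simp
  have 3: "integral\<^sup>L lebesgue ?H = set_lebesgue_integral lebesgue S h"
    unfolding set_lebesgue_integral_def
    using integral_distr[OF measurable_complex_of_vec_lebesgue h]
    by (simp add: lebesgue_distr_complex_of_vec[symmetric])
  show "set_lebesgue_integral lebesgue (complex_of_vec -` S) (vec_of_complex \<circ> h \<circ> complex_of_vec)
          = vec_of_complex (set_lebesgue_integral lebesgue S h)"
  proof (cases "integrable lebesgue ?H")
    case True
    show ?thesis unfolding set_lebesgue_integral_def[of _ "_ -` _"] eq 3[symmetric]
      by (rule integral_bounded_linear[OF bounded_linear_vec_of_complex True])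
  next
    \<comment> \<open>Outside the integrable case both Bochner integrals are zero by
      convention.\<close>
    case False
    thus ?thesis unfolding set_lebesgue_integral_def[of _ "_ -` _"] eq 3[symmetric]
      using 2 by (simp add: not_integrable_integral_eq linear_0[OF bounded_linear.linear[OF bounded_linear_vec_of_complex]])
  qed
qed

lemma borel_measurable_lebesgue_uhp:
  fixes h :: "complex \<Rightarrow> 'a::{real_normed_vector, second_countable_topology}"
  assumes "continuous_on uhp h" "S \<in> sets lebesgue" "S \<subseteq> uhp"
  shows "(\<lambda>x. indicat_real S x *\<^sub>R h x) \<in> borel_measurable lebesgue"
proof -
  have "(\<lambda>x. indicat_real uhp x *\<^sub>R h x) \<in> borel_measurable borel"
    using borel_measurable_continuous_on_indicator[OF _ assms(1)] open_uhp by auto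
  hence "(\<lambda>x. indicat_real uhp x *\<^sub>R h x) \<in> borel_measurable lebesgue"
    by (simp add: measurable_completion)
  hence "(\<lambda>x. indicat_real S x *\<^sub>R (indicat_real uhp x *\<^sub>R h x)) \<in> borel_measurable lebesgue"
    by (rule borel_measurable_scaleR[OF borel_measurable_indicator[OF assms(2)]])
  also have "(\<lambda>x. indicat_real S x *\<^sub>R (indicat_real uhp x *\<^sub>R h x)) = (\<lambda>x. indicat_real S x *\<^sub>R h x)"
    using assms(3) by (auto simp: fun_eq_iff indicator_def)
  finally show ?thesis .
qed

section \<open>Invariance of the hyperbolic measure\<close>

lemma mobius_differentiable_on: "A \<in> carrier SL2Z \<Longrightarrow> S \<subseteq> uhp \<Longrightarrow> mobius A differentiable_on S"
  unfolding differentiable_on_def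
  using mobius_has_field_derivative has_field_derivative_imp_has_derivative differentiable_def by blast

lemma mobius_image_lebesgue: "A \<in> carrier SL2Z \<Longrightarrow> S \<in> sets lebesgue \<Longrightarrow> S \<subseteq> uhp \<Longrightarrow> mobius A ` S \<in> sets lebesgue"
  by (intro differentiable_image_in_sets_lebesgue mobius_differentiable_on) auto

lemma mobius_image_negligible: "A \<in> carrier SL2Z \<Longrightarrow> negligible S \<Longrightarrow> S \<subseteq> uhp \<Longrightarrow> negligible (mobius A ` S)"
  by (intro negligible_differentiable_image_negligible mobius_differentiable_on) auto

lemma det_complex_mult: "det (matrix (\<lambda>v. vec_of_complex (D * complex_of_vec v))) = (cmod D)\<^sup>2"
  unfolding cmod_power2 by (simp add: det_2 matrix_def axis_def power2_eq_square)

text \<open>The real Jacobian of \<open>mobius A\<close> is the inverse fourth power of the modulus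
  of the automorphy factor, which is exactly the change of the squared height; hence
  \<open>dx dy / y^2\<close> is invariant. Integrability is carried in both directions, as nothing
  is assumed about it.\<close>

lemma mobius_change_of_variables:
  fixes \<phi> :: "complex \<Rightarrow> complex"
  assumes A: "A \<in> carrier SL2Z" and S: "S \<in> sets lebesgue" "S \<subseteq> uhp" and \<phi>: "continuous_on uhp \<phi>"
  shows "set_integrable lebesgue (mobius A ` S) (\<lambda>\<tau>. \<phi> \<tau> / of_real ((Im \<tau>)\<^sup>2))
           \<longleftrightarrow> set_integrable lebesgue S (\<lambda>\<tau>. \<phi> (mobius A \<tau>) / of_real ((Im \<tau>)\<^sup>2))" (is ?integrable)
    and "(LINT \<tau>:mobius A ` S|lebesgue. \<phi> \<tau> / of_real ((Im \<tau>)\<^sup>2))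
           = (LINT \<tau>:S|lebesgue. \<phi> (mobius A \<tau>) / of_real ((Im \<tau>)\<^sup>2))" (is ?integral)
proof -
  define \<psi> where "\<psi> = (\<lambda>\<tau>. \<phi> \<tau> / of_real ((Im \<tau>)\<^sup>2) :: complex)"
  define \<psi>' where "\<psi>' = (\<lambda>\<tau>. \<phi> (mobius A \<tau>) / of_real ((Im \<tau>)\<^sup>2))"
  have c: "continuous_on uhp \<psi>" unfolding \<psi>_def by (intro continuous_intros \<phi>) (auto simp: uhp_def)
  have "continuous_on uhp (mobius A)"
    using mobius_differentiable_on[OF A order_refl] by (rule differentiable_imp_continuous_on)
  hence c': "continuous_on uhp \<psi>'" unfolding \<psi>'_def
    by (intro continuous_intros continuous_on_compose2[OF \<phi>]) (auto intro: mobius_uhp[OF A] simp: uhp_def[symmetric], auto simp: uhp_def)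
  have img: "mobius A ` S \<subseteq> uhp" using S mobius_uhp[OF A] by auto
  note m = borel_measurable_lebesgue_uhp[OF c mobius_image_lebesgue[OF A S] img]
  note m' = borel_measurable_lebesgue_uhp[OF c' S]
  define S' where "S' = complex_of_vec -` S"
  define g where "g = (\<lambda>v. vec_of_complex (mobius A (complex_of_vec v)))"
  define f where "f = vec_of_complex \<circ> \<psi> \<circ> complex_of_vec"
  define g' where "g' = (\<lambda>x v. vec_of_complex (1 / (aut_factor A (complex_of_vec x))\<^sup>2 * complex_of_vec v))"
  have S': "S' \<in> sets lebesgue"
    using measurable_sets[OF measurable_complex_of_vec_lebesgue S(1)] by (simp add: S'_def)
  have der: "(g has_derivative g' x) (at x within S')" if "x \<in> S'" for x
  proof -
    have "complex_of_vec x \<in> uhp" using that S by (auto simp: S'_def)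
    from mobius_has_field_derivative[OF A this]
    have "(mobius A has_derivative (\<lambda>v. 1 / (aut_factor A (complex_of_vec x))\<^sup>2 * v)) (at (complex_of_vec x) within complex_of_vec ` S')"
      unfolding has_field_derivative_def .
    from diff_chain_within[OF bounded_linear_imp_has_derivative[OF bounded_linear_complex_of_vec] this]
    have "((\<lambda>v. mobius A (complex_of_vec v)) has_derivative (\<lambda>v. 1 / (aut_factor A (complex_of_vec x))\<^sup>2 * complex_of_vec v)) (at x within S')"
      by (simp add: o_def)
    from bounded_linear.has_derivative[OF bounded_linear_vec_of_complex this]
    show ?thesis by (simp add: g_def g'_def)
  qed
  have inj: "inj_on g S'"
  proof (rule inj_onI)
    fix x y assume "x \<in> S'" "y \<in> S'" "g x = g y"
    hence "mobius A (complex_of_vec x) = mobius A (complex_of_vec y)" "complex_of_vec x \<in> uhp" "complex_of_vec y \<in> uhp"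
      using S by (auto simp: g_def S'_def) (metis complex_vec_inverse(1))
    thus "x = y" using inj_on_mobius[OF A] by (metis complex_vec_inverse(2) inj_onD)
  qed
  have gS: "g ` S' = complex_of_vec -` (mobius A ` S)"
  proof (intro equalityI subsetI)
    fix x assume "x \<in> g ` S'" thus "x \<in> complex_of_vec -` (mobius A ` S)" by (auto simp: g_def S'_def)
  next
    fix x assume "x \<in> complex_of_vec -` (mobius A ` S)"
    then obtain y where y: "complex_of_vec x = mobius A y" "y \<in> S" by auto
    have "x = g (vec_of_complex y)" unfolding g_def by (simp add: y(1)[symmetric])
    thus "x \<in> g ` S'" using y(2) by (auto simp: S'_def)
  qed
  have eq: "\<bar>det (matrix (g' x))\<bar> *\<^sub>R f (g x) = (vec_of_complex \<circ> \<psi>' \<circ> complex_of_vec) x" if "x \<in> S'" for x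
  proof -
    define z where "z = complex_of_vec x"
    have z: "z \<in> uhp" using that S by (auto simp: S'_def z_def)
    have nz: "cmod (aut_factor A z) \<noteq> 0" using aut_factor_nonzero[OF A z] by simp
    have "det (matrix (g' x)) = 1 / (cmod (aut_factor A z)) ^ 4"
      unfolding g'_def det_complex_mult z_def[symmetric] by (simp add: norm_divide norm_power power_divide flip: power_mult)
    moreover have "\<psi>' z = (1 / (cmod (aut_factor A z)) ^ 4) *\<^sub>R \<psi> (mobius A z)"
      unfolding \<psi>_def \<psi>'_def Im_mobius[OF A] using nz
      by (simp add: scaleR_conv_of_real power_divide flip: power_mult)
    moreover have "f (g x) = vec_of_complex (\<psi> (mobius A z))" by (simp add: f_def g_def z_def)
    ultimately show ?thesis
      by (simp add: z_def[symmetric] linear_scale[OF bounded_linear.linear[OF bounded_linear_vec_of_complex]])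
  qed
  have *: "(vec_of_complex \<circ> \<psi>' \<circ> complex_of_vec) absolutely_integrable_on S' \<and> integral S' (vec_of_complex \<circ> \<psi>' \<circ> complex_of_vec) = b
     \<longleftrightarrow> f absolutely_integrable_on (g ` S') \<and> integral (g ` S') f = b" for b
  proof -
    have "(\<lambda>x. \<bar>det (matrix (g' x))\<bar> *\<^sub>R f (g x)) absolutely_integrable_on S'
        \<longleftrightarrow> (vec_of_complex \<circ> \<psi>' \<circ> complex_of_vec) absolutely_integrable_on S'"
      by (rule set_integrable_cong) (use eq in auto)
    moreover have "integral S' (\<lambda>x. \<bar>det (matrix (g' x))\<bar> *\<^sub>R f (g x)) = integral S' (vec_of_complex \<circ> \<psi>' \<circ> complex_of_vec)"
      by (rule integral_cong) (use eq in auto)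
    ultimately show ?thesis
      using has_absolute_integral_change_of_variables[OF S' der inj, of f b] by simp
  qed
  have I: "f absolutely_integrable_on (g ` S') \<longleftrightarrow> (vec_of_complex \<circ> \<psi>' \<circ> complex_of_vec) absolutely_integrable_on S'"
    using * by blast
  have I1: "f absolutely_integrable_on (g ` S') \<longleftrightarrow> set_integrable lebesgue (mobius A ` S) \<psi>"
    unfolding gS f_def by (rule set_integral_complex_of_vec(1)[OF m])
  have I2: "(vec_of_complex \<circ> \<psi>' \<circ> complex_of_vec) absolutely_integrable_on S' \<longleftrightarrow> set_integrable lebesgue S \<psi>'"
    unfolding S'_def by (rule set_integral_complex_of_vec(1)[OF m'])
  show "?integrable" using I I1 I2 by (simp add: \<psi>_def \<psi>'_def)
  have "set_lebesgue_integral lebesgue (mobius A ` S) \<psi> = set_lebesgue_integral lebesgue S \<psi>'"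
  proof (cases "f absolutely_integrable_on (g ` S')")
    case True
    hence T': "(vec_of_complex \<circ> \<psi>' \<circ> complex_of_vec) absolutely_integrable_on S'" using I by simp
    have "integral (g ` S') f = integral S' (vec_of_complex \<circ> \<psi>' \<circ> complex_of_vec)" using * True by blast
    hence E: "set_lebesgue_integral lebesgue (g ` S') f = set_lebesgue_integral lebesgue S' (vec_of_complex \<circ> \<psi>' \<circ> complex_of_vec)"
      using set_lebesgue_integral_eq_integral(2)[OF True] set_lebesgue_integral_eq_integral(2)[OF T'] by (simp only:)
    have "vec_of_complex (set_lebesgue_integral lebesgue (mobius A ` S) \<psi>) = vec_of_complex (set_lebesgue_integral lebesgue S \<psi>')"
    proof -
      have "set_lebesgue_integral lebesgue (g ` S') f = vec_of_complex (set_lebesgue_integral lebesgue (mobius A ` S) \<psi>)"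
        unfolding gS f_def by (rule set_integral_complex_of_vec(2)[OF m])
      moreover have "set_lebesgue_integral lebesgue S' (vec_of_complex \<circ> \<psi>' \<circ> complex_of_vec)
          = vec_of_complex (set_lebesgue_integral lebesgue S \<psi>')"
        unfolding S'_def by (rule set_integral_complex_of_vec(2)[OF m'])
      ultimately show ?thesis using E by (simp only:)
    qed
    thus ?thesis by (metis complex_vec_inverse(1))
  next
    case False
    hence "\<not> set_integrable lebesgue (mobius A ` S) \<psi>" "\<not> set_integrable lebesgue S \<psi>'" using I I1 I2 by auto
    thus ?thesis unfolding set_lebesgue_integral_def set_integrable_def by (simp add: not_integrable_integral_eq)
  qed
  thus ?integral by (simp add: \<psi>_def \<psi>'_def)
qed

section \<open>Fundamental domains\<close>

text \<open>Overlaps concern only countably many pairs, so one null set collects them all; off the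
  exceptional null sets each point of \<open>T\<close> lies in exactly one piece and the series has
  at most one nonzero term.\<close>

lemma sums_indicator_ae_disjoint:
  fixes h :: "complex \<Rightarrow> 'b::real_normed_vector"
  assumes disj: "\<And>m n. m \<noteq> n \<Longrightarrow> negligible (S m \<inter> S n)"
    and sub: "\<And>n. S n \<subseteq> T" and cover: "negligible (T - (\<Union>n. S n))"
  shows "AE x in lebesgue. (\<lambda>n::nat. indicat_real (S n) x *\<^sub>R h x) sums (indicat_real T x *\<^sub>R h x)"
proof -
  have "AE x in lebesgue. m \<noteq> n \<longrightarrow> x \<notin> S m \<inter> S n" for m n
    using disj[of m n] AE_not_in[of "S m \<inter> S n" lebesgue] by (cases "m = n") (auto simp: negligible_iff_null_sets)
  hence "AE x in lebesgue. \<forall>m n. m \<noteq> n \<longrightarrow> x \<notin> S m \<inter> S n"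
    by (simp add: AE_all_countable)
  moreover have "AE x in lebesgue. x \<notin> T - (\<Union>n. S n)"
    using cover unfolding negligible_iff_null_sets by (rule AE_not_in)
  ultimately have "AE x in lebesgue. (\<forall>m n. m \<noteq> n \<longrightarrow> x \<notin> S m \<inter> S n) \<and> x \<notin> T - (\<Union>n. S n)"
    by eventually_elim blast
  thus ?thesis
  proof eventually_elim
    case (elim x)
    show ?case
    proof (cases "x \<in> T")
      case True
      then obtain m where m: "x \<in> S m" using elim by auto
      have "(\<lambda>n. indicat_real (S n) x *\<^sub>R h x) = (\<lambda>n. if n = m then h x else 0)"
        using elim m by (auto simp: fun_eq_iff indicator_def)
      thus ?thesis using True sums_single[of m "\<lambda>_. h x"] by simp
    next
      case False
      hence "(\<lambda>n. indicat_real (S n) x *\<^sub>R h x) = (\<lambda>n. 0)" using sub by (auto simp: fun_eq_iff indicator_def)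
      thus ?thesis using False by simp
    qed
  qed
qed

text \<open>This direction starts from integrability on the whole; the summability of the norms is
  what the converse passage from pieces to a union requires.\<close>

lemma set_integrable_ae_disjoint_pieces:
  fixes h :: "complex \<Rightarrow> complex"
  assumes "\<And>m n. m \<noteq> n \<Longrightarrow> negligible (S m \<inter> S n)"
    and "\<And>n. S n \<subseteq> T" and "negligible (T - (\<Union>n. S n))"
    and S: "\<And>n. S n \<in> sets lebesgue" and h: "set_integrable lebesgue T h"
  shows "set_integrable lebesgue (S n) h"
    and "summable (\<lambda>n::nat. LINT x:S n|lebesgue. norm (h x))"
proof -
  have AE: "AE x in lebesgue. (\<lambda>n. indicat_real (S n) x *\<^sub>R norm (h x)) sums (indicat_real T x *\<^sub>R norm (h x))"
    by (rule sums_indicator_ae_disjoint) (use assms in auto)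
  show int: "set_integrable lebesgue (S n) h" for n
    using set_integrable_subset[OF h S assms(2)] .
  have hn: "set_integrable lebesgue T (\<lambda>x. norm (h x))" by (rule set_integrable_norm[OF h])
  show "summable (\<lambda>n::nat. LINT x:S n|lebesgue. norm (h x))"
  proof (rule bounded_imp_summable[where B = "LINT x:T|lebesgue. norm (h x)"])
    show "0 \<le> (LINT x:S n|lebesgue. norm (h x))" for n
      unfolding set_lebesgue_integral_def by (intro Bochner_Integration.integral_nonneg) auto
    fix n
    have "(\<Sum>k\<le>n. LINT x:S k|lebesgue. norm (h x)) = (LINT x|lebesgue. (\<Sum>k\<le>n. indicat_real (S k) x *\<^sub>R norm (h x)))"
      unfolding set_lebesgue_integral_def
      using set_integrable_norm[OF int] by (subst Bochner_Integration.integral_sum) (auto simp: set_integrable_def)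
    also have "\<dots> \<le> (LINT x:T|lebesgue. norm (h x))"
      unfolding set_lebesgue_integral_def
    proof (rule integral_mono_AE)
      show "integrable lebesgue (\<lambda>x. \<Sum>k\<le>n. indicat_real (S k) x *\<^sub>R norm (h x))"
        using set_integrable_norm[OF int]
        by (intro Bochner_Integration.integrable_sum) (simp only: set_integrable_def)
      show "integrable lebesgue (\<lambda>x. indicat_real T x *\<^sub>R norm (h x))"
        using hn by (simp add: set_integrable_def)
      show "AE x in lebesgue. (\<Sum>k\<le>n. indicat_real (S k) x *\<^sub>R norm (h x)) \<le> indicat_real T x *\<^sub>R norm (h x)"
        using AE
      proof eventually_elim
        case (elim x)
        have "(\<Sum>k\<le>n. indicat_real (S k) x *\<^sub>R norm (h x)) \<le> (\<Sum>k. indicat_real (S k) x *\<^sub>R norm (h x))"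
          by (rule sum_le_suminf[OF sums_summable[OF elim]]) auto
        thus ?case using sums_unique[OF elim] by simp
      qed
    qed
    finally show "(\<Sum>k\<le>n. LINT x:S k|lebesgue. norm (h x)) \<le> (LINT x:T|lebesgue. norm (h x))" .
  qed
qed

text \<open>Integrability on \<open>T\<close> is a conclusion: the pieces may be images of parts of
  another domain, for which alone integrability is known.\<close>

lemma set_integral_ae_disjoint_union:
  fixes h :: "complex \<Rightarrow> complex"
  assumes "\<And>m n. m \<noteq> n \<Longrightarrow> negligible (S m \<inter> S n)"
    and "\<And>n. S n \<subseteq> T" and "negligible (T - (\<Union>n. S n))" and T: "T \<in> sets lebesgue" "T \<subseteq> uhp"
    and h: "continuous_on uhp h"
    and int: "\<And>n. set_integrable lebesgue (S n) h"
    and sum: "summable (\<lambda>n::nat. LINT x:S n|lebesgue. norm (h x))"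
  shows "set_integrable lebesgue T h"
    and "(LINT x:T|lebesgue. h x) = (\<Sum>n. LINT x:S n|lebesgue. h x)"
proof -
  have AE: "AE x in lebesgue. (\<lambda>n. indicat_real (S n) x *\<^sub>R norm (h x)) sums (indicat_real T x *\<^sub>R norm (h x))"
      "AE x in lebesgue. (\<lambda>n. indicat_real (S n) x *\<^sub>R h x) sums (indicat_real T x *\<^sub>R h x)"
    by (rule sums_indicator_ae_disjoint, use assms in auto)+
  have i: "integrable lebesgue (\<lambda>x. indicat_real (S n) x *\<^sub>R h x)" for n
    using int by (simp add: set_integrable_def)
  have n: "norm (indicat_real (S n) x *\<^sub>R h x) = indicat_real (S n) x *\<^sub>R norm (h x)" for n x
    by simp
  have s1: "AE x in lebesgue. summable (\<lambda>n. norm (indicat_real (S n) x *\<^sub>R h x))"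
    unfolding n using AE(1) by eventually_elim (rule sums_summable)
  have s2: "summable (\<lambda>n. LINT x|lebesgue. norm (indicat_real (S n) x *\<^sub>R h x))"
    using sum unfolding n set_lebesgue_integral_def .
  have eq: "AE x in lebesgue. (\<Sum>n. indicat_real (S n) x *\<^sub>R h x) = indicat_real T x *\<^sub>R h x"
    using AE(2) by eventually_elim (rule sums_unique[symmetric])
  have m: "(\<lambda>x. indicat_real T x *\<^sub>R h x) \<in> borel_measurable lebesgue"
    by (rule borel_measurable_lebesgue_uhp[OF h T])
  have m': "(\<lambda>x. \<Sum>n. indicat_real (S n) x *\<^sub>R h x) \<in> borel_measurable lebesgue"
    using integrable_suminf[OF i s1 s2] by auto
  show "set_integrable lebesgue T h"
    unfolding set_integrable_def using integrable_suminf[OF i s1 s2] integrable_cong_AE[OF m' m eq] by simp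
  show "(LINT x:T|lebesgue. h x) = (\<Sum>n. LINT x:S n|lebesgue. h x)"
    unfolding set_lebesgue_integral_def
    using integral_suminf[OF i s1 s2] integral_cong_AE[OF m' m eq] by simp
qed

text \<open>\<open>D'\<close> is cut into its intersections with the translates of \<open>D\<close>,
  and \<open>D\<close> into its intersections with the translates of \<open>D'\<close>; a group
  element carries one piece onto the other, so the two sums agree term by term. Integrability is
  assumed on \<open>D'\<close> only and reaches \<open>D\<close> through the pieces.\<close>

lemma fundamental_domain_integral_eq:
  fixes \<phi> :: "complex \<Rightarrow> complex"
  assumes G: "G \<subseteq> carrier SL2Z" "\<And>A B. A \<in> G \<Longrightarrow> B \<in> G \<Longrightarrow> A ** B \<in> G"
      "\<And>A. A \<in> G \<Longrightarrow> sl2_inv A \<in> G" "\<And>A. A \<in> G \<Longrightarrow> - A \<in> G"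
    and \<phi>: "continuous_on uhp \<phi>" "\<And>A \<tau>. A \<in> G \<Longrightarrow> \<tau> \<in> uhp \<Longrightarrow> \<phi> (mobius A \<tau>) = \<phi> \<tau>"
    and D': "fundamental_domain G D'" "set_integrable lebesgue D' (\<lambda>\<tau>. \<phi> \<tau> / of_real ((Im \<tau>)\<^sup>2))"
    and D: "fundamental_domain G D"
  shows "(LINT \<tau>:D|lebesgue. \<phi> \<tau> / of_real ((Im \<tau>)\<^sup>2)) = (LINT \<tau>:D'|lebesgue. \<phi> \<tau> / of_real ((Im \<tau>)\<^sup>2))"
proof -
  define \<psi> where "\<psi> = (\<lambda>\<tau>. \<phi> \<tau> / of_real ((Im \<tau>)\<^sup>2) :: complex)"
  have SL: "A \<in> carrier SL2Z" if "A \<in> G" for A using that G(1) by auto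
  have [simp]: "D \<in> sets lebesgue" "D' \<in> sets lebesgue" and DU: "D \<subseteq> uhp" "D' \<subseteq> uhp"
    using D D' by (auto simp: fundamental_domain_def)
  have cov: "negligible (uhp - (\<Union>A\<in>G. mobius A ` D))" "negligible (uhp - (\<Union>A\<in>G. mobius A ` D'))"
    using D D' by (auto simp: fundamental_domain_def)
  have dis: "negligible (E \<inter> mobius A ` E)" if "E = D \<or> E = D'" "A \<in> G" "A \<noteq> mat 1" "A \<noteq> - mat 1" for A E
    using D D' that by (auto simp: fundamental_domain_def)
  \<comment> \<open>one of each pair \<open>A\<close>, \<open>- A\<close>, which act identically\<close>
  define P where "P = {A \<in> G. A$2$1 > 0 \<or> (A$2$1 = 0 \<and> A$2$2 > 0)}"
  have P_cases: "A \<in> P \<or> - A \<in> P" if "A \<in> G" for A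
  proof -
    have "A$2$1 \<noteq> 0 \<or> A$2$2 \<noteq> 0" using SL[OF that] by (auto simp: SL2Z_iff)
    thus ?thesis using that G(4) by (auto simp: P_def)
  qed
  have P_neg: "A \<noteq> - B" if "A \<in> P" "B \<in> P" for A B
    using that by (auto simp: P_def)
  \<comment> \<open>An enumeration of \<open>P\<close> by natural numbers with gaps: each index
    holds at most one matrix, and empty indices give empty pieces.\<close>
  define M where "M = (\<lambda>n. {A \<in> P. to_nat A = n})"
  define S where "S = (\<lambda>n. \<Union>A\<in>M n. D' \<inter> mobius A ` D)"
  define R where "R = (\<lambda>n. \<Union>A\<in>M n. D \<inter> mobius (sl2_inv A) ` D')"
  have M_cases: "M n = {} \<or> (\<exists>A\<in>P. M n = {A})" for n
  proof (cases "M n = {}")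
    case False
    then obtain A where "A \<in> M n" by blast
    hence "A \<in> P" "M n = {A}" by (auto simp: M_def)
    thus ?thesis by blast
  qed simp
  have M_ex: "\<exists>n. M n = {A}" if "A \<in> P" for A
    using that by (intro exI[of _ "to_nat A"]) (auto simp: M_def)
  have M_dist: "A \<noteq> B" if "A \<in> M m" "B \<in> M n" "m \<noteq> n" for A B m n using that by (auto simp: M_def)
  have MP: "A \<in> P" "A \<in> G" "A \<in> carrier SL2Z" if "A \<in> M n" for A n
    using that SL by (auto simp: M_def P_def)
  have inv_ne: "sl2_inv A ** B \<noteq> mat 1 \<and> sl2_inv A ** B \<noteq> - mat 1" 
    if "A \<in> P" "B \<in> P" "A \<noteq> B" for A B
  proof (intro conjI notI)
    have A: "A \<in> carrier SL2Z" using that SL by (auto simp: P_def)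
    { assume "sl2_inv A ** B = mat 1"
      hence "B = A ** mat 1" by (metis SL2Z_left_cancel(2) A)
      thus False using that by simp }
    { assume "sl2_inv A ** B = - mat 1"
      hence "B = A ** (- mat 1)" by (metis SL2Z_left_cancel(2) A)
      also have "\<dots> = - A" by (simp add: mat2_eq_iff mat2_mult_nth)
      finally show False using P_neg[OF that(2,1)] by simp }
  qed
  have inv_ne': "A ** sl2_inv B \<noteq> mat 1 \<and> A ** sl2_inv B \<noteq> - mat 1" 
    if "A \<in> P" "B \<in> P" "A \<noteq> B" for A B
  proof (intro conjI notI)
    have B: "B \<in> carrier SL2Z" using that SL by (auto simp: P_def)
    have *: "(A ** sl2_inv B) ** B = A" by (simp add: matrix_mul_assoc[symmetric] sl2_inv_left B)
    { assume "A ** sl2_inv B = mat 1"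
      thus False using that * by simp }
    { assume "A ** sl2_inv B = - mat 1"
      hence "A = (- mat 1) ** B" using * by simp
      also have "\<dots> = - B" by (simp add: mat2_eq_iff mat2_mult_nth)
      finally show False using P_neg[OF that(1,2)] by simp }
  qed
  have inter: "negligible (mobius A ` E \<inter> mobius B ` E)"
    if "E = D \<or> E = D'" "A \<in> G" "B \<in> G" "sl2_inv A ** B \<noteq> mat 1 \<and> sl2_inv A ** B \<noteq> - mat 1" for A B E
  proof -
    have E: "E \<subseteq> uhp" using that DU by auto
    have "negligible (mobius A ` (E \<inter> mobius (sl2_inv A ** B) ` E))"
      using that E by (intro mobius_image_negligible dis SL G) auto
    moreover have "mobius A ` E \<inter> mobius B ` E \<subseteq> mobius A ` (E \<inter> mobius (sl2_inv A ** B) ` E)"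
    proof
      fix z assume "z \<in> mobius A ` E \<inter> mobius B ` E"
      then obtain x y where xy: "z = mobius A x" "x \<in> E" "z = mobius B y" "y \<in> E" by blast
      have "mobius (sl2_inv A ** B) y = mobius (sl2_inv A) z"
        using xy E by (subst mobius_mult[OF sl2_inv_closed[OF SL[OF that(2)]] SL[OF that(3)]]) auto
      also have "\<dots> = x" using xy E mobius_inv_cancel(1)[OF SL[OF that(2)]] by auto
      finally show "z \<in> mobius A ` (E \<inter> mobius (sl2_inv A ** B) ` E)" using xy by force
    qed
    ultimately show ?thesis by (rule negligible_subset)
  qed
  have S_meas: "S n \<in> sets lebesgue" and R_meas: "R n \<in> sets lebesgue" for n
    using M_cases[of n] DU SL by (auto simp: S_def R_def P_def intro!: sets.Int mobius_image_lebesgue sl2_inv_closed)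
  have S_sub: "S n \<subseteq> D'" and R_sub: "R n \<subseteq> D" for n by (auto simp: S_def R_def)
  have S_disj: "negligible (S m \<inter> S n)" if "m \<noteq> n" for m n
  proof (cases "M m = {} \<or> M n = {}")
    case False
    then obtain A B where AB: "M m = {A}" "M n = {B}" using M_cases by metis
    hence "A \<in> P" "B \<in> P" "A \<noteq> B" using MP M_dist[OF _ _ that] by auto
    hence "negligible (mobius A ` D \<inter> mobius B ` D)" by (intro inter inv_ne) (auto simp: P_def)
    thus ?thesis by (rule negligible_subset) (auto simp: S_def AB)
  qed (auto simp: S_def)
  have R_disj: "negligible (R m \<inter> R n)" if "m \<noteq> n" for m n
  proof (cases "M m = {} \<or> M n = {}")
    case False
    then obtain A B where AB: "M m = {A}" "M n = {B}" using M_cases by metis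
    hence "A \<in> P" "B \<in> P" "A \<noteq> B" using MP M_dist[OF _ _ that] by auto
    hence "negligible (mobius (sl2_inv A) ` D' \<inter> mobius (sl2_inv B) ` D')"
      by (intro inter) (auto simp: P_def inv_ne' G(3))
    thus ?thesis by (rule negligible_subset) (auto simp: R_def AB)
  qed (auto simp: R_def)
  have S_cov: "negligible (D' - (\<Union>n. S n))"
  proof (rule negligible_subset[OF cov(1)])
    have "mobius A y \<in> (\<Union>n. S n)" if A: "A \<in> G" and y: "y \<in> D" "mobius A y \<in> D'" for A y
    proof -
      obtain B where B: "B \<in> P" "mobius B y = mobius A y" using P_cases[OF A] by (metis mobius_minus)
      then obtain n where "M n = {B}" using M_ex by blast
      hence "mobius A y \<in> S n" using y B by (auto simp: S_def intro!: image_eqI[of _ _ y])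
      thus ?thesis by blast
    qed
    thus "D' - (\<Union>n. S n) \<subseteq> uhp - (\<Union>A\<in>G. mobius A ` D)" using DU by blast
  qed
  have R_cov: "negligible (D - (\<Union>n. R n))"
  proof (rule negligible_subset[OF cov(2)])
    have "mobius A y \<in> (\<Union>n. R n)" if A: "A \<in> G" and y: "y \<in> D'" "mobius A y \<in> D" for A y
    proof -
      obtain B where B: "B \<in> P" "B = sl2_inv A \<or> B = - sl2_inv A" using P_cases[OF G(3)[OF A]] by blast
      have "sl2_inv (- sl2_inv A) = - A" by (simp add: mat2_eq_iff sl2_inv_def)
      hence "mobius (sl2_inv B) y = mobius A y" using B(2) by auto
      moreover obtain n where "M n = {B}" using M_ex B by blast
      ultimately have "mobius A y \<in> R n" using y by (auto simp: R_def intro!: image_eqI[of _ _ y])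
      thus ?thesis by blast
    qed
    thus "D - (\<Union>n. R n) \<subseteq> uhp - (\<Union>A\<in>G. mobius A ` D')" using DU by blast
  qed
  have RS: "S n = mobius A ` R n" if MA: "M n = {A}" for n A
  proof -
    have A: "A \<in> carrier SL2Z" using MP(3)[of A n] MA by simp
    show ?thesis
    proof (intro equalityI subsetI)
      fix x assume "x \<in> S n"
      then obtain y where y: "mobius A y \<in> D'" "x = mobius A y" "y \<in> D" unfolding S_def MA by blast
      have "mobius (sl2_inv A) (mobius A y) = y" using y(3) DU by (intro mobius_inv_cancel(1) A) auto
      hence "y \<in> R n" using y unfolding R_def MA by force
      thus "x \<in> mobius A ` R n" using y by blast
    next
      fix x assume "x \<in> mobius A ` R n"
      then obtain z where z: "x = mobius A (mobius (sl2_inv A) z)" "mobius (sl2_inv A) z \<in> D" "z \<in> D'"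
        unfolding R_def MA by blast
      have "mobius A (mobius (sl2_inv A) z) = z" using z(3) DU by (intro mobius_inv_cancel(2) A) auto
      thus "x \<in> S n" using z unfolding S_def MA by force
    qed
  qed
  have cv: "set_integrable lebesgue (S n) (\<lambda>\<tau>. f \<tau> / of_real ((Im \<tau>)\<^sup>2)) \<longleftrightarrow> set_integrable lebesgue (R n) (\<lambda>\<tau>. f \<tau> / of_real ((Im \<tau>)\<^sup>2))"
      "(LINT \<tau>:S n|lebesgue. f \<tau> / of_real ((Im \<tau>)\<^sup>2)) = (LINT \<tau>:R n|lebesgue. f \<tau> / of_real ((Im \<tau>)\<^sup>2))"
    if f: "continuous_on uhp f" "\<And>A \<tau>. A \<in> G \<Longrightarrow> \<tau> \<in> uhp \<Longrightarrow> f (mobius A \<tau>) = f \<tau>" for n and f :: "complex \<Rightarrow> complex"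
  proof -
    have "(set_integrable lebesgue (S n) (\<lambda>\<tau>. f \<tau> / of_real ((Im \<tau>)\<^sup>2)) \<longleftrightarrow> set_integrable lebesgue (R n) (\<lambda>\<tau>. f \<tau> / of_real ((Im \<tau>)\<^sup>2))) \<and>
      (LINT \<tau>:S n|lebesgue. f \<tau> / of_real ((Im \<tau>)\<^sup>2)) = (LINT \<tau>:R n|lebesgue. f \<tau> / of_real ((Im \<tau>)\<^sup>2))"
    proof (cases "M n = {}")
      case True
      thus ?thesis by (simp add: S_def R_def)
    next
      case False
      then obtain A where A: "M n = {A}" using M_cases by blast
      have AG: "A \<in> G" "A \<in> carrier SL2Z" using MP[of A n] A by auto
      have Ru: "R n \<subseteq> uhp" using R_sub DU by blast
      have 1: "set_integrable lebesgue (R n) (\<lambda>\<tau>. f (mobius A \<tau>) / of_real ((Im \<tau>)\<^sup>2)) = set_integrable lebesgue (R n) (\<lambda>\<tau>. f \<tau> / of_real ((Im \<tau>)\<^sup>2))"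
        using Ru by (intro set_integrable_cong) (auto simp: f(2) AG)
      have 2: "(LINT \<tau>:R n|lebesgue. f (mobius A \<tau>) / of_real ((Im \<tau>)\<^sup>2)) = (LINT \<tau>:R n|lebesgue. f \<tau> / of_real ((Im \<tau>)\<^sup>2))"
        using Ru by (intro set_lebesgue_integral_cong R_meas) (auto simp: f(2) AG)
      show ?thesis unfolding RS[OF A]
        using mobius_change_of_variables[OF AG(2) R_meas Ru f(1)] 1 2 by simp
    qed
    thus "set_integrable lebesgue (S n) (\<lambda>\<tau>. f \<tau> / of_real ((Im \<tau>)\<^sup>2)) \<longleftrightarrow> set_integrable lebesgue (R n) (\<lambda>\<tau>. f \<tau> / of_real ((Im \<tau>)\<^sup>2))"
      "(LINT \<tau>:S n|lebesgue. f \<tau> / of_real ((Im \<tau>)\<^sup>2)) = (LINT \<tau>:R n|lebesgue. f \<tau> / of_real ((Im \<tau>)\<^sup>2))" by auto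
  qed
  \<comment> \<open>The substitution rule is stated for complex integrands, so the norm is read as a
    complex function and the real part is taken.\<close>
  have norm_eq: "(LINT \<tau>:X|lebesgue. norm (\<psi> \<tau>)) = Re (LINT \<tau>:X|lebesgue. of_real (norm (\<phi> \<tau>)) / of_real ((Im \<tau>)\<^sup>2))" for X
  proof -
    have "of_real (norm (\<phi> \<tau>)) / of_real ((Im \<tau>)\<^sup>2) = complex_of_real (norm (\<psi> \<tau>))" for \<tau>
      by (simp add: \<psi>_def norm_divide norm_power)
    thus ?thesis by (simp add: set_integral_complex_of_real)
  qed
  have norm_cv: "(LINT \<tau>:S n|lebesgue. norm (\<psi> \<tau>)) = (LINT \<tau>:R n|lebesgue. norm (\<psi> \<tau>))" for n
    unfolding norm_eq by (subst cv(2)) (auto intro!: continuous_intros \<phi> simp: \<phi>(2))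
  have c\<psi>: "continuous_on uhp \<psi>"
    unfolding \<psi>_def by (intro continuous_intros \<phi>) (auto simp: uhp_def)
  have 1: "set_integrable lebesgue (S n) \<psi>" "summable (\<lambda>n. LINT \<tau>:S n|lebesgue. norm (\<psi> \<tau>))" for n
    by (rule set_integrable_ae_disjoint_pieces[of S D']; use S_disj S_sub S_cov S_meas D'(2)[folded \<psi>_def] in blast)+
  have 2: "set_integrable lebesgue (R n) \<psi>" for n
    using 1(1)[of n] cv(1)[OF \<phi>] by (simp add: \<psi>_def)
  have 3: "summable (\<lambda>n. LINT \<tau>:R n|lebesgue. norm (\<psi> \<tau>))" using 1(2) by (simp add: norm_cv)
  have "(LINT \<tau>:D|lebesgue. \<psi> \<tau>) = (\<Sum>n. LINT \<tau>:R n|lebesgue. \<psi> \<tau>)"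
    by (rule set_integral_ae_disjoint_union(2)) (use R_disj R_sub R_cov DU(1) c\<psi> 2 3 in auto)
  also have "\<dots> = (\<Sum>n. LINT \<tau>:S n|lebesgue. \<psi> \<tau>)"
    using cv(2)[OF \<phi>] by (simp add: \<psi>_def)
  also have "\<dots> = (LINT \<tau>:D'|lebesgue. \<psi> \<tau>)"
    by (rule set_integral_ae_disjoint_union(2)[symmetric]) (use S_disj S_sub S_cov DU(2) c\<psi> 1 in auto)
  finally show ?thesis by (simp add: \<psi>_def)
qed

section \<open>The standard fundamental domain\<close>

text \<open>Taken open, so that translates by elements other than the two trivial ones are truly
  disjoint; the price is a null set of uncovered boundary points.\<close>

definition std_domain :: "complex set" where
  "std_domain = {\<tau>. \<bar>Re \<tau>\<bar> < 1/2 \<and> norm \<tau> > 1 \<and> Im \<tau> > 0}"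

lemma std_domain_subset_uhp: "std_domain \<subseteq> uhp"
  by (auto simp: std_domain_def uhp_def)

lemma open_std_domain: "open std_domain"
  unfolding std_domain_def by (intro open_Collect_conj open_Collect_less continuous_intros)

text \<open>For \<open>c \<noteq> 0\<close> the squared modulus of \<open>c * \<tau> + d\<close>
  exceeds the integer \<open>c * c - \<bar>c * d\<bar> + d * d\<close>, a value of a positive
  definite form and hence at least one.\<close>

lemma Im_mobius_std_domain:
  assumes "\<tau> \<in> std_domain" "A \<in> carrier SL2Z" "A$2$1 \<noteq> 0"
  shows "Im (mobius A \<tau>) < Im \<tau>"
proof -
  define c d where "c = A$2$1" and "d = A$2$2"
  have \<tau>: "\<bar>Re \<tau>\<bar> < 1/2" "norm \<tau> > 1" "Im \<tau> > 0" using assms(1) by (auto simp: std_domain_def)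
  have c: "c \<noteq> 0" using assms by (simp add: c_def)
  have "1 \<le> c * c - \<bar>c * d\<bar> + d * d"
  proof (cases "d = 0")
    case True
    moreover have "c * c > 0" using c by (auto simp: zero_less_mult_iff)
    ultimately show ?thesis by simp
  next
    case False
    have "c * d \<noteq> 0" using c False by simp
    hence "1 \<le> \<bar>c * d\<bar>" by linarith
    moreover have "0 \<le> (\<bar>c\<bar> - \<bar>d\<bar>) * (\<bar>c\<bar> - \<bar>d\<bar>)" by simp
    hence "0 \<le> c * c - 2 * \<bar>c * d\<bar> + d * d" by (simp add: algebra_simps abs_mult)
    ultimately show ?thesis by linarith
  qed
  hence "real_of_int 1 \<le> real_of_int (c * c - \<bar>c * d\<bar> + d * d)" by (simp only: of_int_le_iff)
  hence 1: "1 \<le> real_of_int c ^ 2 - \<bar>of_int c * of_int d\<bar> + real_of_int d ^ 2" by (simp add: power2_eq_square)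
  have "(cmod (aut_factor A \<tau>))\<^sup>2 = real_of_int c ^ 2 * (norm \<tau>)\<^sup>2 + (of_int c * of_int d) * (2 * Re \<tau>) + real_of_int d ^ 2"
    unfolding cmod_power2 by (simp add: aut_factor_def c_def d_def power2_eq_square algebra_simps)
  moreover have "real_of_int c ^ 2 * 1 < real_of_int c ^ 2 * (norm \<tau>)\<^sup>2"
    using c \<tau> by (intro mult_strict_left_mono) (auto simp: one_less_power)
  moreover have "- \<bar>of_int c * of_int d\<bar> \<le> (of_int c * of_int d) * (2 * Re \<tau>)"
  proof -
    have "\<bar>(of_int c * of_int d) * (2 * Re \<tau>)\<bar> \<le> \<bar>of_int c * of_int d\<bar> * 1"
      unfolding abs_mult[of _ "2 * Re \<tau>"] using \<tau> by (intro mult_left_mono) auto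
    thus ?thesis by linarith
  qed
  ultimately have "(cmod (aut_factor A \<tau>))\<^sup>2 > 1" using 1 by linarith
  thus ?thesis unfolding Im_mobius[OF assms(2)] using \<tau> by (simp add: divide_less_eq)
qed

text \<open>Unless the lower left entry vanishes, \<open>A\<close> strictly lowers the height and
  its inverse strictly lowers it again. What is left are translations, and a shift between two
  points of the domain is shorter than one.\<close>

lemma std_domain_unique:
  assumes \<tau>: "\<tau> \<in> std_domain" and A: "A \<in> carrier SL2Z" and A\<tau>: "mobius A \<tau> \<in> std_domain"
  shows "A = mat 1 \<or> A = - mat 1"
proof -
  have c: "A$2$1 = 0"
  proof (rule ccontr)
    assume c: "A$2$1 \<noteq> 0"
    have "Im (mobius A \<tau>) < Im \<tau>" using Im_mobius_std_domain[OF \<tau> A c] .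
    moreover have "Im (mobius (sl2_inv A) (mobius A \<tau>)) < Im (mobius A \<tau>)"
      using c by (intro Im_mobius_std_domain[OF A\<tau>] sl2_inv_closed A) (simp add: sl2_inv_def)
    ultimately show False using mobius_inv_cancel(1)[OF A] \<tau> std_domain_subset_uhp by auto
  qed
  have "A$1$1 * A$2$2 = 1" using A c by (simp add: SL2Z_iff)
  hence ad: "A$1$1 = 1 \<and> A$2$2 = 1 \<or> A$1$1 = -1 \<and> A$2$2 = -1" by (simp add: zmult_eq_1_iff)
  hence "\<bar>Re (mobius A \<tau>) - Re \<tau>\<bar> = \<bar>real_of_int (A$1$2)\<bar>"
    by (auto simp: mobius_def aut_factor_def c)
  hence "\<bar>real_of_int (A$1$2)\<bar> < 1" using \<tau> A\<tau> by (auto simp: std_domain_def)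
  hence "A$1$2 = 0" by simp
  thus ?thesis using ad c by (auto simp: mat2_eq_iff)
qed

text \<open>Maximising the height in the orbit means minimising the modulus of the automorphy
  factor. Translation keeps a minimiser minimal, and comparison with one further inversion yields
  modulus at least one.\<close>

lemma std_domain_cover:
  assumes \<tau>: "\<tau> \<in> uhp"
  shows "\<exists>A\<in>carrier SL2Z. \<bar>Re (mobius A \<tau>)\<bar> \<le> 1/2 \<and> norm (mobius A \<tau>) \<ge> 1"
proof -
  have y: "Im \<tau> > 0" using \<tau> by (simp add: uhp_def)
  \<comment> \<open>Only moduli up to one are collected, which leaves finitely many values; the
    identity supplies the value one, so the minimum of \<open>W\<close> is the minimum over the
    whole group.\<close>
  define W where "W = (\<lambda>A. cmod (aut_factor A \<tau>)) ` {A \<in> carrier SL2Z. cmod (aut_factor A \<tau>) \<le> 1}"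
  define K where "K = \<lceil>1 / Im \<tau>\<rceil>"
  define L where "L = \<lceil>1 + of_int K * \<bar>Re \<tau>\<bar>\<rceil>"
  have "W \<subseteq> (\<lambda>(c, d). cmod (of_int c * \<tau> + of_int d)) ` ({-K..K} \<times> {-L..L})"
  proof
    fix w assume "w \<in> W"
    then obtain A where A: "w = cmod (aut_factor A \<tau>)" "cmod (aut_factor A \<tau>) \<le> 1" by (auto simp: W_def)
    have "\<bar>of_int (A$2$1) * Im \<tau>\<bar> \<le> 1"
      using abs_Im_le_cmod[of "aut_factor A \<tau>"] A(2) by (simp add: aut_factor_def)
    hence "\<bar>of_int (A$2$1)\<bar> \<le> 1 / Im \<tau>" using y by (simp add: abs_mult field_simps)
    hence c: "\<bar>A$2$1\<bar> \<le> K" unfolding K_def by linarith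
    have "\<bar>of_int (A$2$1) * Re \<tau> + of_int (A$2$2)\<bar> \<le> 1"
      using abs_Re_le_cmod[of "aut_factor A \<tau>"] A(2) by (simp add: aut_factor_def)
    moreover have "\<bar>of_int (A$2$1) * Re \<tau>\<bar> \<le> of_int K * \<bar>Re \<tau>\<bar>"
      unfolding abs_mult using c by (intro mult_right_mono) (auto simp flip: of_int_abs)
    ultimately have "\<bar>of_int (A$2$2)\<bar> \<le> 1 + of_int K * \<bar>Re \<tau>\<bar>" by linarith
    hence "\<bar>A$2$2\<bar> \<le> L" unfolding L_def by linarith
    thus "w \<in> (\<lambda>(c, d). cmod (of_int c * \<tau> + of_int d)) ` ({-K..K} \<times> {-L..L})"
      using c A(1) by (intro image_eqI[of _ _ "(A$2$1, A$2$2)"]) (auto simp: aut_factor_def)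
  qed
  hence fin: "finite W" by (rule finite_subset) auto
  have one: "mat 1 \<in> carrier SL2Z" by (simp add: SL2Z_iff)
  have "1 \<in> W" unfolding W_def using one by (intro image_eqI[of _ _ "mat 1"]) (auto simp: aut_factor_def)
  hence Min: "Min W \<in> W" "Min W \<le> 1" using fin Min_in[OF fin] Min_le[OF fin] by blast+
  then obtain A where A: "A \<in> carrier SL2Z" "cmod (aut_factor A \<tau>) = Min W" by (auto simp: W_def)
  have min: "cmod (aut_factor A \<tau>) \<le> cmod (aut_factor B \<tau>)" if "B \<in> carrier SL2Z" for B
  proof (cases "cmod (aut_factor B \<tau>) \<le> 1")
    case True
    thus ?thesis using fin that A(2) by (auto intro!: Min_le simp: W_def)
  qed (use Min A in auto)
  define n where "n = \<lfloor>Re (mobius A \<tau>) + 1/2\<rfloor>"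
  define B where "B = sl2 1 (-n) 0 1 ** A"
  have T: "sl2 1 (-n) 0 1 \<in> carrier SL2Z" and S: "sl2 0 (-1) 1 0 \<in> carrier SL2Z" by (simp_all add: SL2Z_iff)
  have B: "B \<in> carrier SL2Z" unfolding B_def by (intro SL2Z_mult_closed T A)
  have mB: "mobius B \<tau> = mobius A \<tau> - of_int n"
    unfolding B_def mobius_mult[OF T A(1) \<tau>] by (simp add: mobius_def[of "sl2 _ _ _ _"] aut_factor_def[of "sl2 _ _ _ _"])
  have aB: "aut_factor B \<tau> = aut_factor A \<tau>"
    unfolding B_def aut_factor_mult[OF A(1) \<tau>] by (simp add: aut_factor_def[of "sl2 _ _ _ _"])
  have "aut_factor (sl2 0 (-1) 1 0 ** B) \<tau> = mobius B \<tau> * aut_factor A \<tau>"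
    unfolding aut_factor_mult[OF B \<tau>] aB by (simp add: aut_factor_def[of "sl2 _ _ _ _"])
  hence "cmod (aut_factor A \<tau>) * 1 \<le> cmod (aut_factor A \<tau>) * cmod (mobius B \<tau>)"
    using min[OF SL2Z_mult_closed[OF S B]] by (simp add: norm_mult mult.commute)
  hence "1 \<le> cmod (mobius B \<tau>)"
    using aut_factor_nonzero[OF A(1) \<tau>] by (simp add: mult_le_cancel_left1)
  moreover have "\<bar>Re (mobius B \<tau>)\<bar> \<le> 1/2" 
  proof -
    have "of_int n \<le> Re (mobius A \<tau>) + 1/2" "Re (mobius A \<tau>) + 1/2 < of_int n + 1"
      unfolding n_def by linarith+
    hence "\<bar>Re (mobius A \<tau>) - of_int n\<bar> \<le> 1/2" by (intro abs_leI) linarith+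
    thus ?thesis unfolding mB by simp
  qed
  ultimately show ?thesis using B by blast
qed

definition std_boundary :: "complex set" where
  "std_boundary = {\<tau> \<in> uhp. \<bar>Re \<tau>\<bar> \<le> 1/2 \<and> norm \<tau> \<ge> 1} - std_domain"

lemma negligible_std_boundary: "negligible std_boundary"
proof (rule negligible_subset)
  have "negligible {\<tau>::complex. 1 \<bullet> \<tau> = 1/2}" "negligible {\<tau>::complex. 1 \<bullet> \<tau> = -1/2}"
    by (rule negligible_hyperplane, simp)+
  thus "negligible ({\<tau>::complex. 1 \<bullet> \<tau> = 1/2} \<union> {\<tau>::complex. 1 \<bullet> \<tau> = -1/2} \<union> sphere 0 1)"
    by (intro negligible_Un negligible_sphere)
  show "std_boundary \<subseteq> {\<tau>::complex. 1 \<bullet> \<tau> = 1/2} \<union> {\<tau>::complex. 1 \<bullet> \<tau> = -1/2} \<union> sphere 0 1"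
    by (auto simp: std_boundary_def std_domain_def uhp_def inner_complex_def)
qed

section \<open>The fundamental domain attached to coset representatives\<close>

locale Gamma0_reps =
  fixes N :: nat and J :: "'j set" and \<gamma> :: "'j \<Rightarrow> int ^ 2 ^ 2"
  assumes finite_J: "finite J"
    and reps_SL2Z: "j \<in> J \<Longrightarrow> \<gamma> j \<in> carrier SL2Z"
    and reps_cover: "A \<in> carrier SL2Z \<Longrightarrow> \<exists>j\<in>J. \<exists>h\<in>Gamma0 N. A = h ** \<gamma> j"
    and reps_unique: "i \<in> J \<Longrightarrow> j \<in> J \<Longrightarrow> h \<in> Gamma0 N \<Longrightarrow> h' \<in> Gamma0 N \<Longrightarrow> h ** \<gamma> i = h' ** \<gamma> j \<Longrightarrow> i = j"
begin

text \<open>Right multiplication by \<open>A\<close> permutes the cosets, hence the representatives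
  up to left factors from \<open>Gamma0 N\<close>, which \<open>w\<close> does not see. On a finite
  set injectivity suffices for this.\<close>

lemma sum_reps_right_mult:
  fixes w :: "int ^ 2 ^ 2 \<Rightarrow> 'a::comm_monoid_add"
  assumes A: "A \<in> carrier SL2Z" and w: "\<And>h B. h \<in> Gamma0 N \<Longrightarrow> B \<in> carrier SL2Z \<Longrightarrow> w (h ** B) = w B"
  shows "(\<Sum>j\<in>J. w (\<gamma> j ** A)) = (\<Sum>j\<in>J. w (\<gamma> j))"
proof -
  have "\<forall>j\<in>J. \<exists>i. i \<in> J \<and> (\<exists>h\<in>Gamma0 N. \<gamma> j ** A = h ** \<gamma> i)"
    using reps_cover SL2Z_mult_closed[OF reps_SL2Z A] by blast
  then obtain \<sigma> where \<sigma>: "\<And>j. j \<in> J \<Longrightarrow> \<sigma> j \<in> J \<and> (\<exists>h\<in>Gamma0 N. \<gamma> j ** A = h ** \<gamma> (\<sigma> j))"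
    unfolding bchoice_iff by blast
  have inj: "inj_on \<sigma> J"
  proof (rule inj_onI)
    fix i j assume ij: "i \<in> J" "j \<in> J" "\<sigma> i = \<sigma> j"
    obtain h h' where h: "h \<in> Gamma0 N" "\<gamma> i ** A = h ** \<gamma> (\<sigma> i)" "h' \<in> Gamma0 N" "\<gamma> j ** A = h' ** \<gamma> (\<sigma> i)"
      using \<sigma>[OF ij(1)] \<sigma>[OF ij(2)] ij(3) by auto
    have "sl2_inv h ** (\<gamma> i ** A) = sl2_inv h' ** (\<gamma> j ** A)"
      using h by (simp add: SL2Z_left_cancel Gamma0_SL2Z)
    hence "(sl2_inv h ** \<gamma> i) ** A = (sl2_inv h' ** \<gamma> j) ** A"
      by (simp only: matrix_mul_assoc)
    hence "(sl2_inv h ** \<gamma> i) ** A ** sl2_inv A = (sl2_inv h' ** \<gamma> j) ** A ** sl2_inv A" by (simp only:)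
    hence "sl2_inv h ** \<gamma> i = sl2_inv h' ** \<gamma> j"
      by (simp add: matrix_mul_assoc[symmetric] sl2_inv_right[OF A])
    thus "i = j" using ij h by (intro reps_unique[OF ij(1,2) Gamma0_inv_closed Gamma0_inv_closed])
  qed
  have "\<sigma> ` J = J" using endo_inj_surj[OF finite_J _ inj] \<sigma> by blast
  hence "bij_betw \<sigma> J J" using inj by (simp add: bij_betw_def)
  hence "(\<Sum>j\<in>J. w (\<gamma> j)) = (\<Sum>j\<in>J. w (\<gamma> (\<sigma> j)))" by (rule sum.reindex_bij_betw[symmetric])
  also have "\<dots> = (\<Sum>j\<in>J. w (\<gamma> j ** A))"
  proof (rule sum.cong)
    fix j assume j: "j \<in> J"
    then obtain h where "h \<in> Gamma0 N" "\<gamma> j ** A = h ** \<gamma> (\<sigma> j)" using \<sigma> by blast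
    thus "w (\<gamma> (\<sigma> j)) = w (\<gamma> j ** A)" using w \<sigma>[OF j] reps_SL2Z by simp
  qed simp
  finally show ?thesis by simp
qed

definition reps_domain :: "complex set" where
  "reps_domain = (\<Union>j\<in>J. mobius (\<gamma> j) ` std_domain)"

text \<open>The element \<open>sl2_inv (\<gamma> i) ** (A ** \<gamma> j)\<close> maps
  \<open>y\<close> to \<open>x\<close> inside the standard domain, hence is plus or minus the
  identity; uniqueness of representatives identifies \<open>i\<close> with \<open>j\<close>.\<close>

lemma std_domain_translates_disjoint:
  assumes "i \<in> J" "j \<in> J" "A \<in> Gamma0 N" "x \<in> std_domain" "y \<in> std_domain"
    "mobius (\<gamma> i) x = mobius A (mobius (\<gamma> j) y)"
  shows "i = j \<and> (A = mat 1 \<or> A = - mat 1)"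
proof -
  note SL = reps_SL2Z[OF assms(1)] reps_SL2Z[OF assms(2)] Gamma0_SL2Z[OF assms(3)]
  have u: "x \<in> uhp" "y \<in> uhp" using assms std_domain_subset_uhp by auto
  define B where "B = sl2_inv (\<gamma> i) ** (A ** \<gamma> j)"
  have B: "B \<in> carrier SL2Z" unfolding B_def by (intro SL2Z_mult_closed sl2_inv_closed SL)
  have "mobius B y = mobius (sl2_inv (\<gamma> i)) (mobius (\<gamma> i) x)"
    unfolding B_def using assms(6) u
    by (simp add: mobius_mult SL SL2Z_mult_closed sl2_inv_closed)
  hence "mobius B y = x" using mobius_inv_cancel(1)[OF SL(1) u(1)] by simp
  hence "B = mat 1 \<or> B = - mat 1" using std_domain_unique[OF assms(5) B] assms(4) by simp
  moreover have AB: "A ** \<gamma> j = \<gamma> i ** B" unfolding B_def by (simp add: SL2Z_left_cancel SL)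
  moreover have "\<gamma> i ** (- mat 1) = (- mat 1) ** \<gamma> i" by (simp add: mat2_eq_iff mat2_mult_nth)
  ultimately have "A ** \<gamma> j = mat 1 ** \<gamma> i \<or> A ** \<gamma> j = (- mat 1) ** \<gamma> i" by auto
  then obtain e where e: "e = mat 1 \<or> e = - mat 1" "A ** \<gamma> j = e ** \<gamma> i" by blast
  have "e \<in> Gamma0 N" using e(1) one_in_Gamma0 by auto
  hence ij: "j = i" using reps_unique[OF assms(2,1,3)] e(2) by blast
  have "A ** \<gamma> j ** sl2_inv (\<gamma> j) = e ** \<gamma> j ** sl2_inv (\<gamma> j)" using e(2) ij by simp
  hence "A = e" by (simp add: matrix_mul_assoc[symmetric] sl2_inv_right[OF SL(2)])
  thus ?thesis using ij e by auto
qed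

lemma fundamental_domain_reps: "fundamental_domain (Gamma0 N) reps_domain"
  unfolding fundamental_domain_def
proof (intro conjI ballI impI)
  have F: "std_domain \<in> sets lebesgue" using open_std_domain by (simp add: borel_open)
  show "reps_domain \<in> sets lebesgue" unfolding reps_domain_def
    using finite_J by (intro sets.finite_UN mobius_image_lebesgue reps_SL2Z F std_domain_subset_uhp)
  show sub: "reps_domain \<subseteq> uhp"
    using mobius_uhp reps_SL2Z std_domain_subset_uhp unfolding reps_domain_def by blast
  show "negligible (uhp - (\<Union>A\<in>Gamma0 N. mobius A ` reps_domain))"
  proof (rule negligible_subset)
    have "std_boundary \<subseteq> uhp" by (auto simp: std_boundary_def)
    thus "negligible (\<Union>A\<in>carrier SL2Z. mobius A ` std_boundary)"
      by (intro negligible_countable_Union countable_image countable_int_mat)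
         (auto intro!: mobius_image_negligible negligible_std_boundary)
    \<comment> \<open>A point that is never reached has its reduced representative on the boundary
      of the standard domain, so countably many translates of a null set contain all such
      points.\<close>
    show "uhp - (\<Union>A\<in>Gamma0 N. mobius A ` reps_domain) \<subseteq> (\<Union>A\<in>carrier SL2Z. mobius A ` std_boundary)"
    proof (rule subsetI, rule ccontr)
      fix \<tau> assume "\<tau> \<in> uhp - (\<Union>A\<in>Gamma0 N. mobius A ` reps_domain)"
        and nb: "\<tau> \<notin> (\<Union>A\<in>carrier SL2Z. mobius A ` std_boundary)"
      hence \<tau>: "\<tau> \<in> uhp" "\<tau> \<notin> (\<Union>A\<in>Gamma0 N. mobius A ` reps_domain)" by auto
      obtain A where A: "A \<in> carrier SL2Z" "\<bar>Re (mobius A \<tau>)\<bar> \<le> 1/2" "norm (mobius A \<tau>) \<ge> 1"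
        using std_domain_cover[OF \<tau>(1)] by blast
      define z where "z = mobius A \<tau>"
      have z: "z \<in> uhp" unfolding z_def by (rule mobius_uhp[OF A(1) \<tau>(1)])
      have \<tau>z: "\<tau> = mobius (sl2_inv A) z" unfolding z_def using mobius_inv_cancel(1)[OF A(1) \<tau>(1)] by simp
      hence "z \<notin> std_boundary" using nb sl2_inv_closed[OF A(1)] by blast
      hence "z \<in> std_domain" using z A by (auto simp: std_boundary_def z_def)
      obtain j h where jh: "j \<in> J" "h \<in> Gamma0 N" "sl2_inv A = h ** \<gamma> j"
        using reps_cover[OF sl2_inv_closed[OF A(1)]] by blast
      have "\<tau> = mobius h (mobius (\<gamma> j) z)"
        unfolding \<tau>z jh(3) by (rule mobius_mult[OF Gamma0_SL2Z[OF jh(2)] reps_SL2Z[OF jh(1)] z])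
      thus False using jh \<tau>(2) \<open>z \<in> std_domain\<close> unfolding reps_domain_def by blast
    qed
  qed
  fix A assume A: "A \<in> Gamma0 N" "A \<noteq> mat 1 \<and> A \<noteq> - mat 1"
  have "reps_domain \<inter> mobius A ` reps_domain = {}"
    using std_domain_translates_disjoint[OF _ _ A(1)] A(2) unfolding reps_domain_def by blast
  thus "negligible (reps_domain \<inter> mobius A ` reps_domain)" by simp
qed

text \<open>The domain built from the representatives settles both halves of the definite
  description: every other domain has the same integral, and its own value forces
  uniqueness.\<close>

lemma quotient_integral_eq:
  fixes \<phi> :: "complex \<Rightarrow> complex"
  assumes \<phi>: "continuous_on uhp \<phi>" "\<And>A \<tau>. A \<in> Gamma0 N \<Longrightarrow> \<tau> \<in> uhp \<Longrightarrow> \<phi> (mobius A \<tau>) = \<phi> \<tau>"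
    and int: "\<And>j. j \<in> J \<Longrightarrow> set_integrable lebesgue std_domain (\<lambda>\<tau>. \<phi> (mobius (\<gamma> j) \<tau>) / of_real ((Im \<tau>)\<^sup>2))"
  shows "quotient_integral (Gamma0 N) \<phi>
           = (\<Sum>j\<in>J. LINT \<tau>:std_domain|lebesgue. \<phi> (mobius (\<gamma> j) \<tau>) / of_real ((Im \<tau>)\<^sup>2))"
proof -
  have F: "std_domain \<in> sets lebesgue" using open_std_domain by (simp add: borel_open)
  note cv = mobius_change_of_variables[OF reps_SL2Z F std_domain_subset_uhp \<phi>(1)]
  have disj: "disjoint_family_on (\<lambda>j. mobius (\<gamma> j) ` std_domain) J"
    unfolding disjoint_family_on_def
    using std_domain_translates_disjoint[OF _ _ one_in_Gamma0] by auto
  have pieces: "set_integrable lebesgue (mobius (\<gamma> j) ` std_domain) (\<lambda>\<tau>. \<phi> \<tau> / of_real ((Im \<tau>)\<^sup>2))" if "j \<in> J" for j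
    using cv(1) int that by blast
  have meas: "mobius (\<gamma> j) ` std_domain \<in> sets lebesgue" if "j \<in> J" for j
    using that by (intro mobius_image_lebesgue reps_SL2Z F std_domain_subset_uhp)
  have intD: "set_integrable lebesgue reps_domain (\<lambda>\<tau>. \<phi> \<tau> / of_real ((Im \<tau>)\<^sup>2))"
    unfolding reps_domain_def by (intro set_integrable_UN finite_J pieces meas)
  have val: "(LINT \<tau>:reps_domain|lebesgue. \<phi> \<tau> / of_real ((Im \<tau>)\<^sup>2))
      = (\<Sum>j\<in>J. LINT \<tau>:std_domain|lebesgue. \<phi> (mobius (\<gamma> j) \<tau>) / of_real ((Im \<tau>)\<^sup>2))"
    unfolding reps_domain_def
    by (subst set_integral_finite_Union[OF finite_J disj pieces meas]) (simp_all only: cv(2) cong: sum.cong)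
  show ?thesis unfolding quotient_integral_def
  proof (rule the_equality)
    show "\<forall>D. fundamental_domain (Gamma0 N) D \<longrightarrow> (LINT \<tau>:D|lebesgue. \<phi> \<tau> / of_real ((Im \<tau>)\<^sup>2))
        = (\<Sum>j\<in>J. LINT \<tau>:std_domain|lebesgue. \<phi> (mobius (\<gamma> j) \<tau>) / of_real ((Im \<tau>)\<^sup>2))"
    proof (intro allI impI)
      fix D assume D: "fundamental_domain (Gamma0 N) D"
      show "(LINT \<tau>:D|lebesgue. \<phi> \<tau> / of_real ((Im \<tau>)\<^sup>2))
        = (\<Sum>j\<in>J. LINT \<tau>:std_domain|lebesgue. \<phi> (mobius (\<gamma> j) \<tau>) / of_real ((Im \<tau>)\<^sup>2))"
        unfolding val[symmetric]
        by (rule fundamental_domain_integral_eq[OF _ Gamma0_mult_closed Gamma0_inv_closed _ \<phi> fundamental_domain_reps intD D])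
           (auto intro: Gamma0_SL2Z)
    qed
  next
    fix I assume "\<forall>D. fundamental_domain (Gamma0 N) D \<longrightarrow> (LINT \<tau>:D|lebesgue. \<phi> \<tau> / of_real ((Im \<tau>)\<^sup>2)) = I"
    thus "I = (\<Sum>j\<in>J. LINT \<tau>:std_domain|lebesgue. \<phi> (mobius (\<gamma> j) \<tau>) / of_real ((Im \<tau>)\<^sup>2))"
      using fundamental_domain_reps val by auto
  qed
qed

end

section \<open>Green's formula on the standard fundamental domain\<close>

lemma lborel_distr_Complex: "distr (lborel \<Otimes>\<^sub>M lborel) borel (\<lambda>(x, y). Complex x y) = lborel"
proof (rule lborel_eqI[symmetric])
  fix l u :: complex assume le: "\<And>b. b \<in> Basis \<Longrightarrow> l \<bullet> b \<le> u \<bullet> b"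
  have lu: "Re l \<le> Re u" "Im l \<le> Im u" using le[of 1] le[of \<i>] by (auto simp: Basis_complex_def)
  have m: "(\<lambda>(x, y). Complex x y) \<in> (lborel \<Otimes>\<^sub>M lborel) \<rightarrow>\<^sub>M (borel :: complex measure)"
    unfolding lborel_prod split_beta'
    by (simp add: borel_measurable_continuous_onI continuous_intros)
  have "(\<lambda>(x, y). Complex x y) -` box l u = {Re l<..<Re u} \<times> {Im l<..<Im u}"
    unfolding set_eq_iff by (auto simp: in_box_complex_iff)
  hence "emeasure (distr (lborel \<Otimes>\<^sub>M lborel) borel (\<lambda>(x, y). Complex x y)) (box l u)
      = emeasure (lborel \<Otimes>\<^sub>M lborel) ({Re l<..<Re u} \<times> {Im l<..<Im u})"
    by (subst emeasure_distr[OF m]) (auto simp: space_pair_measure)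
  also have "\<dots> = ennreal (Re u - Re l) * ennreal (Im u - Im l)"
    using lu by (subst lborel.emeasure_pair_measure_Times) auto
  also have "\<dots> = ennreal (\<Prod>b\<in>Basis. (u - l) \<bullet> b)"
    using lu by (simp add: Basis_complex_def complex_eq_iff ennreal_mult)
  finally show "emeasure (distr (lborel \<Otimes>\<^sub>M lborel) borel (\<lambda>(x, y). Complex x y)) (box l u)
     = ennreal (\<Prod>b\<in>Basis. (u - l) \<bullet> b)" .
qed simp

lemma lborel_integral_Complex_iterated:
  fixes f :: "complex \<Rightarrow> complex"
  assumes "integrable lborel f"
  shows "integral\<^sup>L lborel f = (LBINT x. LBINT y. f (Complex x y))"
proof -
  have m: "(\<lambda>(x, y). Complex x y) \<in> (lborel \<Otimes>\<^sub>M lborel) \<rightarrow>\<^sub>M (borel :: complex measure)"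
    unfolding lborel_prod split_beta'
    by (simp add: borel_measurable_continuous_onI continuous_intros)
  have f: "f \<in> borel_measurable borel" using assms by (simp add: borel_measurable_integrable flip: measurable_lborel1)
  have int: "integrable (lborel \<Otimes>\<^sub>M lborel) (\<lambda>z. f (case z of (x, y) \<Rightarrow> Complex x y))"
    using integrable_distr_eq[OF m f] assms lborel_distr_Complex by simp
  have "integral\<^sup>L lborel f = integral\<^sup>L (lborel \<Otimes>\<^sub>M lborel) (\<lambda>z. f (case z of (x, y) \<Rightarrow> Complex x y))"
    using integral_distr[OF m f] lborel_distr_Complex by simp
  also have "\<dots> = (LBINT x. LBINT y. f (Complex x y))"
    using lborel_pair.integral_fst'[OF int] by simp
  finally show ?thesis .
qed

definition strip :: "complex set" where
  "strip = {\<tau>. \<bar>Re \<tau>\<bar> \<le> 1/2 \<and> Im \<tau> \<ge> 1/2}"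

text \<open>On a strip of bounded width a purely exponential bound is enough, as polynomial factors
  can be absorbed into a smaller rate.\<close>

definition strip_decay :: "(complex \<Rightarrow> complex) \<Rightarrow> bool" where
  "strip_decay Q \<longleftrightarrow> (\<exists>C c. C \<ge> 0 \<and> c > 0 \<and> (\<forall>\<tau>\<in>strip. norm (Q \<tau>) \<le> C * exp (- c * Im \<tau>)))"

lemma strip_subset_uhp: "strip \<subseteq> uhp" by (auto simp: strip_def uhp_def)

text \<open>Unit boxes stacked along the strip have measure one, so the integral of the norm is
  dominated by a geometric series.\<close>

lemma strip_decay_integrable:
  assumes Q: "continuous_on uhp Q" "strip_decay Q" and S: "S \<in> sets lebesgue" "S \<subseteq> strip"
  shows "set_integrable lebesgue S Q"
  unfolding set_integrable_def
proof (rule integrableI_bounded)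
  have Su: "S \<subseteq> uhp" using S strip_subset_uhp by auto
  show "(\<lambda>x. indicat_real S x *\<^sub>R Q x) \<in> borel_measurable lebesgue"
    by (rule borel_measurable_lebesgue_uhp[OF Q(1) S(1) Su])
  obtain C c where C: "C \<ge> 0" "c > 0" and bd: "\<And>\<tau>. \<tau> \<in> strip \<Longrightarrow> norm (Q \<tau>) \<le> C * exp (- c * Im \<tau>)"
    using Q(2) by (auto simp: strip_decay_def)
  define B where "B = (\<lambda>m::nat. cbox (Complex (-1/2) (real m)) (Complex (1/2) (real m + 1)))"
  define q where "q = exp (- c)"
  have q: "0 < q" "q < 1" using C by (auto simp: q_def)
  have "(\<integral>\<^sup>+ x. ennreal (norm (indicat_real S x *\<^sub>R Q x)) \<partial>lebesgue)
      \<le> (\<integral>\<^sup>+ x. (\<Sum>m. ennreal (C * q ^ m) * indicator (B m) x) \<partial>lebesgue)"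
  proof (rule nn_integral_mono)
    fix x :: complex
    show "ennreal (norm (indicat_real S x *\<^sub>R Q x)) \<le> (\<Sum>m. ennreal (C * q ^ m) * indicator (B m) x)"
    proof (cases "x \<in> S")
      case True
      hence x: "x \<in> strip" using S by auto
      define m where "m = nat \<lfloor>Im x\<rfloor>"
      have m: "real m \<le> Im x" "Im x \<le> real m + 1" using x unfolding m_def strip_def by auto
      have "norm (Q x) \<le> C * exp (- c * Im x)" by (rule bd[OF x])
      also have "\<dots> \<le> C * exp (- c * real m)" using m C by (intro mult_left_mono) auto
      also have "exp (- c * real m) = q ^ m" by (simp add: q_def exp_of_nat_mult[symmetric] mult.commute)
      finally have "ennreal (norm (Q x)) \<le> ennreal (C * q ^ m)" by (rule ennreal_leI)
      also have "\<dots> = ennreal (C * q ^ m) * indicator (B m) x"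
      proof -
        have "\<bar>Re x\<bar> \<le> 1/2" using x by (simp add: strip_def)
        hence "- 1/2 \<le> Re x" "Re x \<le> 1/2" by linarith+
        hence "x \<in> B m" using m by (simp add: B_def in_cbox_complex_iff)
        thus ?thesis by simp
      qed
      also have "\<dots> \<le> (\<Sum>m. ennreal (C * q ^ m) * indicator (B m) x)"
      proof -
        define g where "g = (\<lambda>m. ennreal (C * q ^ m) * indicator (B m) x)"
        have "sum g {m} \<le> suminf g" by (rule sum_le_suminf) auto
        hence "g m \<le> suminf g" by simp
        thus ?thesis by (simp only: g_def)
      qed
      finally show ?thesis using True by simp
    qed simp
  qed
  also have "\<dots> = (\<Sum>m. \<integral>\<^sup>+ x. ennreal (C * q ^ m) * indicator (B m) x \<partial>lebesgue)"
    by (intro nn_integral_suminf borel_measurable_times_ennreal borel_measurable_const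
        borel_measurable_indicator) (simp add: B_def)
  also have "\<dots> = (\<Sum>m. ennreal (C * q ^ m))"
  proof -
    have "emeasure lebesgue (B m) = 1" for m
      by (simp add: B_def emeasure_lborel_cbox_eq Basis_complex_def complex_eq_iff)
    moreover have "B m \<in> sets lebesgue" for m by (simp add: B_def)
    ultimately show ?thesis by (simp add: nn_integral_cmult_indicator)
  qed
  also have "\<dots> < \<infinity>"
  proof -
    have "summable (\<lambda>m. C * q ^ m)" using q by (intro summable_mult summable_geometric) auto
    thus ?thesis using C q by (subst suminf_ennreal2) auto
  qed
  finally show "(\<integral>\<^sup>+ x. ennreal (norm (indicat_real S x *\<^sub>R Q x)) \<partial>lebesgue) < \<infinity>" .
qed

text \<open>The arc of the unit circle that bounds the standard domain from below.\<close>

definition lower_arc :: "real \<Rightarrow> complex" where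
  "lower_arc x = Complex x (sqrt (1 - x\<^sup>2))"

text \<open>Using the real part as parameter makes the real part of this derivative identically one;
  its sum with its conjugate is therefore 2, the source of that constant in Green's formula.\<close>

definition lower_arc_deriv :: "real \<Rightarrow> complex" where
  "lower_arc_deriv x = Complex 1 (- x / sqrt (1 - x\<^sup>2))"

lemma half_le_sqrt: "\<bar>x\<bar> \<le> 1/2 \<Longrightarrow> sqrt (1 - x\<^sup>2) \<ge> 1/2"
proof -
  assume "\<bar>x\<bar> \<le> 1/2"
  hence "\<bar>x\<bar>\<^sup>2 \<le> (1/2)\<^sup>2" by (intro power_mono) auto
  hence "(1/2)\<^sup>2 \<le> 1 - x\<^sup>2" by (simp add: power2_eq_square)
  thus ?thesis by (rule real_le_rsqrt)
qed

lemma lower_arc_shift_strip: "\<bar>x\<bar> \<le> 1/2 \<Longrightarrow> s \<ge> 0 \<Longrightarrow> lower_arc x + \<i> * of_real s \<in> strip"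
  using half_le_sqrt[of x] by (simp add: strip_def lower_arc_def)

lemma lower_arc_strip: "\<bar>x\<bar> \<le> 1/2 \<Longrightarrow> lower_arc x \<in> strip"
  using lower_arc_shift_strip[of x 0] by simp

lemma lower_arc_has_vector_derivative:
  assumes "\<bar>x\<bar> \<le> 1/2" shows "(lower_arc has_vector_derivative lower_arc_deriv x) (at x within A)"
proof -
  have "sqrt (1 - x\<^sup>2) > 0" using half_le_sqrt[OF assms] by linarith
  hence "1 - x\<^sup>2 > 0" by (simp only: real_sqrt_gt_0_iff)
  hence "((\<lambda>x. sqrt (1 - x\<^sup>2)) has_real_derivative - x / sqrt (1 - x\<^sup>2)) (at x within A)"
    by (auto intro!: derivative_eq_intros simp: field_simps)
  moreover have "((\<lambda>x. x) has_real_derivative 1) (at x within A)" by (rule DERIV_ident)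
  ultimately have "((\<lambda>x. of_real x + \<i> * of_real (sqrt (1 - x\<^sup>2)) :: complex)
      has_vector_derivative of_real 1 + \<i> * of_real (- x / sqrt (1 - x\<^sup>2))) (at x within A)"
    by (intro has_vector_derivative_add has_vector_derivative_mult_right has_vector_derivative_of_real)
  moreover have "(\<lambda>x. of_real x + \<i> * of_real (sqrt (1 - x\<^sup>2))) = lower_arc"
    by (auto simp: lower_arc_def complex_eq_iff)
  moreover have "of_real 1 + \<i> * of_real (- x / sqrt (1 - x\<^sup>2)) = lower_arc_deriv x"
    by (simp add: lower_arc_deriv_def complex_eq_iff)
  ultimately show ?thesis by simp
qed

lemma continuous_on_lower_arc_deriv: "continuous_on {-1/2..1/2} lower_arc_deriv"
proof -
  have "continuous_on {-1/2..1/2} (\<lambda>x::real. 1 + \<i> * of_real (- x / sqrt (1 - x\<^sup>2)))"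
  proof (intro continuous_intros ballI)
    fix x :: real assume "x \<in> {-1/2..1/2}"
    hence "sqrt (1 - x\<^sup>2) \<ge> 1/2" by (intro half_le_sqrt) auto
    thus "sqrt (1 - x\<^sup>2) \<noteq> 0" by linarith
  qed
  moreover have "(\<lambda>x::real. 1 + \<i> * of_real (- x / sqrt (1 - x\<^sup>2))) = lower_arc_deriv"
    by (auto simp: lower_arc_deriv_def complex_eq_iff)
  ultimately show ?thesis by (simp only:)
qed

lemma norm_lower_arc_deriv: "\<bar>x\<bar> \<le> 1/2 \<Longrightarrow> norm (lower_arc_deriv x) \<le> 2"
proof -
  assume x: "\<bar>x\<bar> \<le> 1/2"
  have "norm (lower_arc_deriv x) \<le> 1 + \<bar>x\<bar> / sqrt (1 - x\<^sup>2)"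
    using cmod_le[of "lower_arc_deriv x"] half_le_sqrt[OF x] by (simp add: lower_arc_deriv_def abs_divide)
  moreover have "\<bar>x\<bar> / sqrt (1 - x\<^sup>2) \<le> 1"
  proof -
    have "\<bar>x\<bar> \<le> sqrt (1 - x\<^sup>2)" "0 < sqrt (1 - x\<^sup>2)" using x half_le_sqrt[OF x] by linarith+
    thus ?thesis by (simp only: divide_le_eq_1_pos)
  qed
  ultimately show ?thesis by simp
qed

lemma continuous_on_lower_arc: "continuous_on {-1/2..1/2} lower_arc"
  unfolding continuous_on_eq_continuous_within
  by (intro ballI has_vector_derivative_continuous[OF lower_arc_has_vector_derivative]) auto

definition above_arc :: "complex set" where
  "above_arc = {\<tau>. \<bar>Re \<tau>\<bar> \<le> 1/2 \<and> Im \<tau> \<ge> sqrt (1 - (Re \<tau>)\<^sup>2)}"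

text \<open>The top is a raised copy of the arc and not a horizontal segment, so that a vertical
  shear straightens the region to a rectangle.\<close>

definition above_arc_upto :: "real \<Rightarrow> complex set" where
  "above_arc_upto Y = {\<tau>. \<bar>Re \<tau>\<bar> \<le> 1/2 \<and> Im \<tau> \<ge> sqrt (1 - (Re \<tau>)\<^sup>2) \<and> Im \<tau> \<le> sqrt (1 - (Re \<tau>)\<^sup>2) + Y}"

lemma above_arc_strip: "above_arc \<subseteq> strip"
  using half_le_sqrt by (force simp: above_arc_def strip_def)

lemma above_arc_upto_subset: "above_arc_upto Y \<subseteq> above_arc"
  by (auto simp: above_arc_def above_arc_upto_def)

lemma closed_above_arc: "closed above_arc" and closed_above_arc_upto: "closed (above_arc_upto Y)"
  unfolding above_arc_def above_arc_upto_def
  by (intro closed_Collect_conj closed_Collect_le continuous_intros)+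

lemma above_arc_eq: "above_arc = {\<tau> \<in> uhp. \<bar>Re \<tau>\<bar> \<le> 1/2 \<and> norm \<tau> \<ge> 1}"
proof -
  have "(Im \<tau> \<ge> sqrt (1 - (Re \<tau>)\<^sup>2)) \<longleftrightarrow> (norm \<tau> \<ge> 1 \<and> Im \<tau> > 0)" if "\<bar>Re \<tau>\<bar> \<le> 1/2" for \<tau>
  proof -
    have "Im \<tau> > 0" if "Im \<tau> \<ge> sqrt (1 - (Re \<tau>)\<^sup>2)"
      using half_le_sqrt[OF \<open>\<bar>Re \<tau>\<bar> \<le> 1/2\<close>] that by linarith
    moreover have "(Im \<tau> \<ge> sqrt (1 - (Re \<tau>)\<^sup>2)) \<longleftrightarrow> norm \<tau> \<ge> 1" if "Im \<tau> > 0"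
    proof -
      have "(Im \<tau> \<ge> sqrt (1 - (Re \<tau>)\<^sup>2)) \<longleftrightarrow> 1 - (Re \<tau>)\<^sup>2 \<le> (Im \<tau>)\<^sup>2"
        using that by (auto intro: sqrt_le_D real_le_lsqrt)
      also have "\<dots> \<longleftrightarrow> norm \<tau> \<ge> 1" by (simp add: cmod_def) linarith
      finally show ?thesis .
    qed
    ultimately show ?thesis by blast
  qed
  thus ?thesis by (auto simp: above_arc_def uhp_def)
qed

lemma above_arc_minus_std_domain: "above_arc - std_domain = std_boundary" and std_domain_above_arc: "std_domain \<subseteq> above_arc"
  unfolding above_arc_eq std_boundary_def by (auto simp: std_domain_def uhp_def)

text \<open>After Fubini, each vertical line is translated by the height of the arc above
  \<open>x\<close>, a shear with unit Jacobian.\<close>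

lemma integral_above_arc_upto:
  fixes Q :: "complex \<Rightarrow> complex"
  assumes Q: "continuous_on uhp Q" "strip_decay Q"
  shows "(LINT \<tau>:above_arc_upto Y|lebesgue. Q \<tau>)
    = integral {-1/2..1/2} (\<lambda>x. integral {0..Y} (\<lambda>s. Q (lower_arc x + \<i> * of_real s)))"
proof -
  let ?S = "above_arc_upto Y"
  let ?f = "\<lambda>\<tau>. indicat_real ?S \<tau> *\<^sub>R Q \<tau>"
  have S: "?S \<in> sets borel" "?S \<in> sets lebesgue" "?S \<subseteq> strip"
    using closed_above_arc_upto above_arc_upto_subset above_arc_strip by (auto intro!: borel_closed)
  have Su: "?S \<subseteq> uhp" using S strip_subset_uhp by auto
  have "set_integrable lebesgue ?S Q" by (rule strip_decay_integrable[OF Q S(2,3)])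
  hence "integrable lebesgue ?f" by (simp add: set_integrable_def)
  moreover have fb: "?f \<in> borel_measurable lborel"
    using borel_measurable_continuous_on_indicator[OF S(1) continuous_on_subset[OF Q(1) Su]] by simp
  ultimately have f: "integrable lborel ?f" by (simp add: integrable_completion)
  have inner: "(LBINT y. ?f (Complex x y)) = indicat_real {-1/2..1/2} x *\<^sub>R integral {0..Y} (\<lambda>s. Q (lower_arc x + \<i> * of_real s))" for x
  proof (cases "\<bar>x\<bar> \<le> 1/2")
    case True
    have "(LBINT y. ?f (Complex x y)) = (LBINT s. ?f (Complex x (sqrt (1 - x\<^sup>2) + 1 * s)))"
      by (subst lborel_integral_real_affine[of 1 _ "sqrt (1 - x\<^sup>2)"]) auto
    also have "\<dots> = (LBINT s:{0..Y}. Q (lower_arc x + \<i> * of_real s))"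
      unfolding set_lebesgue_integral_def
    proof (rule Bochner_Integration.integral_cong)
      fix s :: real
      have "lower_arc x + \<i> * of_real s = Complex x (sqrt (1 - x\<^sup>2) + 1 * s)" by (simp add: lower_arc_def complex_eq_iff)
      thus "?f (Complex x (sqrt (1 - x\<^sup>2) + 1 * s)) = indicat_real {0..Y} s *\<^sub>R Q (lower_arc x + \<i> * of_real s)"
        using True by (auto simp: above_arc_upto_def indicator_def)
    qed simp
    also have "\<dots> = integral {0..Y} (\<lambda>s. Q (lower_arc x + \<i> * of_real s))"
    proof (rule set_borel_integral_eq_integral(2), rule borel_integrable_atLeastAtMost')
      show "continuous_on {0..Y} (\<lambda>s. Q (lower_arc x + \<i> * of_real s))"
        using lower_arc_shift_strip[OF True] strip_subset_uhp by (intro continuous_on_compose2[OF Q(1)] continuous_intros) auto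
    qed
    moreover have "x \<in> {-1/2..1/2}" using True by auto
    ultimately show ?thesis by simp
  next
    case False
    hence z: "?f (Complex x y) = 0" for y by (simp add: above_arc_upto_def)
    have "(LBINT y. ?f (Complex x y)) = (LBINT (y::real). (0::complex))" by (simp only: z)
    moreover have "x \<notin> {-1/2..1/2}" using False by auto
    ultimately show ?thesis by simp
  qed
  have "(LINT \<tau>:?S|lebesgue. Q \<tau>) = integral\<^sup>L lborel ?f"
    unfolding set_lebesgue_integral_def by (rule integral_completion[OF fb])
  also have "\<dots> = (LBINT x:{-1/2..1/2}. integral {0..Y} (\<lambda>s. Q (lower_arc x + \<i> * of_real s)))"
    unfolding lborel_integral_Complex_iterated[OF f] inner set_lebesgue_integral_def ..
  also have "\<dots> = integral {-1/2..1/2} (\<lambda>x. integral {0..Y} (\<lambda>s. Q (lower_arc x + \<i> * of_real s)))"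
  proof (rule set_borel_integral_eq_integral(2), rule borel_integrable_atLeastAtMost')
    have "continuous_on ({-1/2..1/2} \<times> {0..Y}) (\<lambda>z. Q (lower_arc (fst z) + \<i> * of_real (snd z)))"
      using lower_arc_shift_strip strip_subset_uhp
      by (intro continuous_on_compose2[OF Q(1)] continuous_intros continuous_on_compose2[OF continuous_on_lower_arc]) (auto simp: abs_le_iff, force)
    hence "continuous_on (cbox (-1/2) (1/2) \<times> cbox 0 Y) (\<lambda>(x, s). Q (lower_arc x + \<i> * of_real s))"
      by (simp add: split_beta')
    from integral_continuous_on_param[OF this]
    show "continuous_on {-1/2..1/2} (\<lambda>x. integral {0..Y} (\<lambda>s. Q (lower_arc x + \<i> * of_real s)))" by simp
  qed
  finally show ?thesis .
qed

text \<open>The shear \<open>(x, s) \<mapsto> lower_arc x + \<i> * s\<close> turns the truncated domain into a rectangle. In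
  these coordinates the density \<open>2 * \<i> * Q\<close> splits into an \<open>x\<close>-derivative, which periodicity
  kills, and an \<open>s\<close>-derivative, which gives the two boundary terms.\<close>

lemma green_identity_upto:
  fixes u v w u' :: "'i \<Rightarrow> complex \<Rightarrow> complex" and I :: "'i set"
  defines "H \<equiv> \<lambda>\<tau>. \<Sum>i\<in>I. u i \<tau> * cnj (v i \<tau>)"
    and "Q \<equiv> \<lambda>\<tau>. \<Sum>i\<in>I. u i \<tau> * cnj (w i \<tau>)"
  assumes I: "finite I"
    and u: "\<And>i \<tau>. i \<in> I \<Longrightarrow> \<tau> \<in> uhp \<Longrightarrow> (u i has_field_derivative u' i \<tau>) (at \<tau>)"
    and v: "\<And>i \<tau>. i \<in> I \<Longrightarrow> \<tau> \<in> uhp \<Longrightarrow> (v i has_field_derivative w i \<tau>) (at \<tau>)"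
    and cu': "\<And>i. i \<in> I \<Longrightarrow> continuous_on uhp (u' i)" and cw: "\<And>i. i \<in> I \<Longrightarrow> continuous_on uhp (w i)"
    and per: "\<And>\<tau>. \<tau> \<in> uhp \<Longrightarrow> H (\<tau> + 1) = H \<tau>" and Y: "Y \<ge> 0"
  shows "2 * \<i> * integral {-1/2..1/2} (\<lambda>x. integral {0..Y} (\<lambda>s. Q (lower_arc x + \<i> * of_real s)))
     = integral {-1/2..1/2} (\<lambda>x. lower_arc_deriv x * H (lower_arc x))
       - integral {-1/2..1/2} (\<lambda>x. lower_arc_deriv x * H (lower_arc x + \<i> * of_real Y))"
proof -
  let ?X = "{-1/2..1/2::real}"
  define P where "P = (\<lambda>x s. lower_arc x + \<i> * of_real s)"
  have P: "P x s \<in> uhp" if "x \<in> ?X" "s \<ge> 0" for x s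
    using lower_arc_shift_strip[of x s] that strip_subset_uhp by (auto simp: P_def abs_le_iff)
  have cu: "continuous_on uhp (u i)" and cv: "continuous_on uhp (v i)" if "i \<in> I" for i
    using u[OF that] v[OF that] DERIV_isCont by (blast intro: continuous_at_imp_continuous_on)+
  have cP: "continuous_on (?X \<times> {0..Y}) (\<lambda>z. P (fst z) (snd z))"
    unfolding P_def by (intro continuous_intros continuous_on_compose2[OF continuous_on_lower_arc]) auto
  have PX: "(\<lambda>z. P (fst z) (snd z)) ` (?X \<times> {0..Y}) \<subseteq> uhp" using P by auto
  have comp: "continuous_on (?X \<times> {0..Y}) (\<lambda>z. f (P (fst z) (snd z)))" if "continuous_on uhp f" for f :: "complex \<Rightarrow> complex"
    by (rule continuous_on_compose2[OF that cP PX])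
  have cd: "continuous_on (?X \<times> {0..Y}) (\<lambda>z. lower_arc_deriv (fst z))"
    by (intro continuous_on_compose2[OF continuous_on_lower_arc_deriv] continuous_intros) auto
  define Hx where "Hx = (\<lambda>x s. \<Sum>i\<in>I. u' i (P x s) * lower_arc_deriv x * cnj (v i (P x s))
      + u i (P x s) * cnj (w i (P x s) * lower_arc_deriv x))"
  define Hs where "Hs = (\<lambda>x s. \<Sum>i\<in>I. u' i (P x s) * \<i> * cnj (v i (P x s)) + u i (P x s) * cnj (w i (P x s) * \<i>))"
  have dHx: "((\<lambda>x. H (P x s)) has_vector_derivative Hx x s) (at x within ?X)" if "x \<in> ?X" "s \<in> {0..Y}" for x s
  proof -
    have dP: "((\<lambda>x. P x s) has_vector_derivative lower_arc_deriv x) (at x within ?X)"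
      unfolding P_def using lower_arc_has_vector_derivative[of x ?X] that
      by (auto intro!: derivative_eq_intros simp: abs_le_iff)
    have "P x s \<in> uhp" using P that by auto
    note * = field_vector_diff_chain_within[OF dP has_field_derivative_at_within, unfolded o_def]
    show ?thesis unfolding H_def Hx_def
    proof (rule has_vector_derivative_sum)
      fix i assume i: "i \<in> I"
      show "((\<lambda>x. u i (P x s) * cnj (v i (P x s))) has_vector_derivative
          u' i (P x s) * lower_arc_deriv x * cnj (v i (P x s)) + u i (P x s) * cnj (w i (P x s) * lower_arc_deriv x)) (at x within ?X)"
        using has_vector_derivative_mult[OF *[OF u[OF i \<open>P x s \<in> uhp\<close>]] has_vector_derivative_cnj[OF *[OF v[OF i \<open>P x s \<in> uhp\<close>]]]]
        by (simp add: add.commute mult_ac)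
    qed
  qed
  have dHs: "((\<lambda>s. H (P x s)) has_vector_derivative Hs x s) (at s within {0..Y})" if "x \<in> ?X" "s \<in> {0..Y}" for x s
  proof -
    have dP: "((\<lambda>s. P x s) has_vector_derivative \<i>) (at s within {0..Y})"
      unfolding P_def by (auto intro!: derivative_eq_intros)
    have "P x s \<in> uhp" using P that by auto
    note * = field_vector_diff_chain_within[OF dP has_field_derivative_at_within, unfolded o_def]
    show ?thesis unfolding H_def Hs_def
    proof (rule has_vector_derivative_sum)
      fix i assume i: "i \<in> I"
      show "((\<lambda>s. u i (P x s) * cnj (v i (P x s))) has_vector_derivative
          u' i (P x s) * \<i> * cnj (v i (P x s)) + u i (P x s) * cnj (w i (P x s) * \<i>)) (at s within {0..Y})"
        using has_vector_derivative_mult[OF *[OF u[OF i \<open>P x s \<in> uhp\<close>]] has_vector_derivative_cnj[OF *[OF v[OF i \<open>P x s \<in> uhp\<close>]]]]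
        by (simp add: add.commute mult_ac)
    qed
  qed
  \<comment> \<open>Write \<open>d\<close> for \<open>lower_arc_deriv x\<close>. In
    \<open>\<i> * Hx x s - d * Hs x s\<close> the terms with \<open>u'\<close> cancel; conjugating
    the factor \<open>\<i>\<close> flips a sign, so the terms with \<open>w\<close> add up with the
    factor \<open>\<i> * (d + cnj d)\<close>.\<close>
  have QH: "2 * \<i> * Q (P x s) = \<i> * Hx x s - lower_arc_deriv x * Hs x s" for x s
  proof -
    have c: "lower_arc_deriv x + cnj (lower_arc_deriv x) = 2"
      by (simp add: lower_arc_deriv_def complex_eq_iff)
    have "\<i> * Hx x s - lower_arc_deriv x * Hs x s
        = (\<Sum>i\<in>I. \<i> * (lower_arc_deriv x + cnj (lower_arc_deriv x)) * (u i (P x s) * cnj (w i (P x s))))"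
      unfolding Hx_def Hs_def sum_distrib_left sum_subtractf[symmetric]
      by (intro sum.cong refl) (simp add: algebra_simps)
    also have "\<dots> = 2 * \<i> * Q (P x s)" unfolding c Q_def sum_distrib_left by (intro sum.cong refl) simp
    finally show ?thesis by simp
  qed
  have cHx: "continuous_on (?X \<times> {0..Y}) (\<lambda>z. Hx (fst z) (snd z))"
    unfolding Hx_def by (intro continuous_intros comp cd cu cv cu' cw)
  have cHs: "continuous_on (?X \<times> {0..Y}) (\<lambda>z. Hs (fst z) (snd z))"
    unfolding Hs_def by (intro continuous_intros comp cd cu cv cu' cw)
  have slice: "continuous_on {0..Y} (f x)" if "continuous_on (?X \<times> {0..Y}) (\<lambda>z. f (fst z) (snd z))" "x \<in> ?X"
    for f :: "real \<Rightarrow> real \<Rightarrow> complex" and x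
  proof -
    have "continuous_on {0..Y} (\<lambda>s. f (fst (x, s)) (snd (x, s)))"
      by (rule continuous_on_compose2[OF that(1) continuous_on_Pair[OF continuous_on_const continuous_on_id]])
         (use that in auto)
    thus ?thesis by simp
  qed
  have param: "(\<lambda>x. integral {0..Y} (f x)) integrable_on ?X"
    if "continuous_on (?X \<times> {0..Y}) (\<lambda>z. f (fst z) (snd z))" for f :: "real \<Rightarrow> real \<Rightarrow> complex"
    using integral_continuous_on_param[of ?X 0 Y f] that
    by (intro integrable_continuous_interval) (simp add: split_beta')
  have FTCs: "integral {0..Y} (Hs x) = H (P x Y) - H (P x 0)" if "x \<in> ?X" for x
    using fundamental_theorem_of_calculus[OF Y dHs[OF that]] by (intro integral_unique) auto
  \<comment> \<open>The vertical sides lie one unit apart, so periodicity of \<open>H\<close> makes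
    them cancel at every height.\<close>
  have FTCx: "integral ?X (\<lambda>x. Hx x s) = 0" if "s \<in> {0..Y}" for s
  proof -
    have "((\<lambda>x. Hx x s) has_integral (H (P (1/2) s) - H (P (-1/2) s))) ?X"
      by (rule fundamental_theorem_of_calculus) (use dHx that in auto)
    moreover have "P (1/2) s = P (-1/2) s + 1" by (simp add: P_def lower_arc_def complex_eq_iff)
    ultimately show ?thesis using per[OF P[of "-1/2" s]] that by (simp add: integral_unique)
  qed
  have "2 * \<i> * integral ?X (\<lambda>x. integral {0..Y} (\<lambda>s. Q (P x s)))
     = integral ?X (\<lambda>x. integral {0..Y} (\<lambda>s. 2 * \<i> * Q (P x s)))" by simp
  also have "\<dots> = integral ?X (\<lambda>x. integral {0..Y} (\<lambda>s. \<i> * Hx x s - lower_arc_deriv x * Hs x s))"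
    by (simp only: QH)
  also have "\<dots> = integral ?X (\<lambda>x. \<i> * integral {0..Y} (Hx x) - lower_arc_deriv x * integral {0..Y} (Hs x))"
  proof (rule integral_cong)
    fix x assume "x \<in> ?X"
    hence "Hx x integrable_on {0..Y}" "Hs x integrable_on {0..Y}"
      using slice[OF cHx] slice[OF cHs] by (auto intro: integrable_continuous_interval)
    thus "integral {0..Y} (\<lambda>s. \<i> * Hx x s - lower_arc_deriv x * Hs x s)
        = \<i> * integral {0..Y} (Hx x) - lower_arc_deriv x * integral {0..Y} (Hs x)"
      by (subst integral_diff) (auto intro: integrable_on_mult_right)
  qed
  also have "\<dots> = integral ?X (\<lambda>x. \<i> * integral {0..Y} (Hx x)) - integral ?X (\<lambda>x. lower_arc_deriv x * integral {0..Y} (Hs x))"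
  proof (rule integral_diff)
    show "(\<lambda>x. \<i> * integral {0..Y} (Hx x)) integrable_on ?X"
      by (intro integrable_on_mult_right param cHx)
    have "(\<lambda>x. integral {0..Y} (\<lambda>s. lower_arc_deriv x * Hs x s)) integrable_on ?X"
      by (intro param continuous_intros cd cHs)
    thus "(\<lambda>x. lower_arc_deriv x * integral {0..Y} (Hs x)) integrable_on ?X" by simp
  qed
  also have "integral ?X (\<lambda>x. \<i> * integral {0..Y} (Hx x)) = \<i> * integral {0..Y} (\<lambda>s. integral ?X (\<lambda>x. Hx x s))"
    using integral_swap_continuous[where a = "-1/2" and b = "1/2" and c = 0 and d = Y and f = Hx] cHx by (simp add: split_beta' cbox_Pair_eq)
  also have "integral {0..Y} (\<lambda>s. integral ?X (\<lambda>x. Hx x s)) = 0"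
    using FTCx by (subst integral_cong[of _ _ "\<lambda>_. 0"]) auto
  also have "integral ?X (\<lambda>x. lower_arc_deriv x * integral {0..Y} (Hs x))
     = integral ?X (\<lambda>x. lower_arc_deriv x * H (P x Y) - lower_arc_deriv x * H (P x 0))"
    by (intro integral_cong) (simp add: FTCs algebra_simps)
  also have "\<dots> = integral ?X (\<lambda>x. lower_arc_deriv x * H (P x Y)) - integral ?X (\<lambda>x. lower_arc_deriv x * H (P x 0))"
  proof (rule integral_diff)
    have cH: "continuous_on uhp H" unfolding H_def by (intro continuous_intros cu cv)
    have "(\<lambda>x. lower_arc_deriv x * H (P x s)) integrable_on ?X" if "s \<ge> 0" for s
      using P that unfolding P_def
      by (intro integrable_continuous_interval continuous_intros continuous_on_lower_arc_deriv
          continuous_on_compose2[OF cH] continuous_on_lower_arc) auto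
    thus "(\<lambda>x. lower_arc_deriv x * H (P x Y)) integrable_on ?X" "(\<lambda>x. lower_arc_deriv x * H (P x 0)) integrable_on ?X"
      using Y by auto
  qed
  finally show ?thesis by (simp add: P_def)
qed

text \<open>The truncation is raised to infinity: the top boundary term is at most a constant times
  \<open>exp (- c * n)\<close>, and the closed region differs from \<open>std_domain\<close> by a
  null set.\<close>

theorem green_identity:
  fixes u v w u' :: "'i \<Rightarrow> complex \<Rightarrow> complex" and I :: "'i set"
  defines "H \<equiv> \<lambda>\<tau>. \<Sum>i\<in>I. u i \<tau> * cnj (v i \<tau>)"
    and "Q \<equiv> \<lambda>\<tau>. \<Sum>i\<in>I. u i \<tau> * cnj (w i \<tau>)"
  assumes I: "finite I"
    and u: "\<And>i \<tau>. i \<in> I \<Longrightarrow> \<tau> \<in> uhp \<Longrightarrow> (u i has_field_derivative u' i \<tau>) (at \<tau>)"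
    and v: "\<And>i \<tau>. i \<in> I \<Longrightarrow> \<tau> \<in> uhp \<Longrightarrow> (v i has_field_derivative w i \<tau>) (at \<tau>)"
    and cu': "\<And>i. i \<in> I \<Longrightarrow> continuous_on uhp (u' i)" and cw: "\<And>i. i \<in> I \<Longrightarrow> continuous_on uhp (w i)"
    and per: "\<And>\<tau>. \<tau> \<in> uhp \<Longrightarrow> H (\<tau> + 1) = H \<tau>"
    and HQ: "strip_decay H" "strip_decay Q"
  shows "2 * \<i> * (LINT \<tau>:std_domain|lebesgue. Q \<tau>) = integral {-1/2..1/2} (\<lambda>x. lower_arc_deriv x * H (lower_arc x))"
proof -
  have cu: "continuous_on uhp (u i)" and cv: "continuous_on uhp (v i)" if "i \<in> I" for i
    using u[OF that] v[OF that] DERIV_isCont by (blast intro: continuous_at_imp_continuous_on)+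
  have cH: "continuous_on uhp H" and cQ: "continuous_on uhp Q" 
    unfolding H_def Q_def by (auto intro!: continuous_intros cu cv cw)
  have std: "std_domain \<in> sets lebesgue" "std_domain \<subseteq> strip" "std_domain \<subseteq> uhp"
    and ab: "above_arc \<in> sets lebesgue" "above_arc \<subseteq> strip" "above_arc \<subseteq> uhp"
    using open_std_domain std_domain_above_arc above_arc_strip strip_subset_uhp closed_above_arc
    by (auto simp: borel_open borel_closed)
  define L where "L = (\<lambda>n::nat. LINT \<tau>:above_arc_upto (real n)|lebesgue. Q \<tau>)"
  have "L \<longlonglongrightarrow> (LINT \<tau>:(\<Union>n::nat. above_arc_upto (real n))|lebesgue. Q \<tau>)"
    unfolding L_def
  proof (rule set_integral_cont_up)
    show "above_arc_upto (real n) \<in> sets lebesgue" for n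
      using closed_above_arc_upto by (simp add: borel_closed)
    show "incseq (\<lambda>n. above_arc_upto (real n))" by (auto simp: incseq_def above_arc_upto_def)
    show "set_integrable lebesgue (\<Union>n. above_arc_upto (real n)) Q"
      using closed_above_arc_upto above_arc_upto_subset above_arc_strip
      by (intro strip_decay_integrable cQ HQ sets.countable_UN) (auto simp: borel_closed)
  qed
  also have "(\<Union>n::nat. above_arc_upto (real n)) = above_arc"
  proof (intro equalityI subsetI)
    fix \<tau> assume \<tau>: "\<tau> \<in> above_arc"
    obtain n :: nat where "Im \<tau> - sqrt (1 - (Re \<tau>)\<^sup>2) \<le> real n" using real_arch_simple by blast
    thus "\<tau> \<in> (\<Union>n::nat. above_arc_upto (real n))" using \<tau> by (auto simp: above_arc_def above_arc_upto_def algebra_simps)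
  qed (use above_arc_upto_subset in auto)
  also have "(LINT \<tau>:above_arc|lebesgue. Q \<tau>) = (LINT \<tau>:std_domain|lebesgue. Q \<tau>)"
  proof (rule set_integral_cong_set)
    show "set_borel_measurable lebesgue std_domain Q" "set_borel_measurable lebesgue above_arc Q"
      unfolding set_borel_measurable_def using cQ std ab by (auto intro: borel_measurable_lebesgue_uhp)
    have "AE \<tau> in lebesgue. \<tau> \<notin> std_boundary"
      using negligible_std_boundary unfolding negligible_iff_null_sets by (rule AE_not_in)
    thus "AE \<tau> in lebesgue. (\<tau> \<in> std_domain) = (\<tau> \<in> above_arc)"
      by eventually_elim (use above_arc_minus_std_domain std_domain_above_arc in blast)
  qed
  finally have lim1: "(\<lambda>n. 2 * \<i> * L n) \<longlonglongrightarrow> 2 * \<i> * (LINT \<tau>:std_domain|lebesgue. Q \<tau>)"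
    by (intro tendsto_intros)
  define E where "E = (\<lambda>n::nat. integral {-1/2..1/2} (\<lambda>x. lower_arc_deriv x * H (lower_arc x + \<i> * of_real (real n))))"
  have LE: "2 * \<i> * L n = integral {-1/2..1/2} (\<lambda>x. lower_arc_deriv x * H (lower_arc x)) - E n" for n
  proof -
    have "2 * \<i> * L n = 2 * \<i> * integral {-1/2..1/2} (\<lambda>x. integral {0..real n} (\<lambda>s. Q (lower_arc x + \<i> * of_real s)))"
      unfolding L_def integral_above_arc_upto[OF cQ HQ(2)] ..
    also have "\<dots> = integral {-1/2..1/2} (\<lambda>x. lower_arc_deriv x * H (lower_arc x)) - E n"
      unfolding E_def H_def Q_def by (rule green_identity_upto[OF I u v cu' cw per[unfolded H_def]]) auto
    finally show ?thesis .
  qed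
  have "E \<longlonglongrightarrow> 0"
  proof -
    obtain C c where C: "C \<ge> 0" "c > 0" and bd: "\<And>\<tau>. \<tau> \<in> strip \<Longrightarrow> norm (H \<tau>) \<le> C * exp (- c * Im \<tau>)"
      using HQ(1) by (auto simp: strip_decay_def)
    have "norm (E n) \<le> 2 * C * exp (- c * real n) * (1/2 - (-1/2))" for n
      unfolding E_def
    proof (rule integral_bound)
      show "continuous_on {-1/2..1/2} (\<lambda>x. lower_arc_deriv x * H (lower_arc x + \<i> * of_real (real n)))"
        using lower_arc_shift_strip[of _ "real n"] strip_subset_uhp
        by (intro continuous_intros continuous_on_lower_arc_deriv continuous_on_compose2[OF cH] continuous_on_lower_arc)
           (force simp: abs_le_iff)
      fix x :: real assume "x \<in> {-1/2..1/2}"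
      hence x: "\<bar>x\<bar> \<le> 1/2" by auto
      have "norm (H (lower_arc x + \<i> * of_real (real n))) \<le> C * exp (- c * Im (lower_arc x + \<i> * of_real (real n)))"
        by (rule bd[OF lower_arc_shift_strip[OF x]]) simp
      also have "\<dots> \<le> C * exp (- c * real n)"
      proof -
        have "0 \<le> sqrt (1 - x\<^sup>2)" using half_le_sqrt[OF x] by linarith
        thus ?thesis using C by (intro mult_left_mono) (simp_all add: lower_arc_def)
      qed
      finally have "norm (lower_arc_deriv x) * norm (H (lower_arc x + \<i> * of_real (real n))) \<le> 2 * (C * exp (- c * real n))"
        using norm_lower_arc_deriv[OF x] by (intro mult_mono) auto
      thus "norm (lower_arc_deriv x * H (lower_arc x + \<i> * of_real (real n))) \<le> 2 * C * exp (- c * real n)"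
        by (simp add: norm_mult mult.assoc)
    qed simp
    hence "\<forall>\<^sub>F n in sequentially. norm (E n) \<le> 2 * C * exp (- c * real n) * (1/2 - (-1/2))"
      by (intro always_eventually allI)
    moreover have "(\<lambda>n. 2 * C * exp (- c * real n) * (1/2 - (-1/2))) \<longlonglongrightarrow> 0"
      using C by real_asymp
    ultimately show ?thesis by (rule Lim_null_comparison)
  qed
  hence "(\<lambda>n. 2 * \<i> * L n) \<longlonglongrightarrow> integral {-1/2..1/2} (\<lambda>x. lower_arc_deriv x * H (lower_arc x)) - 0"
    unfolding LE by (intro tendsto_intros)
  from LIMSEQ_unique[OF lim1 this] show ?thesis by simp
qed

text \<open>On the unit circle the map \<open>- 1 / \<tau>\<close> is reflection in the imaginary
  axis.\<close>

lemma lower_arc_inversion: "\<bar>x\<bar> \<le> 1/2 \<Longrightarrow> - 1 / lower_arc x = lower_arc (- x)"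
proof -
  assume x: "\<bar>x\<bar> \<le> 1/2"
  have "\<bar>x\<bar>\<^sup>2 \<le> (1/2)\<^sup>2" using x by (intro power_mono) auto
  hence "x\<^sup>2 \<le> 1" by (simp add: power2_eq_square)
  hence "lower_arc (- x) * lower_arc x = -1" by (simp add: lower_arc_def complex_eq_iff power2_eq_square)
  moreover have "lower_arc x \<noteq> 0" using lower_arc_strip[OF x] by (auto simp: strip_def)
  ultimately show ?thesis by (simp add: field_simps)
qed

text \<open>Inversion exchanges the two halves of the arc and fixes \<open>\<i>\<close>. Folding
  replaces \<open>H\<close>, which need not be holomorphic, by its cocycle \<open>h\<close>, which
  has a primitive, so that only the endpoints of the left half remain.\<close>

lemma lower_arc_integral:
  assumes H: "continuous_on uhp H" and \<Psi>: "primitive_on_uhp \<Psi> h"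
    and inv: "\<And>\<tau>. \<tau> \<in> uhp \<Longrightarrow> H \<tau> - H (- 1 / \<tau>) / \<tau>\<^sup>2 = h \<tau>"
  shows "integral {-1/2..1/2} (\<lambda>x. lower_arc_deriv x * H (lower_arc x)) = \<Psi> \<i> - \<Psi> (lower_arc (-1/2))"
proof -
  let ?f = "\<lambda>x. lower_arc_deriv x * H (lower_arc x)"
  have uhp: "lower_arc x \<in> uhp" if "x \<in> {-1/2..1/2}" for x
    using lower_arc_strip[of x] that strip_subset_uhp by (auto simp: abs_le_iff)
  have "continuous_on {-1/2..1/2} ?f"
    using uhp by (intro continuous_intros continuous_on_lower_arc_deriv continuous_on_compose2[OF H] continuous_on_lower_arc) auto
  hence int: "?f integrable_on {-1/2..1/2}" by (rule integrable_continuous_interval)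
  \<comment> \<open>The derivative of the relation between the arc and its inverse, checked by
    algebra from the equation of the circle.\<close>
  have deriv: "lower_arc_deriv (- x) = - lower_arc_deriv x / (lower_arc x)\<^sup>2" if x: "x \<in> {-1/2..0}" for x
  proof -
    have x': "\<bar>x\<bar> \<le> 1/2" using x by auto
    define s where "s = sqrt (1 - x\<^sup>2)"
    have s: "s \<ge> 1/2" unfolding s_def by (rule half_le_sqrt[OF x'])
    have "s > 0" using s by linarith
    hence "s\<^sup>2 = 1 - x\<^sup>2" unfolding s_def by (simp only: real_sqrt_gt_0_iff) simp
    hence s2: "s * s = 1 - x * x" by (simp add: power2_eq_square)
    have "lower_arc_deriv (- x) * (lower_arc x)\<^sup>2 = - lower_arc_deriv x"
    proof -
      have "Complex 1 (x / s) * (Complex x s)\<^sup>2 = - Complex 1 (- x / s)" if "s > 0" "s * s = 1 - x * x" for x s :: real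
      proof -
        define t where "t = x / s"
        have x: "x = t * s" using that by (simp add: t_def)
        have e: "s * s + t * s * (t * s) = 1" using that(2) by (simp add: x)
        have "t * s * (t * s) - s * s - t * (t * s * s + s * (t * s)) = - 1"
          "t * s * s + s * (t * s) + t * (t * s * (t * s) - s * s) = t"
          using e by algebra+
        hence "Complex 1 t * (Complex (t * s) s)\<^sup>2 = - Complex 1 (- t)"
          by (simp add: complex_eq_iff power2_eq_square)
        thus ?thesis using that(1) by (simp add: x)
      qed
      from this[OF \<open>s > 0\<close> s2] show ?thesis by (simp add: lower_arc_def lower_arc_deriv_def s_def)
    qed
    moreover have "lower_arc x \<noteq> 0" using lower_arc_strip[OF x'] by (auto simp: strip_def)
    ultimately show ?thesis by (simp add: field_simps)
  qed
  have "integral {-1/2..1/2} ?f = integral {-1/2..0} ?f + integral {0..1/2} ?f"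
    by (rule Henstock_Kurzweil_Integration.integral_combine[symmetric]) (use int in auto)
  also have "integral {0..1/2} ?f = integral {-1/2..0} (\<lambda>x. ?f (- x))"
  proof -
    have "integral {-(1/2)..-0} (\<lambda>x. ?f (- x)) = integral {0..1/2} ?f"
      by (rule Henstock_Kurzweil_Integration.integral_reflect_real)
    thus ?thesis by simp
  qed
  also have "integral {-1/2..0} ?f + integral {-1/2..0} (\<lambda>x. ?f (- x)) = integral {-1/2..0} (\<lambda>x. ?f x + ?f (- x))"
  proof (rule integral_add[symmetric])
    show "?f integrable_on {-1/2..0}" by (rule integrable_on_subinterval[OF int]) auto
    have "?f integrable_on {0..1/2}" by (rule integrable_on_subinterval[OF int]) auto
    hence "(\<lambda>x. ?f (- x)) integrable_on {-(1/2)..-0}" by (rule iffD2[OF Henstock_Kurzweil_Integration.integrable_reflect_real[where f = ?f]])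
    thus "(\<lambda>x. ?f (- x)) integrable_on {-1/2..0}" by simp
  qed
  also have "\<dots> = integral {-1/2..0} (\<lambda>x. lower_arc_deriv x * h (lower_arc x))"
  proof (rule integral_cong)
    fix x :: real assume x: "x \<in> {-1/2..0}"
    have x': "\<bar>x\<bar> \<le> 1/2" using x by auto
    have hx: "h (lower_arc x) = H (lower_arc x) - H (lower_arc (- x)) / (lower_arc x)\<^sup>2"
      using inv[OF uhp, of x] x lower_arc_inversion[OF x'] by simp
    thus "?f x + ?f (- x) = lower_arc_deriv x * h (lower_arc x)"
      unfolding deriv[OF x] hx by (simp add: algebra_simps)
  qed
  also have "\<dots> = \<Psi> (lower_arc 0) - \<Psi> (lower_arc (-1/2))"
  proof (rule integral_unique, rule fundamental_theorem_of_calculus)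
    fix x :: real assume x: "x \<in> {-1/2..0}"
    have "(lower_arc has_vector_derivative lower_arc_deriv x) (at x within {-1/2..0})"
      using x by (intro lower_arc_has_vector_derivative) auto
    moreover have "(\<Psi> has_field_derivative h (lower_arc x)) (at (lower_arc x) within lower_arc ` {-1/2..0})"
      using x by (intro primitive_on_uhpD[OF \<Psi>] uhp) auto
    ultimately show "((\<lambda>x. \<Psi> (lower_arc x)) has_vector_derivative lower_arc_deriv x * h (lower_arc x)) (at x within {-1/2..0})"
      using field_vector_diff_chain_within unfolding o_def by blast
  qed simp
  also have "lower_arc 0 = \<i>" by (simp add: lower_arc_def complex_eq_iff)
  finally show ?thesis .
qed

section \<open>Decay on the strip\<close>

lemma strip_decay_mult_bounded:
  assumes "strip_decay u" and "\<And>\<tau>. \<tau> \<in> strip \<Longrightarrow> norm (v \<tau>) \<le> M"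
  shows "strip_decay (\<lambda>\<tau>. u \<tau> * v \<tau>)"
proof -
  obtain C c where C: "C \<ge> 0" "c > 0" and bd: "\<And>\<tau>. \<tau> \<in> strip \<Longrightarrow> norm (u \<tau>) \<le> C * exp (- c * Im \<tau>)"
    using assms(1) by (auto simp: strip_decay_def)
  have "norm (u \<tau> * v \<tau>) \<le> C * \<bar>M\<bar> * exp (- c * Im \<tau>)" if "\<tau> \<in> strip" for \<tau>
  proof -
    have "norm (u \<tau> * v \<tau>) \<le> (C * exp (- c * Im \<tau>)) * \<bar>M\<bar>"
      unfolding norm_mult using bd[OF that] assms(2)[OF that] C by (intro mult_mono) auto
    thus ?thesis by (simp add: mult_ac)
  qed
  thus ?thesis unfolding strip_decay_def using C by (intro exI[of _ "C * \<bar>M\<bar>"] exI[of _ c]) auto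
qed

lemma strip_decay_add:
  assumes "strip_decay u" "strip_decay v" shows "strip_decay (\<lambda>\<tau>. u \<tau> + v \<tau>)"
proof -
  obtain C c D d where C: "C \<ge> 0" "c > 0" and bd: "\<And>\<tau>. \<tau> \<in> strip \<Longrightarrow> norm (u \<tau>) \<le> C * exp (- c * Im \<tau>)"
    and D: "D \<ge> 0" "d > 0" and bd': "\<And>\<tau>. \<tau> \<in> strip \<Longrightarrow> norm (v \<tau>) \<le> D * exp (- d * Im \<tau>)"
    using assms by (auto simp: strip_decay_def)
  define e where "e = min c d"
  have "norm (u \<tau> + v \<tau>) \<le> (C + D) * exp (- e * Im \<tau>)" if \<tau>: "\<tau> \<in> strip" for \<tau>
  proof -
    have y: "Im \<tau> \<ge> 0" using \<tau> by (auto simp: strip_def)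
    have "e * Im \<tau> \<le> c * Im \<tau>" "e * Im \<tau> \<le> d * Im \<tau>" using y by (auto simp: e_def intro: mult_right_mono)
    hence "C * exp (- c * Im \<tau>) + D * exp (- d * Im \<tau>) \<le> C * exp (- e * Im \<tau>) + D * exp (- e * Im \<tau>)"
      using C D by (intro add_mono mult_left_mono) auto
    thus ?thesis using bd[OF \<tau>] bd'[OF \<tau>] norm_triangle_ineq[of "u \<tau>" "v \<tau>"] by (simp add: distrib_right)
  qed
  thus ?thesis unfolding strip_decay_def using C D by (intro exI[of _ "C + D"] exI[of _ e]) (auto simp: e_def)
qed

lemma strip_decay_sum: "finite I \<Longrightarrow> (\<And>i. i \<in> I \<Longrightarrow> strip_decay (u i)) \<Longrightarrow> strip_decay (\<lambda>\<tau>. \<Sum>i\<in>I. u i \<tau>)"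
proof (induction I rule: finite_induct)
  case empty
  show ?case by (auto simp: strip_decay_def intro!: exI[of _ 0] exI[of _ 1])
next
  case (insert i I)
  thus ?case by (simp add: strip_decay_add)
qed

text \<open>Half of the exponential rate absorbs the polynomial factor, the other half
  remains.\<close>

lemma rapid_decay_strip:
  assumes "rapid_decay F" shows "strip_decay F"
proof -
  obtain C c n where C: "C \<ge> 0" "c > 0"
    and bd: "\<And>\<tau>. Im \<tau> \<ge> 1/2 \<Longrightarrow> norm (F \<tau>) \<le> C * (1 + norm \<tau>) ^ n * exp (- c * Im \<tau>)"
    using assms by (auto simp: rapid_decay_def)
  define g where "g = (\<lambda>y::real. (2 + y) ^ n * exp (- (c/2) * y))"
  have "(g \<longlongrightarrow> 0) at_top" unfolding g_def using C by real_asymp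
  hence "\<forall>\<^sub>F y in at_top. g y < 1" by (rule order_tendstoD) simp
  then obtain Y where Y: "\<And>y. y \<ge> Y \<Longrightarrow> g y < 1" by (auto simp: eventually_at_top_linorder)
  have "continuous_on {0..Y} g" unfolding g_def by (intro continuous_intros)
  hence "bounded (g ` {0..Y})" by (intro compact_imp_bounded compact_continuous_image) auto
  then obtain B where "\<forall>x\<in>g ` {0..Y}. norm x \<le> B" unfolding bounded_iff by blast
  hence B: "norm (g y) \<le> B" if "y \<in> {0..Y}" for y using that by blast
  define M where "M = max 1 B"
  have M: "g y \<le> M" if "y \<ge> 0" for y
    using Y[of y] B[of y] that by (cases "y \<ge> Y") (auto simp: M_def le_max_iff_disj)
  have "norm (F \<tau>) \<le> C * M * exp (- (c/2) * Im \<tau>)" if \<tau>: "\<tau> \<in> strip" for \<tau>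
  proof -
    have y: "Im \<tau> \<ge> 1/2" and x: "\<bar>Re \<tau>\<bar> \<le> 1/2" using \<tau> by (auto simp: strip_def)
    have "1 + norm \<tau> \<le> 2 + Im \<tau>" using cmod_le[of \<tau>] x y by linarith
    hence "(1 + norm \<tau>) ^ n \<le> (2 + Im \<tau>) ^ n" by (intro power_mono) auto
    hence "norm (F \<tau>) \<le> C * (2 + Im \<tau>) ^ n * exp (- c * Im \<tau>)"
      using bd[OF y] C by (elim order_trans) (intro mult_right_mono mult_left_mono, auto)
    also have "exp (- c * Im \<tau>) = exp (- (c/2) * Im \<tau>) * exp (- (c/2) * Im \<tau>)" by (simp add: exp_add[symmetric])
    also have "C * (2 + Im \<tau>) ^ n * (exp (- (c/2) * Im \<tau>) * exp (- (c/2) * Im \<tau>)) = C * g (Im \<tau>) * exp (- (c/2) * Im \<tau>)"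
      by (simp only: g_def mult.assoc)
    also have "\<dots> \<le> C * M * exp (- (c/2) * Im \<tau>)"
      using C M[of "Im \<tau>"] y by (intro mult_right_mono mult_left_mono) auto
    finally show ?thesis .
  qed
  moreover have "C * M \<ge> 0" using C by (simp add: M_def)
  ultimately show ?thesis unfolding strip_decay_def using C by (intro exI[of _ "C * M"] exI[of _ "c/2"]) auto
qed

lemma strip_decay_bounded:
  assumes "strip_decay F" obtains M where "\<And>\<tau>. \<tau> \<in> strip \<Longrightarrow> norm (F \<tau>) \<le> M"
proof -
  obtain C c where C: "C \<ge> 0" "c > 0" and bd: "\<And>\<tau>. \<tau> \<in> strip \<Longrightarrow> norm (F \<tau>) \<le> C * exp (- c * Im \<tau>)"
    using assms by (auto simp: strip_decay_def)
  have "norm (F \<tau>) \<le> C" if \<tau>: "\<tau> \<in> strip" for \<tau>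
  proof -
    have "C * exp (- c * Im \<tau>) \<le> C * 1" using C \<tau> by (intro mult_left_mono) (auto simp: strip_def)
    thus ?thesis using bd[OF \<tau>] by simp
  qed
  thus ?thesis by (rule that)
qed

text \<open>Limits at cusps are defined by approaches, and these need not be continuous: points that
  violate uniformity at every height can be joined to a step function approaching infinity in a
  sector, which contradicts the limit. At bounded height compactness gives the bound.\<close>

lemma cusp_limit_strip_bounded:
  assumes lim: "cusp_limit \<Phi> Inf_cusp L" and cont: "continuous_on uhp \<Phi>"
  obtains M where "\<And>\<tau>. \<tau> \<in> strip \<Longrightarrow> norm (\<Phi> \<tau>) \<le> M"
proof -
  have "\<exists>n::nat. \<forall>\<tau>\<in>strip. Im \<tau> \<ge> real n \<longrightarrow> norm (\<Phi> \<tau> - L) < 1"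
  proof (rule ccontr)
    assume "\<not> ?thesis"
    hence "\<forall>n::nat. \<exists>\<tau>. \<tau> \<in> strip \<and> Im \<tau> \<ge> real n \<and> norm (\<Phi> \<tau> - L) \<ge> 1" by (auto simp: not_less)
    then obtain \<sigma> where \<sigma>: "\<And>n::nat. \<sigma> n \<in> strip" "\<And>n. Im (\<sigma> n) \<ge> real n" "\<And>n. norm (\<Phi> (\<sigma> n) - L) \<ge> 1"
      by metis
    define p where "p = (\<lambda>t::real. \<sigma> (nat \<lfloor>t\<rfloor>))"
    have "filterlim (\<lambda>t. Im (p t)) at_top at_top"
    proof (rule filterlim_at_top_mono[where f = "\<lambda>t. t - 1"])
      show "filterlim (\<lambda>t::real. t - 1) at_top at_top" by real_asymp
      show "\<forall>\<^sub>F t in at_top. t - 1 \<le> Im (p t)"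
        using eventually_ge_at_top[of "0::real"]
      proof eventually_elim
        case (elim t)
        have "t - 1 \<le> real (nat \<lfloor>t\<rfloor>)" using elim by linarith
        thus ?case using \<sigma>(2)[of "nat \<lfloor>t\<rfloor>"] by (simp add: p_def)
      qed
    qed
    moreover have "\<bar>Re (p t)\<bar> \<le> 1 * Im (p t)" for t
      using \<sigma>(1)[of "nat \<lfloor>t\<rfloor>"] by (simp add: p_def strip_def)
    ultimately have "tends_to_cusp p Inf_cusp at_top" by (auto intro!: exI[of _ 1])
    moreover have "\<forall>\<^sub>F t in at_top. p t \<in> uhp" using \<sigma>(1) strip_subset_uhp
      by (intro always_eventually) (auto simp: p_def)
    ultimately have "((\<lambda>t. \<Phi> (p t)) \<longlongrightarrow> L) at_top" using cusp_limitD[OF lim] by blast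
    hence "\<forall>\<^sub>F t in at_top. dist (\<Phi> (p t)) L < 1" by (rule tendstoD) simp
    then obtain t where "dist (\<Phi> (p t)) L < 1" by (auto dest: eventually_happens)
    thus False using \<sigma>(3)[of "nat \<lfloor>t\<rfloor>"] by (simp add: p_def dist_norm)
  qed
  then obtain n :: nat where n: "\<And>\<tau>. \<tau> \<in> strip \<Longrightarrow> Im \<tau> \<ge> real n \<Longrightarrow> norm (\<Phi> \<tau> - L) < 1" by blast
  define K where "K = cbox (Complex (-1/2) (1/2)) (Complex (1/2) (real n))"
  have "K \<subseteq> uhp" by (auto simp: K_def in_cbox_complex_iff uhp_def)
  hence "bounded (\<Phi> ` K)"
    by (intro compact_imp_bounded compact_continuous_image continuous_on_subset[OF cont]) (auto simp: K_def)
  then obtain B where B: "\<And>\<tau>. \<tau> \<in> K \<Longrightarrow> norm (\<Phi> \<tau>) \<le> B" by (auto simp: bounded_iff)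
  have "norm (\<Phi> \<tau>) \<le> max B (norm L + 1)" if \<tau>: "\<tau> \<in> strip" for \<tau>
  proof (cases "Im \<tau> \<ge> real n")
    case True
    have "norm (\<Phi> \<tau>) \<le> norm L + norm (\<Phi> \<tau> - L)" using norm_triangle_ineq[of L "\<Phi> \<tau> - L"] by simp
    thus ?thesis using n[OF \<tau> True] by simp
  next
    case False
    have "\<bar>Re \<tau>\<bar> \<le> 1/2" "Im \<tau> \<ge> 1/2" using \<tau> by (auto simp: strip_def)
    hence "- 1/2 \<le> Re \<tau>" "Re \<tau> \<le> 1/2" "1/2 \<le> Im \<tau>" by linarith+
    hence "\<tau> \<in> K" using False by (simp add: K_def in_cbox_complex_iff)
    thus ?thesis using B by (simp add: le_max_iff_disj)
  qed
  thus ?thesis by (rule that)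
qed

section \<open>Haberland's formula for a kernel\<close>

lemma primitive_on_uhp_holomorphic:
  assumes "primitive_on_uhp \<Phi> F"
  shows "\<Phi> holomorphic_on uhp" "F holomorphic_on uhp" "continuous_on uhp \<Phi>" "continuous_on uhp F"
proof -
  show 1: "\<Phi> holomorphic_on uhp"
    using assms open_uhp by (auto simp: primitive_on_uhp_def holomorphic_on_open)
  have d: "deriv \<Phi> \<tau> = F \<tau>" if "\<tau> \<in> uhp" for \<tau>
    using primitive_on_uhpD[OF assms that, of UNIV] by (rule DERIV_imp_deriv)
  show 2: "F holomorphic_on uhp" by (rule holomorphic_transform[OF holomorphic_deriv[OF 1 open_uhp] d])
  show "continuous_on uhp \<Phi>" "continuous_on uhp F" using 1 2 by (auto intro: holomorphic_on_imp_continuous_on)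
qed

lemma constant_on_uhp:
  assumes "\<And>\<tau>. \<tau> \<in> uhp \<Longrightarrow> (f has_field_derivative 0) (at \<tau>)" "\<tau> \<in> uhp" "\<tau>' \<in> uhp"
  shows "f \<tau> = (f \<tau>' :: complex)"
proof -
  have "\<exists>c. \<forall>\<tau>\<in>uhp. f \<tau> = c"
    by (rule has_field_derivative_zero_constant[OF convex_uhp]) (rule has_field_derivative_at_within[OF assms(1)])
  then obtain c where "\<And>\<tau>. \<tau> \<in> uhp \<Longrightarrow> f \<tau> = c" by blast
  thus ?thesis using assms by simp
qed

section \<open>Interior points and cusps as endpoints of paths\<close>

datatype xpoint = Interior complex | Cusp cusp

fun ext_value :: "(complex \<Rightarrow> complex) \<Rightarrow> xpoint \<Rightarrow> complex" where
  "ext_value \<Phi> (Interior z) = \<Phi> z"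
| "ext_value \<Phi> (Cusp c) = cusp_value \<Phi> c"

fun approaches :: "(real \<Rightarrow> complex) \<Rightarrow> xpoint \<Rightarrow> bool" where
  "approaches p (Interior z) \<longleftrightarrow> z \<in> uhp \<and> (\<forall>\<^sub>F t in at_top. p t \<in> uhp) \<and> (p \<longlongrightarrow> z) at_top"
| "approaches p (Cusp c) \<longleftrightarrow> (\<forall>\<^sub>F t in at_top. p t \<in> uhp) \<and> tends_to_cusp p c at_top"

text \<open>The action on cusps is expressed by one approach whose image is again an approach. A
  single witness suffices, since the limits of the primitives do not depend on the approach.\<close>

definition carries :: "int ^ 2 ^ 2 \<Rightarrow> xpoint \<Rightarrow> xpoint \<Rightarrow> bool" where
  "carries A x x' \<longleftrightarrow> (\<exists>p. approaches p x \<and> approaches (\<lambda>t. mobius A (p t)) x')"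

abbreviation "mat_T \<equiv> sl2 1 1 0 1"
abbreviation "mat_S \<equiv> sl2 0 (-1) 1 0"
text \<open>The product \<open>mat_S ** mat_T\<close>; on cusps it acts as the cycle infinity, 0,
  -1.\<close>

abbreviation "mat_U \<equiv> sl2 0 (-1) 1 1"
abbreviation "cusp_inf \<equiv> Cusp Inf_cusp"
abbreviation "cusp_int a \<equiv> Cusp (Rat_cusp (of_int a))"

lemma mobius_TSU:
  "mobius mat_T \<tau> = \<tau> + 1" "mobius mat_S \<tau> = - 1 / \<tau>" "mobius mat_U \<tau> = - 1 / (\<tau> + 1)"
  by (simp_all add: mobius_def aut_factor_def)

lemma TSU_SL2Z: "mat_T \<in> carrier SL2Z" "mat_S \<in> carrier SL2Z" "mat_U \<in> carrier SL2Z"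
  by (simp_all add: SL2Z_iff)

lemma approaches_inf: "approaches (\<lambda>t. \<i> * of_real t) cusp_inf" "approaches (\<lambda>t. \<i> * of_real t + 1) cusp_inf"
proof -
  have 1: "\<forall>\<^sub>F t in at_top. t > (0::real)" by (rule eventually_gt_at_top)
  have 2: "\<forall>\<^sub>F t in at_top. t \<ge> (1::real)" by (rule eventually_ge_at_top)
  show "approaches (\<lambda>t. \<i> * of_real t) cusp_inf"
    using 1 by (auto simp: uhp_def filterlim_ident intro!: exI[of _ 1] elim: eventually_mono)
  show "approaches (\<lambda>t. \<i> * of_real t + 1) cusp_inf"
    using 1 2 by (auto simp: uhp_def filterlim_ident intro!: exI[of _ 1] elim: eventually_mono)
qed

lemma approaches_cusp_intI:
  assumes p: "\<And>t. t \<ge> 1 \<Longrightarrow> p t = Complex (of_int a + x t) (y t)"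
    and xy: "\<And>t. t \<ge> 1 \<Longrightarrow> \<bar>x t\<bar> \<le> y t \<and> 0 < y t"
    and lim: "(x \<longlongrightarrow> 0) at_top" "(y \<longlongrightarrow> 0) at_top"
  shows "approaches p (cusp_int a)"
proof -
  have 1: "\<forall>\<^sub>F t in at_top. t \<ge> (1::real)" by (rule eventually_ge_at_top)
  have "(p \<longlongrightarrow> of_rat (of_int a)) at_top"
  proof (rule Lim_transform_eventually)
    have "((\<lambda>t. Complex (of_int a + x t) (y t)) \<longlongrightarrow> Complex (of_int a + 0) 0) at_top"
      by (intro tendsto_Complex tendsto_add tendsto_const lim)
    also have "Complex (of_int a + 0) 0 = of_rat (of_int a)" by (simp add: complex_eq_iff)
    finally show "((\<lambda>t. Complex (of_int a + x t) (y t)) \<longlongrightarrow> of_rat (of_int a)) at_top" .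
    show "\<forall>\<^sub>F t in at_top. Complex (of_int a + x t) (y t) = p t" using 1 by eventually_elim (simp add: p)
  qed
  moreover have "\<forall>\<^sub>F t in at_top. p t \<in> uhp" using 1 by eventually_elim (simp add: p xy uhp_def)
  moreover have "\<forall>\<^sub>F t in at_top. \<bar>Re (p t) - of_rat (of_int a)\<bar> \<le> 1 * Im (p t)"
    using 1 by eventually_elim (simp add: p xy)
  ultimately show ?thesis unfolding approaches.simps tends_to_cusp.simps by blast
qed

lemma approaches_int: "approaches (\<lambda>t. of_int a + \<i> / of_real t) (cusp_int a)"
proof (rule approaches_cusp_intI[where x = "\<lambda>_. 0" and y = "\<lambda>t. 1 / t"])
  show "((\<lambda>t::real. 1 / t) \<longlongrightarrow> 0) at_top" by real_asymp
qed (auto simp: complex_eq_iff Re_divide_of_real Im_divide_of_real)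

text \<open>Both are the image under \<open>mat_U\<close> of the imaginary axis, a half-circle from
  -1 to 0, followed towards either end. Its coordinates are rational functions of \<open>t\<close>,
  and for \<open>t \<ge> 1\<close> they lie in the sector of constant one.\<close>

lemma approaches_tangent:
  "approaches (\<lambda>t. - 1 / (\<i> * of_real t + 1)) (cusp_int 0)"
  "approaches (\<lambda>t. - 1 / (of_int 0 + \<i> / of_real t + 1)) (cusp_int (-1))"
proof -
  define x y where "x = (\<lambda>t::real. 1 / (1 + t\<^sup>2))" and "y = (\<lambda>t::real. t / (1 + t\<^sup>2))"
  have y: "y t = t * x t" for t by (simp add: x_def y_def)
  have x: "x t + t * t * x t = 1" "x t > 0" for t
  proof -
    have "1 + t\<^sup>2 > 0" by (intro add_pos_nonneg) auto
    thus "x t + t * t * x t = 1" "x t > 0"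
      by (simp_all add: x_def add_divide_distrib[symmetric] power2_eq_square)
  qed
  have lim: "((\<lambda>t. - x t) \<longlongrightarrow> 0) at_top" "(x \<longlongrightarrow> 0) at_top" "(y \<longlongrightarrow> 0) at_top"
    unfolding x_def y_def by real_asymp+
  have xy: "\<bar>x t\<bar> \<le> y t \<and> 0 < y t" if "t \<ge> 1" for t
    using that x(2)[of t] by (simp add: y)
  show "approaches (\<lambda>t. - 1 / (\<i> * of_real t + 1)) (cusp_int 0)"
  proof (rule approaches_cusp_intI[OF _ _ lim(1,3)])
    fix t :: real
    have "\<i> * of_real t + 1 \<noteq> 0" by (simp add: complex_eq_iff)
    moreover have "Complex (- x t) (y t) * (\<i> * of_real t + 1) = - 1"
      using x(1)[of t] by (simp add: complex_eq_iff y algebra_simps)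
    ultimately have "- 1 / (\<i> * of_real t + 1) = Complex (- x t) (y t)"
      by (metis nonzero_eq_divide_eq)
    thus "- 1 / (\<i> * of_real t + 1) = Complex (of_int 0 + - x t) (y t)" by simp
  qed (use xy in simp)
  show "approaches (\<lambda>t. - 1 / (of_int 0 + \<i> / of_real t + 1)) (cusp_int (-1))"
  proof (rule approaches_cusp_intI[OF _ _ lim(2,3)])
    fix t :: real assume t: "t \<ge> 1"
    have e: "of_int 0 + \<i> / of_real t + 1 = Complex 1 (1 / t)"
      by (simp add: complex_eq_iff Re_divide_of_real Im_divide_of_real)
    have "(- 1 + x t) / t + t * x t = 0"
      using t x(1)[of t] by (simp add: field_simps)
    hence "Complex (- 1 + x t) (y t) * Complex 1 (1 / t) = - 1"
      using t by (simp add: complex_eq_iff y)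
    moreover have "Complex 1 (1 / t) \<noteq> 0" by (simp add: complex_eq_iff)
    ultimately have "- 1 / Complex 1 (1 / t) = Complex (- 1 + x t) (y t)" by (metis nonzero_eq_divide_eq)
    thus "- 1 / (of_int 0 + \<i> / of_real t + 1) = Complex (of_int (-1) + x t) (y t)" unfolding e by simp
  qed (use xy in simp)
qed

lemma approaches_cong: "approaches p x \<Longrightarrow> (\<And>t. t > 0 \<Longrightarrow> p t = q t) \<Longrightarrow> approaches q x"
proof -
  assume p: "approaches p x" and pq: "\<And>t. t > 0 \<Longrightarrow> p t = q t"
  have ev: "\<forall>\<^sub>F t in at_top. p t = q t"
    using eventually_gt_at_top[of 0] by eventually_elim (rule pq)
  have P: "(\<forall>\<^sub>F t in at_top. P (p t)) = (\<forall>\<^sub>F t in at_top. P (q t))" for P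
    by (rule eventually_cong[OF ev]) auto
  have lim: "(p \<longlongrightarrow> l) at_top = (q \<longlongrightarrow> l) at_top" for l
    by (rule filterlim_cong[OF refl refl ev])
  have Im: "filterlim (\<lambda>t. Im (p t)) at_top at_top = filterlim (\<lambda>t. Im (q t)) at_top at_top"
    by (rule filterlim_cong[OF refl refl]) (use ev in \<open>auto elim: eventually_mono\<close>)
  show ?thesis
  proof (cases x)
    case (Interior z)
    thus ?thesis using p P[of "\<lambda>z. z \<in> uhp"] lim by simp
  next
    case (Cusp c)
    show ?thesis
    proof (cases c)
      case (Rat_cusp a)
      have "(\<forall>\<^sub>F t in at_top. \<bar>Re (p t) - of_rat a\<bar> \<le> C * Im (p t)) = (\<forall>\<^sub>F t in at_top. \<bar>Re (q t) - of_rat a\<bar> \<le> C * Im (q t))" for C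
        by (rule P)
      thus ?thesis using p P[of "\<lambda>z. z \<in> uhp"] lim
        unfolding Cusp Rat_cusp by simp
    next
      case Inf_cusp
      have "(\<forall>\<^sub>F t in at_top. \<bar>Re (p t)\<bar> \<le> C * Im (p t)) = (\<forall>\<^sub>F t in at_top. \<bar>Re (q t)\<bar> \<le> C * Im (q t))" for C
        by (rule P)
      thus ?thesis using p P[of "\<lambda>z. z \<in> uhp"] Im
        unfolding Cusp Inf_cusp by simp
    qed
  qed
qed

lemma carries_Interior: "A \<in> carrier SL2Z \<Longrightarrow> z \<in> uhp \<Longrightarrow> carries A (Interior z) (Interior (mobius A z))"
  unfolding carries_def by (rule exI[of _ "\<lambda>_. z"]) (simp add: mobius_uhp)

lemma carries_TSU:
  "carries mat_S cusp_inf (cusp_int 0)" "carries mat_S (cusp_int 0) cusp_inf"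
  "carries mat_T cusp_inf cusp_inf" "carries mat_T (cusp_int 0) (cusp_int 1)" "carries mat_T (cusp_int (-1)) (cusp_int 0)"
  "carries mat_U cusp_inf (cusp_int 0)" "carries mat_U (cusp_int 0) (cusp_int (-1))" "carries mat_U (cusp_int (-1)) cusp_inf"
  unfolding carries_def mobius_TSU
proof -
  show "\<exists>p. approaches p cusp_inf \<and> approaches (\<lambda>t. - 1 / p t) (cusp_int 0)"
    by (intro exI conjI, rule approaches_inf(1), rule approaches_cong[OF approaches_int[of 0]]) (simp add: field_simps)
  show "\<exists>p. approaches p (cusp_int 0) \<and> approaches (\<lambda>t. - 1 / p t) cusp_inf"
    by (intro exI conjI, rule approaches_int[of 0], rule approaches_cong[OF approaches_inf(1)]) (simp add: field_simps)
  show "\<exists>p. approaches p cusp_inf \<and> approaches (\<lambda>t. p t + 1) cusp_inf"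
    by (intro exI conjI, rule approaches_inf(1), rule approaches_inf(2))
  show "\<exists>p. approaches p (cusp_int 0) \<and> approaches (\<lambda>t. p t + 1) (cusp_int 1)"
    by (intro exI conjI, rule approaches_int[of 0], rule approaches_cong[OF approaches_int[of 1]]) simp
  show "\<exists>p. approaches p (cusp_int (-1)) \<and> approaches (\<lambda>t. p t + 1) (cusp_int 0)"
    by (intro exI conjI, rule approaches_int[of "-1"], rule approaches_cong[OF approaches_int[of 0]]) simp
  show "\<exists>p. approaches p cusp_inf \<and> approaches (\<lambda>t. - 1 / (p t + 1)) (cusp_int 0)"
    by (intro exI conjI, rule approaches_inf(1), rule approaches_tangent(1))
  show "\<exists>p. approaches p (cusp_int 0) \<and> approaches (\<lambda>t. - 1 / (p t + 1)) (cusp_int (-1))"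
    by (intro exI conjI, rule approaches_int[of 0], rule approaches_tangent(2))
  show "\<exists>p. approaches p (cusp_int (-1)) \<and> approaches (\<lambda>t. - 1 / (p t + 1)) cusp_inf"
    by (intro exI conjI, rule approaches_int[of "-1"], rule approaches_cong[OF approaches_inf(1)]) (simp add: field_simps)
qed

text \<open>The automorphy factors in \<open>invariant\<close> cancel those of the two
  differentials. Only \<open>E\<close> is normalised at infinity; its two limits there, zero and the
  chosen \<open>cusp_value\<close>, are identified later by uniqueness.\<close>

locale invariant_kernel =
  fixes I :: "'i set" and U W \<Phi> E :: "'i \<Rightarrow> complex \<Rightarrow> complex"
  assumes finite_I: "finite I"
    and prim_\<Phi>: "i \<in> I \<Longrightarrow> primitive_on_uhp (\<Phi> i) (U i)"
    and prim_E: "i \<in> I \<Longrightarrow> primitive_on_uhp (E i) (W i)"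
    and lim_\<Phi>: "i \<in> I \<Longrightarrow> cusp_limit (\<Phi> i) Inf_cusp (cusp_value (\<Phi> i) Inf_cusp)"
      "i \<in> I \<Longrightarrow> cusp_limit (\<Phi> i) (Rat_cusp (of_int a)) (cusp_value (\<Phi> i) (Rat_cusp (of_int a)))"
    and lim_E: "i \<in> I \<Longrightarrow> cusp_limit (E i) Inf_cusp 0"
      "i \<in> I \<Longrightarrow> cusp_limit (E i) Inf_cusp (cusp_value (E i) Inf_cusp)"
      "i \<in> I \<Longrightarrow> cusp_limit (E i) (Rat_cusp (of_int a)) (cusp_value (E i) (Rat_cusp (of_int a)))"
    and decay_U: "i \<in> I \<Longrightarrow> rapid_decay (U i)" and decay_W: "i \<in> I \<Longrightarrow> rapid_decay (W i)"
    and invariant: "A \<in> carrier SL2Z \<Longrightarrow> \<tau> \<in> uhp \<Longrightarrow> z \<in> uhp \<Longrightarrow>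
      (\<Sum>i\<in>I. U i (mobius A \<tau>) * cnj (W i (mobius A z)))
        = (aut_factor A \<tau>)\<^sup>2 * cnj ((aut_factor A z)\<^sup>2) * (\<Sum>i\<in>I. U i \<tau> * cnj (W i z))"
begin

definition psi :: "complex \<Rightarrow> complex \<Rightarrow> complex" where
  "psi \<tau> z = (\<Sum>i\<in>I. \<Phi> i \<tau> * cnj (E i z))"

definition psi' :: "complex \<Rightarrow> complex \<Rightarrow> complex" where
  "psi' \<tau> z = (\<Sum>i\<in>I. U i \<tau> * cnj (E i z))"

definition kernel :: "complex \<Rightarrow> complex \<Rightarrow> complex" where
  "kernel \<tau> z = (\<Sum>i\<in>I. U i \<tau> * cnj (W i z))"

definition xpsi :: "xpoint \<Rightarrow> xpoint \<Rightarrow> complex" where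
  "xpsi x y = (\<Sum>i\<in>I. ext_value (\<Phi> i) x * cnj (ext_value (E i) y))"

text \<open>Formally the double integral of the kernel over a path from \<open>x\<close> to
  \<open>x'\<close> and a path from \<open>y\<close> to \<open>y'\<close>. Writing it with
  primitives treats interior endpoints and cusps alike.\<close>

definition pairing :: "xpoint \<Rightarrow> xpoint \<Rightarrow> xpoint \<Rightarrow> xpoint \<Rightarrow> complex" where
  "pairing x x' y y' = xpsi x' y' - xpsi x y' - xpsi x' y + xpsi x y"

lemma psi_derivative: "\<tau> \<in> uhp \<Longrightarrow> ((\<lambda>\<tau>. psi \<tau> z) has_field_derivative psi' \<tau> z) (at \<tau>)"
  unfolding psi_def psi'_def
  by (intro DERIV_sum DERIV_cmult_right primitive_on_uhpD[OF prim_\<Phi>])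

lemma psi'_cnj_derivative: "z \<in> uhp \<Longrightarrow> ((\<lambda>z. cnj (psi' \<tau> z)) has_field_derivative cnj (kernel \<tau> z)) (at z)"
  unfolding psi'_def kernel_def cnj_sum complex_cnj_mult complex_cnj_cnj
  by (intro DERIV_sum DERIV_cmult primitive_on_uhpD[OF prim_E])

text \<open>By invariance of the kernel, \<open>cnj (psi' (mobius A \<tau>) (mobius A z) / (aut_factor A \<tau>)\<^sup>2 - psi' \<tau> z)\<close> has derivative
  zero in \<open>z\<close>; the same argument in \<open>\<tau>\<close> then shows that second differences of \<open>psi\<close> are invariant.\<close>

lemma psi'_mobius_diff:
  assumes A: "A \<in> carrier SL2Z" and \<tau>: "\<tau> \<in> uhp" and z: "z \<in> uhp" "z' \<in> uhp"
  shows "psi' (mobius A \<tau>) (mobius A z) / (aut_factor A \<tau>)\<^sup>2 - psi' \<tau> z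
       = psi' (mobius A \<tau>) (mobius A z') / (aut_factor A \<tau>)\<^sup>2 - psi' \<tau> z'"
proof -
  \<comment> \<open>\<open>psi'\<close> is antiholomorphic in its second argument, hence the
    conjugate.\<close>
  define f where "f = (\<lambda>z. cnj (psi' (mobius A \<tau>) (mobius A z)) / cnj ((aut_factor A \<tau>)\<^sup>2) - cnj (psi' \<tau> z))"
  have "(f has_field_derivative 0) (at z)" if z: "z \<in> uhp" for z
  proof -
    note nz = aut_factor_nonzero[OF A \<tau>] aut_factor_nonzero[OF A z]
    have "((\<lambda>z. cnj (psi' (mobius A \<tau>) (mobius A z))) has_field_derivative
        cnj (kernel (mobius A \<tau>) (mobius A z)) * (1 / (aut_factor A z)\<^sup>2)) (at z)"
      using DERIV_chain[OF psi'_cnj_derivative[OF mobius_uhp[OF A z]] mobius_has_field_derivative[OF A z]]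
      by (simp add: o_def)
    from DERIV_diff[OF DERIV_cdivide[OF this, of "cnj ((aut_factor A \<tau>)\<^sup>2)"] psi'_cnj_derivative[OF z]]
    have "(f has_field_derivative cnj (kernel (mobius A \<tau>) (mobius A z)) * (1 / (aut_factor A z)\<^sup>2) / cnj ((aut_factor A \<tau>)\<^sup>2)
        - cnj (kernel \<tau> z)) (at z)" unfolding f_def .
    moreover have "cnj (kernel (mobius A \<tau>) (mobius A z)) = cnj ((aut_factor A \<tau>)\<^sup>2) * (aut_factor A z)\<^sup>2 * cnj (kernel \<tau> z)"
      unfolding kernel_def invariant[OF A \<tau> z] by simp
    ultimately show ?thesis using nz by simp
  qed
  hence "f z = f z'" by (rule constant_on_uhp) (use z in auto)
  hence "cnj (f z) = cnj (f z')" by simp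
  thus ?thesis by (simp add: f_def)
qed

lemma psi_mobius:
  assumes A: "A \<in> carrier SL2Z" and \<tau>: "\<tau> \<in> uhp" "\<tau>' \<in> uhp" and z: "z \<in> uhp" "z' \<in> uhp"
  shows "psi (mobius A \<tau>') (mobius A z') - psi (mobius A \<tau>) (mobius A z') - psi (mobius A \<tau>') (mobius A z) + psi (mobius A \<tau>) (mobius A z)
    = psi \<tau>' z' - psi \<tau> z' - psi \<tau>' z + psi \<tau> z"
proof -
  define f where "f = (\<lambda>\<tau>. psi (mobius A \<tau>) (mobius A z') - psi (mobius A \<tau>) (mobius A z) - (psi \<tau> z' - psi \<tau> z))"
  have "(f has_field_derivative 0) (at \<tau>)" if \<tau>: "\<tau> \<in> uhp" for \<tau>
  proof -
    have d: "((\<lambda>\<tau>. psi (mobius A \<tau>) w) has_field_derivative psi' (mobius A \<tau>) w * (1 / (aut_factor A \<tau>)\<^sup>2)) (at \<tau>)" for w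
      using DERIV_chain[OF psi_derivative[OF mobius_uhp[OF A \<tau>]] mobius_has_field_derivative[OF A \<tau>]] by (simp add: o_def)
    have "(f has_field_derivative psi' (mobius A \<tau>) (mobius A z') * (1 / (aut_factor A \<tau>)\<^sup>2)
        - psi' (mobius A \<tau>) (mobius A z) * (1 / (aut_factor A \<tau>)\<^sup>2) - (psi' \<tau> z' - psi' \<tau> z)) (at \<tau>)"
      unfolding f_def by (intro DERIV_diff d psi_derivative[OF \<tau>])
    moreover have "psi' (mobius A \<tau>) (mobius A z') * (1 / (aut_factor A \<tau>)\<^sup>2)
        - psi' (mobius A \<tau>) (mobius A z) * (1 / (aut_factor A \<tau>)\<^sup>2) - (psi' \<tau> z' - psi' \<tau> z) = 0"
      using psi'_mobius_diff[OF A \<tau> z] by (simp add: algebra_simps)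
    ultimately show ?thesis by simp
  qed
  hence "f \<tau> = f \<tau>'" by (rule constant_on_uhp) (use \<tau> in auto)
  thus ?thesis by (simp add: f_def algebra_simps)
qed

definition regular_point :: "xpoint \<Rightarrow> bool" where
  "regular_point x \<longleftrightarrow> (case x of Interior z \<Rightarrow> True | Cusp c \<Rightarrow> c = Inf_cusp \<or> (\<exists>a. c = Rat_cusp (of_int a)))"

lemma regular_points [simp]: "regular_point (Interior z)" "regular_point cusp_inf" "regular_point (cusp_int a)"
  by (auto simp: regular_point_def)

lemma approaches_ext_value:
  assumes i: "i \<in> I" and x: "regular_point x" and p: "approaches p x"
  shows "((\<lambda>t. \<Phi> i (p t)) \<longlongrightarrow> ext_value (\<Phi> i) x) at_top" "((\<lambda>t. E i (p t)) \<longlongrightarrow> ext_value (E i) x) at_top"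
proof -
  have "((\<lambda>t. \<Phi> i (p t)) \<longlongrightarrow> ext_value (\<Phi> i) x) at_top \<and> ((\<lambda>t. E i (p t)) \<longlongrightarrow> ext_value (E i) x) at_top"
  proof (cases x)
    case (Interior z)
    have z: "z \<in> uhp" using p Interior by simp
    have "isCont (\<Phi> i) z" "isCont (E i) z"
      by (rule DERIV_isCont[OF primitive_on_uhpD[OF prim_\<Phi>[OF i] z]] DERIV_isCont[OF primitive_on_uhpD[OF prim_E[OF i] z]])+
    thus ?thesis using p Interior by (auto intro: isCont_tendsto_compose)
  next
    case (Cusp c)
    hence "c = Inf_cusp \<or> (\<exists>a. c = Rat_cusp (of_int a))" using x by (simp add: regular_point_def)
    hence "cusp_limit (\<Phi> i) c (cusp_value (\<Phi> i) c)" "cusp_limit (E i) c (cusp_value (E i) c)"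
      using lim_\<Phi>[OF i] lim_E[OF i] by auto
    thus ?thesis using p Cusp by (simp add: cusp_limitD)
  qed
  thus "((\<lambda>t. \<Phi> i (p t)) \<longlongrightarrow> ext_value (\<Phi> i) x) at_top" "((\<lambda>t. E i (p t)) \<longlongrightarrow> ext_value (E i) x) at_top" by auto
qed

lemma psi_tendsto:
  assumes "regular_point x" "regular_point y" "approaches p x" "approaches q y"
  shows "((\<lambda>t. psi (p t) (q t)) \<longlongrightarrow> xpsi x y) at_top"
  unfolding psi_def xpsi_def
  by (intro tendsto_sum tendsto_mult tendsto_cnj approaches_ext_value assms)

lemma approaches_uhp: "approaches p x \<Longrightarrow> \<forall>\<^sub>F t in at_top. p t \<in> uhp"
  by (cases x) auto

text \<open>The invariance of second differences at interior points passes to the limit along one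
  approach for each of the four endpoints.\<close>

lemma pairing_invariant:
  assumes A: "A \<in> carrier SL2Z" and c: "carries A x u" "carries A x' u'" "carries A y v" "carries A y' v'"
    and r: "regular_point x" "regular_point x'" "regular_point y" "regular_point y'"
      "regular_point u" "regular_point u'" "regular_point v" "regular_point v'"
  shows "pairing x x' y y' = pairing u u' v v'"
proof -
  obtain p p' q q' where
    P: "approaches p x" "approaches p' x'" "approaches q y" "approaches q' y'"
    and AP: "approaches (\<lambda>t. mobius A (p t)) u" "approaches (\<lambda>t. mobius A (p' t)) u'"
      "approaches (\<lambda>t. mobius A (q t)) v" "approaches (\<lambda>t. mobius A (q' t)) v'"
    using c unfolding carries_def by blast
  have 1: "((\<lambda>t. psi (p' t) (q' t) - psi (p t) (q' t) - psi (p' t) (q t) + psi (p t) (q t)) \<longlongrightarrow> pairing x x' y y') at_top"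
    unfolding pairing_def by (intro tendsto_add tendsto_diff psi_tendsto r P)
  have 2: "((\<lambda>t. psi (mobius A (p' t)) (mobius A (q' t)) - psi (mobius A (p t)) (mobius A (q' t))
      - psi (mobius A (p' t)) (mobius A (q t)) + psi (mobius A (p t)) (mobius A (q t))) \<longlongrightarrow> pairing u u' v v') at_top"
    unfolding pairing_def by (intro tendsto_add tendsto_diff psi_tendsto r AP)
  have "\<forall>\<^sub>F t in at_top. psi (mobius A (p' t)) (mobius A (q' t)) - psi (mobius A (p t)) (mobius A (q' t))
      - psi (mobius A (p' t)) (mobius A (q t)) + psi (mobius A (p t)) (mobius A (q t))
      = psi (p' t) (q' t) - psi (p t) (q' t) - psi (p' t) (q t) + psi (p t) (q t)"
    using P[THEN approaches_uhp] by eventually_elim (rule psi_mobius[OF A])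
  from tendsto_unique[OF _ Lim_transform_eventually[OF 2 this] 1] show ?thesis by simp
qed

lemma cusp_value_E_inf: "i \<in> I \<Longrightarrow> cusp_value (E i) Inf_cusp = 0"
proof -
  assume i: "i \<in> I"
  have "approaches (\<lambda>t. \<i> * of_real t) cusp_inf" by (rule approaches_inf)
  hence "((\<lambda>t. E i (\<i> * of_real t)) \<longlongrightarrow> 0) at_top"
    "((\<lambda>t. E i (\<i> * of_real t)) \<longlongrightarrow> cusp_value (E i) Inf_cusp) at_top"
    using cusp_limitD[OF lim_E(1)[OF i]] cusp_limitD[OF lim_E(2)[OF i]] by auto
  thus ?thesis by (intro tendsto_unique[OF _ _ \<open>((\<lambda>t. E i (\<i> * of_real t)) \<longlongrightarrow> 0) at_top\<close>]) auto
qed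

lemma xpsi_inf: "xpsi x cusp_inf = 0"
  by (simp add: xpsi_def cusp_value_E_inf)

lemma psi'_tendsto:
  assumes "regular_point y" "approaches q y"
  shows "((\<lambda>t. psi' \<tau> (q t)) \<longlongrightarrow> (\<Sum>i\<in>I. U i \<tau> * cnj (ext_value (E i) y))) at_top"
  unfolding psi'_def
  by (intro tendsto_sum tendsto_mult tendsto_cnj tendsto_const approaches_ext_value assms)

text \<open>In the difference relation one second argument is set to \<open>\<tau>\<close> and the
  other is sent to \<open>y\<close>. This shows that the defect of the diagonal function is
  holomorphic in \<open>\<tau>\<close>, although that function itself need not be.\<close>

lemma psi'_mobius:
  assumes A: "A \<in> carrier SL2Z" and c: "carries A y v" "regular_point y" "regular_point v" and \<tau>: "\<tau> \<in> uhp"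
  shows "psi' (mobius A \<tau>) (mobius A \<tau>) / (aut_factor A \<tau>)\<^sup>2 - psi' \<tau> \<tau>
    = (\<Sum>i\<in>I. U i (mobius A \<tau>) * cnj (ext_value (E i) v)) / (aut_factor A \<tau>)\<^sup>2
      - (\<Sum>i\<in>I. U i \<tau> * cnj (ext_value (E i) y))"
proof -
  obtain q where q: "approaches q y" "approaches (\<lambda>t. mobius A (q t)) v" using c unfolding carries_def by blast
  have "((\<lambda>t. psi' (mobius A \<tau>) (mobius A (q t)) / (aut_factor A \<tau>)\<^sup>2 - psi' \<tau> (q t)) \<longlongrightarrow>
      (\<Sum>i\<in>I. U i (mobius A \<tau>) * cnj (ext_value (E i) v)) / (aut_factor A \<tau>)\<^sup>2
      - (\<Sum>i\<in>I. U i \<tau> * cnj (ext_value (E i) y))) at_top"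
    using aut_factor_nonzero[OF A \<tau>] by (intro tendsto_diff tendsto_divide tendsto_const psi'_tendsto c q) auto
  moreover have "\<forall>\<^sub>F t in at_top. psi' (mobius A \<tau>) (mobius A (q t)) / (aut_factor A \<tau>)\<^sup>2 - psi' \<tau> (q t)
     = psi' (mobius A \<tau>) (mobius A \<tau>) / (aut_factor A \<tau>)\<^sup>2 - psi' \<tau> \<tau>"
    using approaches_uhp[OF q(1)] by eventually_elim (rule psi'_mobius_diff[OF A \<tau> _ \<tau>])
  ultimately have "((\<lambda>t::real. psi' (mobius A \<tau>) (mobius A \<tau>) / (aut_factor A \<tau>)\<^sup>2 - psi' \<tau> \<tau>) \<longlongrightarrow>
      (\<Sum>i\<in>I. U i (mobius A \<tau>) * cnj (ext_value (E i) v)) / (aut_factor A \<tau>)\<^sup>2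
      - (\<Sum>i\<in>I. U i \<tau> * cnj (ext_value (E i) y))) at_top"
    by (rule Lim_transform_eventually)
  thus ?thesis by (simp add: tendsto_const_iff)
qed

lemma kernel_integral:
  "2 * \<i> * (LINT \<tau>:std_domain|lebesgue. kernel \<tau> \<tau>) = pairing (Interior (lower_arc (-1/2))) (Interior \<i>) cusp_inf (cusp_int 0)"
proof -
  define H where "H = (\<lambda>\<tau>. psi' \<tau> \<tau>)"
  have hol: "U i holomorphic_on uhp" "continuous_on uhp (W i)" "continuous_on uhp (E i)" "continuous_on uhp (U i)" if "i \<in> I" for i
    using primitive_on_uhp_holomorphic[OF prim_\<Phi>[OF that]] primitive_on_uhp_holomorphic[OF prim_E[OF that]] by auto
  have dH: "strip_decay H"
    unfolding H_def psi'_def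
  proof (rule strip_decay_sum[OF finite_I])
    fix i assume i: "i \<in> I"
    obtain M where "\<And>\<tau>. \<tau> \<in> strip \<Longrightarrow> norm (E i \<tau>) \<le> M"
      using cusp_limit_strip_bounded[OF lim_E(1)[OF i] hol(3)[OF i]] by blast
    thus "strip_decay (\<lambda>\<tau>. U i \<tau> * cnj (E i \<tau>))"
      by (intro strip_decay_mult_bounded[OF rapid_decay_strip[OF decay_U[OF i]]]) simp
  qed
  have dQ: "strip_decay (\<lambda>\<tau>. kernel \<tau> \<tau>)"
    unfolding kernel_def
  proof (rule strip_decay_sum[OF finite_I])
    fix i assume i: "i \<in> I"
    obtain M where "\<And>\<tau>. \<tau> \<in> strip \<Longrightarrow> norm (W i \<tau>) \<le> M"
      using strip_decay_bounded[OF rapid_decay_strip[OF decay_W[OF i]]] by blast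
    thus "strip_decay (\<lambda>\<tau>. U i \<tau> * cnj (W i \<tau>))"
      by (intro strip_decay_mult_bounded[OF rapid_decay_strip[OF decay_U[OF i]]]) simp
  qed
  \<comment> \<open>\<open>mat_T\<close> fixes infinity, where all \<open>E i\<close> vanish, so
    both boundary sums drop out.\<close>
  have per: "H (\<tau> + 1) = H \<tau>" if "\<tau> \<in> uhp" for \<tau>
    using psi'_mobius[OF TSU_SL2Z(1) carries_TSU(3) regular_points(2,2) that]
    by (simp add: mobius_TSU H_def cusp_value_E_inf aut_factor_def)
  have "2 * \<i> * (LINT \<tau>:std_domain|lebesgue. kernel \<tau> \<tau>) = integral {-1/2..1/2} (\<lambda>x. lower_arc_deriv x * H (lower_arc x))"
    unfolding H_def kernel_def psi'_def
  proof (rule green_identity[OF finite_I])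
    show "(U i has_field_derivative deriv (U i) \<tau>) (at \<tau>)" if "i \<in> I" "\<tau> \<in> uhp" for i \<tau>
      using holomorphic_derivI[OF hol(1)[OF that(1)] open_uhp that(2)] .
    show "continuous_on uhp (deriv (U i))" if "i \<in> I" for i
      using holomorphic_deriv[OF hol(1)[OF that] open_uhp] by (rule holomorphic_on_imp_continuous_on)
    show "(E i has_field_derivative W i \<tau>) (at \<tau>)" if "i \<in> I" "\<tau> \<in> uhp" for i \<tau>
      by (rule primitive_on_uhpD[OF prim_E[OF that(1)] that(2)])
    show "continuous_on uhp (W i)" if "i \<in> I" for i using hol(2)[OF that] .
  qed (use per dH dQ in \<open>simp_all add: H_def kernel_def psi'_def\<close>)
  also have "\<dots> = xpsi (Interior \<i>) (cusp_int 0) - xpsi (Interior (lower_arc (-1/2))) (cusp_int 0)"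
  proof (rule lower_arc_integral)
    show "continuous_on uhp H" unfolding H_def psi'_def by (auto intro!: continuous_intros hol)
    show "primitive_on_uhp (\<lambda>\<tau>. xpsi (Interior \<tau>) (cusp_int 0)) (\<lambda>\<tau>. \<Sum>i\<in>I. U i \<tau> * cnj (ext_value (E i) (cusp_int 0)))"
      unfolding primitive_on_uhp_def xpsi_def ext_value.simps(1)
      by (intro ballI DERIV_sum DERIV_cmult_right primitive_on_uhpD[OF prim_\<Phi>])
    \<comment> \<open>\<open>mat_S\<close> carries 0 to infinity: the sum at infinity vanishes and
      the sum at 0 is left.\<close>
    show "H \<tau> - H (- 1 / \<tau>) / \<tau>\<^sup>2 = (\<Sum>i\<in>I. U i \<tau> * cnj (ext_value (E i) (cusp_int 0)))" if "\<tau> \<in> uhp" for \<tau>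
      using psi'_mobius[OF TSU_SL2Z(2) carries_TSU(2) regular_points(3,2) that]
      by (simp add: mobius_TSU H_def cusp_value_E_inf aut_factor_def algebra_simps)
  qed
  finally show ?thesis by (simp add: pairing_def xpsi_inf)
qed

text \<open>\<open>mat_U\<close> has order three in its action and fixes \<open>lower_arc (-1/2)\<close>; summing over its orbit
  of cusps and cancelling through \<open>mat_T\<close> and \<open>mat_S\<close> removes the interior points.\<close>

theorem haberland_kernel:
  "6 * (2 * \<i> * (LINT \<tau>:std_domain|lebesgue. kernel \<tau> \<tau>)) = pairing (cusp_int 0) cusp_inf (cusp_int (-1)) (cusp_int 1)"
proof -
  define \<rho> where "\<rho> = lower_arc (-1/2)"
  define \<rho>' where "\<rho>' = lower_arc (1/2)"
  have \<rho>: "\<rho> \<in> uhp" "\<rho>' \<in> uhp" using lower_arc_strip[of "-1/2"] lower_arc_strip[of "1/2"] strip_subset_uhp by (auto simp: \<rho>_def \<rho>'_def)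
  have i: "\<i> \<in> uhp" by (simp add: uhp_def)
  have S\<rho>: "mobius mat_S \<rho> = \<rho>'" using lower_arc_inversion[of "-1/2"] by (simp add: mobius_TSU \<rho>_def \<rho>'_def)
  have T\<rho>: "mobius mat_T \<rho> = \<rho>'" by (simp add: mobius_TSU \<rho>_def \<rho>'_def lower_arc_def complex_eq_iff)
  have U\<rho>: "mobius mat_U \<rho> = \<rho>"
    using lower_arc_inversion[of "1/2"] T\<rho> by (simp add: mobius_TSU \<rho>_def \<rho>'_def)
  have Si: "mobius mat_S \<i> = \<i>" by (simp add: mobius_TSU)
  note S = carries_Interior[OF TSU_SL2Z(2) \<rho>(1), unfolded S\<rho>] carries_Interior[OF TSU_SL2Z(2) i, unfolded Si]
  note T = carries_Interior[OF TSU_SL2Z(1) \<rho>(1), unfolded T\<rho>]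
  note U = carries_Interior[OF TSU_SL2Z(3) \<rho>(1), unfolded U\<rho>]
  \<comment> \<open>\<open>mat_S\<close> fixes \<open>\<i>\<close> and reverses the path from
    infinity to 0, so twice this pairing is the path from \<open>\<rho>\<close> to
    \<open>\<rho>'\<close> paired with infinity to 0.\<close>
  have e1: "pairing (Interior \<rho>) (Interior \<i>) cusp_inf (cusp_int 0) = pairing (Interior \<rho>') (Interior \<i>) (cusp_int 0) cusp_inf"
    by (rule pairing_invariant[OF TSU_SL2Z(2) S carries_TSU(1,2)]; rule regular_points)
  \<comment> \<open>Splitting the path from \<open>\<rho>\<close> to \<open>\<rho>'\<close> at
    infinity and shifting its second half back leaves the path from \<open>\<rho>\<close> to
    infinity paired with -1 to 0.\<close>
  have e2: "pairing (Interior \<rho>) cusp_inf cusp_inf (cusp_int (-1)) = pairing (Interior \<rho>') cusp_inf cusp_inf (cusp_int 0)"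
    by (rule pairing_invariant[OF TSU_SL2Z(1) T carries_TSU(3,3,5)]; rule regular_points)
  \<comment> \<open>The order-three element produces three equal pairings whose second paths close
    up to a triangle with vertices -1, 0, infinity; in their sum \<open>\<rho>\<close> may therefore
    be replaced by infinity.\<close>
  have e3: "pairing (Interior \<rho>) cusp_inf (cusp_int (-1)) (cusp_int 0) = pairing (Interior \<rho>) (cusp_int 0) cusp_inf (cusp_int (-1))"
    by (rule pairing_invariant[OF TSU_SL2Z(3) U carries_TSU(6,8,7)]; rule regular_points)
  have e4: "pairing (Interior \<rho>) (cusp_int 0) cusp_inf (cusp_int (-1)) = pairing (Interior \<rho>) (cusp_int (-1)) (cusp_int 0) cusp_inf"
    by (rule pairing_invariant[OF TSU_SL2Z(3) U carries_TSU(7,6,8)]; rule regular_points)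
  \<comment> \<open>Only cusps remain by now, and a shift by one turns the path from -1 to infinity
    into the path from 0 to infinity, while the cusp 0 in the second path moves to 1.\<close>
  have e5: "pairing (cusp_int (-1)) cusp_inf (cusp_int 0) cusp_inf = pairing (cusp_int 0) cusp_inf (cusp_int 1) cusp_inf"
    by (rule pairing_invariant[OF TSU_SL2Z(1) carries_TSU(5,3,4,3)]; rule regular_points)
  have "6 * pairing (Interior \<rho>) (Interior \<i>) cusp_inf (cusp_int 0) = pairing (cusp_int 0) cusp_inf (cusp_int (-1)) (cusp_int 1)"
    using e1 e2 e3 e4 e5 unfolding pairing_def xpsi_inf by algebra
  thus ?thesis unfolding kernel_integral \<rho>_def .
qed

end

section \<open>Eichler integrals and moments\<close>

lemma cusp_limit_cusp_value: "cusp_limit \<Phi> c L \<Longrightarrow> cusp_limit \<Phi> c (cusp_value \<Phi> c)"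
  unfolding cusp_value_def by (rule someI)

text \<open>Uniqueness of the limit needs an actual approach to \<open>c\<close>; this is why
  \<open>p\<close> is supplied.\<close>

lemma cusp_value_eqI:
  assumes "approaches p (Cusp c)" "cusp_limit \<Phi> c L" shows "cusp_value \<Phi> c = L"
proof -
  have p: "\<forall>\<^sub>F t in at_top. p t \<in> uhp" "tends_to_cusp p c at_top" using assms(1) by simp_all
  show ?thesis
    by (rule tendsto_unique[OF _ cusp_limitD[OF cusp_limit_cusp_value[OF assms(2)] p] cusp_limitD[OF assms(2) p]]) simp
qed

lemma cusp_limit_linear:
  assumes "\<And>n. n \<in> S \<Longrightarrow> cusp_limit (\<Phi> n) c (L n)"
  shows "cusp_limit (\<lambda>\<tau>. \<Sum>n\<in>S. a n * \<Phi> n \<tau>) c (\<Sum>n\<in>S. a n * L n)"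
  unfolding cusp_limit_def
  by (intro allI impI tendsto_sum tendsto_mult tendsto_const cusp_limitD[OF assms])

lemma cusp_limit_cmult: "cusp_limit \<Phi> c L \<Longrightarrow> cusp_limit (\<lambda>\<tau>. a * \<Phi> \<tau>) c (a * L)"
  unfolding cusp_limit_def by (intro allI impI tendsto_mult tendsto_const) simp

lemma primitive_linear:
  assumes "\<And>n. n \<in> S \<Longrightarrow> primitive_on_uhp (\<Phi> n) (F n)"
  shows "primitive_on_uhp (\<lambda>\<tau>. \<Sum>n\<in>S. a n * \<Phi> n \<tau>) (\<lambda>\<tau>. \<Sum>n\<in>S. a n * F n \<tau>)"
  unfolding primitive_on_uhp_def by (intro ballI DERIV_sum DERIV_cmult primitive_on_uhpD[OF assms])

lemma primitive_cmult: "primitive_on_uhp \<Phi> F \<Longrightarrow> primitive_on_uhp (\<lambda>\<tau>. a * \<Phi> \<tau>) (\<lambda>\<tau>. a * F \<tau>)"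
  unfolding primitive_on_uhp_def by (intro ballI DERIV_cmult) simp

text \<open>The negative of the integral of \<open>z ^ n * F z\<close> from \<open>\<tau>\<close> to
  infinity, a component of the classical Eichler integral.\<close>

definition eichler :: "(complex \<Rightarrow> complex) \<Rightarrow> nat \<Rightarrow> complex \<Rightarrow> complex" where
  "eichler F n = (SOME \<Phi>. primitive_on_uhp \<Phi> (\<lambda>\<tau>. \<tau> ^ n * F \<tau>) \<and> cusp_limit \<Phi> Inf_cusp 0)"

lemma rapid_decay_power:
  assumes "cuspidal k F" "n + 2 \<le> k" shows "rapid_decay (\<lambda>\<tau>. \<tau> ^ n * F \<tau>)"
  using cuspidal_rapid_decay[OF assms, of "mat 1"] by (simp add: SL2Z_iff aut_factor_def)

lemma rapid_decay_cmult: "rapid_decay F \<Longrightarrow> rapid_decay (\<lambda>\<tau>. a * F \<tau>)"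
proof -
  assume "rapid_decay F"
  then obtain C c n where C: "C \<ge> 0" "c > 0"
    and bd: "\<And>\<tau>. Im \<tau> \<ge> 1/2 \<Longrightarrow> norm (F \<tau>) \<le> C * (1 + norm \<tau>) ^ n * exp (- c * Im \<tau>)"
    by (auto simp: rapid_decay_def)
  have "norm (a * F \<tau>) \<le> norm a * C * (1 + norm \<tau>) ^ n * exp (- c * Im \<tau>)" if "Im \<tau> \<ge> 1/2" for \<tau>
    using mult_left_mono[OF bd[OF that] norm_ge_zero[of a]] by (simp add: norm_mult mult.assoc)
  thus ?thesis unfolding rapid_decay_def using C by (intro exI[of _ "norm a * C"] exI[of _ c] exI[of _ n]) auto
qed

text \<open>Convexity of the half-plane provides a primitive, and rapid decay a limit at infinity,
  which is subtracted.\<close>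

lemma eichler:
  assumes F: "cuspidal k F" and n: "n + 2 \<le> k"
  shows "primitive_on_uhp (eichler F n) (\<lambda>\<tau>. \<tau> ^ n * F \<tau>)" "cusp_limit (eichler F n) Inf_cusp 0"
proof -
  have hol: "(\<lambda>\<tau>. \<tau> ^ n * F \<tau>) holomorphic_on uhp"
    using F by (intro holomorphic_intros) (simp add: cuspidal_def)
  have "\<exists>\<Phi>. \<forall>\<tau>\<in>uhp. (\<Phi> has_field_derivative \<tau> ^ n * F \<tau>) (at \<tau> within uhp)"
  proof (rule holomorphic_convex_primitive'[OF convex_uhp open_uhp hol])
    fix \<Phi> assume "\<And>\<tau>. \<tau> \<in> uhp \<Longrightarrow> (\<Phi> has_field_derivative \<tau> ^ n * F \<tau>) (at \<tau> within uhp)"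
    thus ?thesis by (intro exI[of _ \<Phi>] ballI)
  qed
  then obtain \<Phi> where "\<forall>\<tau>\<in>uhp. (\<Phi> has_field_derivative \<tau> ^ n * F \<tau>) (at \<tau> within uhp)" ..
  hence prim: "primitive_on_uhp \<Phi> (\<lambda>\<tau>. \<tau> ^ n * F \<tau>)"
    unfolding primitive_on_uhp_def by (simp add: at_within_open[OF _ open_uhp])
  obtain L where L: "cusp_limit \<Phi> Inf_cusp L"
    using rapid_decay_limit_infinity[OF rapid_decay_power[OF F n] prim] by blast
  have "primitive_on_uhp (\<lambda>\<tau>. \<Phi> \<tau> - L) (\<lambda>\<tau>. \<tau> ^ n * F \<tau>)"
    unfolding primitive_on_uhp_def
  proof
    fix \<tau> assume "\<tau> \<in> uhp"
    from DERIV_diff[OF primitive_on_uhpD[OF prim this] DERIV_const]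
    show "((\<lambda>\<tau>. \<Phi> \<tau> - L) has_field_derivative \<tau> ^ n * F \<tau>) (at \<tau>)" by simp
  qed
  moreover have "cusp_limit (\<lambda>\<tau>. \<Phi> \<tau> - L) Inf_cusp 0"
    unfolding cusp_limit_def
  proof (intro allI impI)
    fix p Fl assume "\<forall>\<^sub>F t in Fl. p t \<in> uhp" "tends_to_cusp p Inf_cusp Fl"
    from tendsto_diff[OF cusp_limitD[OF L this] tendsto_const[of L]]
    show "((\<lambda>t. \<Phi> (p t) - L) \<longlongrightarrow> 0) Fl" by simp
  qed
  ultimately have "\<exists>\<Phi>. primitive_on_uhp \<Phi> (\<lambda>\<tau>. \<tau> ^ n * F \<tau>) \<and> cusp_limit \<Phi> Inf_cusp 0" by blast
  from someI_ex[OF this]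
  show "primitive_on_uhp (eichler F n) (\<lambda>\<tau>. \<tau> ^ n * F \<tau>)" "cusp_limit (eichler F n) Inf_cusp 0"
    unfolding eichler_def by blast+
qed

text \<open>The two pairs of endpoints that occur, bundled so that one proof handles both kinds of
  moments.\<close>

definition period_ends :: "cusp \<Rightarrow> cusp \<Rightarrow> bool" where
  "period_ends A B \<longleftrightarrow> (A = Rat_cusp 0 \<and> B = Inf_cusp) \<or> (A = Rat_cusp (-1) \<and> B = Rat_cusp 1)"

lemma period_ends_path: "period_ends A B \<Longrightarrow> \<exists>p. cusp_path A B p"
  using cusp_path_0_infinity cusp_path_minus1_1 by (auto simp: period_ends_def)

lemma eichler_limits:
  assumes F: "cuspidal k F" and n: "n + 2 \<le> k" and AB: "period_ends A B"
  shows "cusp_limit (eichler F n) A (cusp_value (eichler F n) A)" "cusp_limit (eichler F n) B (cusp_value (eichler F n) B)"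
proof -
  note lim = cuspidal_limits[OF F n eichler(1)[OF F n]]
  show "cusp_limit (eichler F n) A (cusp_value (eichler F n) A)" "cusp_limit (eichler F n) B (cusp_value (eichler F n) B)"
    using AB lim(1) lim(2)[of 0] lim(2)[of 1] lim(2)[of "-1"] by (auto simp: period_ends_def)
qed

lemma moment_eq:
  assumes F: "cuspidal k F" and n: "n + 2 \<le> k" and AB: "period_ends A B"
  shows "moment n A B F = cusp_value (eichler F n) B - cusp_value (eichler F n) A"
proof -
  obtain p where p: "cusp_path A B p" using period_ends_path[OF AB] by blast
  show ?thesis unfolding moment_def by (rule line_integral_eq[OF eichler(1)[OF F n] eichler_limits[OF F n AB] p])
qed

lemma line_integral_polynomial:
  assumes F: "cuspidal k F" and e: "\<And>n. n \<in> S \<Longrightarrow> e n + 2 \<le> k" and AB: "period_ends A B"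
  shows "line_integral A B (\<lambda>\<tau>. \<Sum>n\<in>S. a n * (\<tau> ^ e n * F \<tau>)) = (\<Sum>n\<in>S. a n * moment (e n) A B F)"
proof -
  obtain p where p: "cusp_path A B p" using period_ends_path[OF AB] by blast
  have "line_integral A B (\<lambda>\<tau>. \<Sum>n\<in>S. a n * (\<tau> ^ e n * F \<tau>))
      = (\<Sum>n\<in>S. a n * cusp_value (eichler F (e n)) B) - (\<Sum>n\<in>S. a n * cusp_value (eichler F (e n)) A)"
    by (rule line_integral_eq[OF primitive_linear cusp_limit_linear cusp_limit_linear p])
       (use eichler(1)[OF F e] eichler_limits[OF F e AB] in auto)
  also have "\<dots> = (\<Sum>n\<in>S. a n * moment (e n) A B F)"
    unfolding sum_subtractf[symmetric] by (intro sum.cong refl) (simp add: moment_eq[OF F e AB] algebra_simps)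
  finally show ?thesis .
qed

definition period_coeff :: "nat \<Rightarrow> nat \<Rightarrow> complex" where
  "period_coeff k n = (-1) ^ n * of_nat ((k - 2) choose n)"

lemma diff_power_expansion:
  "(\<tau> - w :: complex) ^ (k - 2) = (\<Sum>n\<in>{0..k-2}. period_coeff k n * (\<tau> ^ (k - 2 - n) * w ^ n))"
proof -
  have "(\<tau> - w) ^ (k - 2) = ((- w) + \<tau>) ^ (k - 2)" by simp
  also have "\<dots> = (\<Sum>n\<le>k-2. of_nat ((k - 2) choose n) * (- w) ^ n * \<tau> ^ (k - 2 - n))" by (rule binomial_ring)
  also have "\<dots> = (\<Sum>n\<in>{0..k-2}. period_coeff k n * (\<tau> ^ (k - 2 - n) * w ^ n))"
    unfolding atLeast0AtMost
    by (intro sum.cong refl) (simp add: period_coeff_def power_minus[of w] mult_ac)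
  finally show ?thesis .
qed

lemma cnj_period_coeff [simp]: "cnj (period_coeff k n) = period_coeff k n"
  by (simp add: period_coeff_def)

text \<open>The polynomial factor separates the variables, so the iterated integral is a finite sum
  of products of moments.\<close>

lemma double_line_integral:
  assumes F: "cuspidal k F" and G: "cuspidal k G" and k: "k \<ge> 2"
  shows "line_integral (Rat_cusp 0) Inf_cusp (\<lambda>\<tau>.
              line_integral_cnj (Rat_cusp (-1)) (Rat_cusp 1) (\<lambda>\<tau>2. F \<tau> * cnj (G \<tau>2) * (\<tau> - cnj \<tau>2) ^ (k - 2)))
    = (\<Sum>n\<in>{0..k-2}. period_coeff k n * moment (k - 2 - n) (Rat_cusp 0) Inf_cusp F * cnj (moment n (Rat_cusp (-1)) (Rat_cusp 1) G))"
proof -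
  have AB: "period_ends (Rat_cusp 0) Inf_cusp" "period_ends (Rat_cusp (-1)) (Rat_cusp 1)" by (simp_all add: period_ends_def)
  have inner: "line_integral_cnj (Rat_cusp (-1)) (Rat_cusp 1) (\<lambda>\<tau>2. F \<tau> * cnj (G \<tau>2) * (\<tau> - cnj \<tau>2) ^ (k - 2))
      = (\<Sum>n\<in>{0..k-2}. (period_coeff k n * cnj (moment n (Rat_cusp (-1)) (Rat_cusp 1) G)) * (\<tau> ^ (k - 2 - n) * F \<tau>))" for \<tau>
  proof -
    \<comment> \<open>The conjugate line integral conjugates its integrand, which turns it into a
      polynomial multiple of \<open>G\<close> in \<open>\<tau>2\<close>, holomorphic on the
      half-plane.\<close>
    have "(\<lambda>\<tau>2. cnj (F \<tau> * cnj (G \<tau>2) * (\<tau> - cnj \<tau>2) ^ (k - 2)))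
        = (\<lambda>\<tau>2. \<Sum>n\<in>{0..k-2}. (period_coeff k n * cnj (\<tau> ^ (k - 2 - n) * F \<tau>)) * (\<tau>2 ^ n * G \<tau>2))"
      unfolding diff_power_expansion sum_distrib_left cnj_sum
      by (intro ext sum.cong refl) (simp add: mult_ac)
    hence "line_integral_cnj (Rat_cusp (-1)) (Rat_cusp 1) (\<lambda>\<tau>2. F \<tau> * cnj (G \<tau>2) * (\<tau> - cnj \<tau>2) ^ (k - 2))
      = cnj (\<Sum>n\<in>{0..k-2}. (period_coeff k n * cnj (\<tau> ^ (k - 2 - n) * F \<tau>)) * moment n (Rat_cusp (-1)) (Rat_cusp 1) G)"
      unfolding line_integral_cnj_def using k by (subst line_integral_polynomial[OF G _ AB(2), symmetric]) auto
    thus ?thesis unfolding cnj_sum by (simp add: mult_ac)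
  qed
  show ?thesis unfolding inner
    using k by (subst line_integral_polynomial[OF F _ AB(1)]) (auto intro!: sum.cong simp: mult_ac)
qed

text \<open>Pairs of a coset index and a binomial exponent index the separated kernel, with the
  binomial coefficients put into the first factor; summing over these pairs recovers the kernel on
  one side and the products of moments on the other.\<close>

theorem haberland_vector:
  fixes F G :: "'j \<Rightarrow> complex \<Rightarrow> complex"
  assumes J: "finite J" and k: "k \<ge> 2"
    and F: "\<And>j. j \<in> J \<Longrightarrow> cuspidal k (F j)" and G: "\<And>j. j \<in> J \<Longrightarrow> cuspidal k (G j)"
    and inv: "\<And>A \<tau> z. A \<in> carrier SL2Z \<Longrightarrow> \<tau> \<in> uhp \<Longrightarrow> z \<in> uhp \<Longrightarrow>
      (\<Sum>j\<in>J. slash k (F j) A \<tau> * cnj (slash k (G j) A z)) = (\<Sum>j\<in>J. F j \<tau> * cnj (G j z))"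
  shows "12 * \<i> * (LINT \<tau>:std_domain|lebesgue. (\<Sum>j\<in>J. F j \<tau> * cnj (G j \<tau>)) * (\<tau> - cnj \<tau>) ^ (k - 2))
    = (\<Sum>j\<in>J. \<Sum>n\<in>{0..k-2}. period_coeff k n * moment (k - 2 - n) (Rat_cusp 0) Inf_cusp (F j)
          * cnj (moment n (Rat_cusp (-1)) (Rat_cusp 1) (G j)))"
proof -
  define I where "I = J \<times> {0..k-2}"
  define U where "U = (\<lambda>i \<tau>. period_coeff k (snd i) * (\<tau> ^ (k - 2 - snd i) * F (fst i) \<tau>))"
  define W where "W = (\<lambda>i \<tau>. \<tau> ^ snd i * G (fst i) \<tau>)"
  define \<Phi> where "\<Phi> = (\<lambda>i \<tau>. period_coeff k (snd i) * eichler (F (fst i)) (k - 2 - snd i) \<tau>)"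
  define E where "E = (\<lambda>i. eichler (G (fst i)) (snd i))"
  have idx: "fst i \<in> J" "k - 2 - snd i + 2 \<le> k" "snd i + 2 \<le> k" if "i \<in> I" for i
    using that k by (auto simp: I_def)
  have kernel: "(\<Sum>i\<in>I. U i \<tau> * cnj (W i z)) = (\<Sum>j\<in>J. F j \<tau> * cnj (G j z)) * (\<tau> - cnj z) ^ (k - 2)" for \<tau> z
  proof -
    have "(\<Sum>j\<in>J. F j \<tau> * cnj (G j z)) * (\<tau> - cnj z) ^ (k - 2)
        = (\<Sum>j\<in>J. \<Sum>n\<in>{0..k-2}. F j \<tau> * cnj (G j z) * (period_coeff k n * (\<tau> ^ (k - 2 - n) * cnj z ^ n)))"
      unfolding diff_power_expansion by (rule sum_product)
    also have "\<dots> = (\<Sum>i\<in>I. U i \<tau> * cnj (W i z))"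
      unfolding I_def U_def W_def sum.cartesian_product by (intro sum.cong refl) (auto simp: mult_ac)
    finally show ?thesis ..
  qed
  note limF = cuspidal_limits[OF F[OF idx(1)] idx(2) eichler(1)[OF F[OF idx(1)] idx(2)]]
  note limG = cuspidal_limits[OF G[OF idx(1)] idx(3) eichler(1)[OF G[OF idx(1)] idx(3)]]
  interpret invariant_kernel I U W \<Phi> E
  proof
    show "finite I" using J by (simp add: I_def)
    fix i assume i: "i \<in> I"
    show "primitive_on_uhp (\<Phi> i) (U i)" unfolding \<Phi>_def U_def
      by (intro primitive_cmult eichler(1)[OF F[OF idx(1)[OF i]] idx(2)[OF i]])
    show "primitive_on_uhp (E i) (W i)" unfolding E_def W_def
      by (intro eichler(1)[OF G[OF idx(1)[OF i]] idx(3)[OF i]])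
    show "cusp_limit (\<Phi> i) Inf_cusp (cusp_value (\<Phi> i) Inf_cusp)"
      unfolding \<Phi>_def by (rule cusp_limit_cusp_value[OF cusp_limit_cmult[OF limF(1)[OF i i i i]]])
    show "cusp_limit (\<Phi> i) (Rat_cusp (of_int a)) (cusp_value (\<Phi> i) (Rat_cusp (of_int a)))" for a
      unfolding \<Phi>_def by (rule cusp_limit_cusp_value[OF cusp_limit_cmult[OF limF(2)[OF i i i i]]])
    show "cusp_limit (E i) Inf_cusp 0"
      unfolding E_def by (rule eichler(2)[OF G[OF idx(1)[OF i]] idx(3)[OF i]])
    show "cusp_limit (E i) Inf_cusp (cusp_value (E i) Inf_cusp)"
      unfolding E_def by (rule limG(1)[OF i i i i])
    show "cusp_limit (E i) (Rat_cusp (of_int a)) (cusp_value (E i) (Rat_cusp (of_int a)))" for a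
      unfolding E_def by (rule limG(2)[OF i i i i])
    show "rapid_decay (U i)"
      unfolding U_def by (intro rapid_decay_cmult rapid_decay_power[OF F[OF idx(1)[OF i]] idx(2)[OF i]])
    show "rapid_decay (W i)"
      unfolding W_def by (intro rapid_decay_power[OF G[OF idx(1)[OF i]] idx(3)[OF i]])
  next
    fix A \<tau> z assume A: "A \<in> carrier SL2Z" and \<tau>: "\<tau> \<in> uhp" and z: "z \<in> uhp"
    define a b where "a = aut_factor A \<tau>" and "b = cnj (aut_factor A z)"
    have nz: "a \<noteq> 0" "b \<noteq> 0" using aut_factor_nonzero[OF A] \<tau> z by (auto simp: a_def b_def)
    obtain m where m: "k = m + 2" using k by (metis add.commute le_Suc_ex)
    have "(\<Sum>j\<in>J. F j (mobius A \<tau>) * cnj (G j (mobius A z)))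
        = (\<Sum>j\<in>J. a ^ k * b ^ k * (slash k (F j) A \<tau> * cnj (slash k (G j) A z)))"
      by (intro sum.cong refl)
         (simp add: slash_mobius[OF A \<tau>, where k = k] slash_mobius[OF A z, where k = k] a_def b_def mult_ac)
    also have "\<dots> = a ^ k * b ^ k * (\<Sum>j\<in>J. F j \<tau> * cnj (G j z))"
      unfolding sum_distrib_left[symmetric] inv[OF A \<tau> z] ..
    finally have 1: "(\<Sum>j\<in>J. F j (mobius A \<tau>) * cnj (G j (mobius A z))) = a ^ k * b ^ k * (\<Sum>j\<in>J. F j \<tau> * cnj (G j z))" .
    \<comment> \<open>Conjugation commutes with integral matrices, so the difference formula can be
      applied with the conjugate point in the lower half-plane.\<close>
    have 2: "mobius A \<tau> - cnj (mobius A z) = (\<tau> - cnj z) / (a * b)"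
      unfolding cnj_mobius using nz mobius_diff[OF A, of \<tau> "cnj z"] by (simp add: a_def b_def cnj_aut_factor)
    \<comment> \<open>In each variable \<open>k - 2\<close> of the \<open>k\<close> automorphy
      factors are consumed by the power of the difference, and two remain.\<close>
    show "(\<Sum>i\<in>I. U i (mobius A \<tau>) * cnj (W i (mobius A z)))
        = (aut_factor A \<tau>)\<^sup>2 * cnj ((aut_factor A z)\<^sup>2) * (\<Sum>i\<in>I. U i \<tau> * cnj (W i z))"
      unfolding kernel 1 2 complex_cnj_power a_def[symmetric] b_def[symmetric] m
      using nz by (simp add: power_divide power_mult_distrib power_add power2_eq_square)
  qed
  have AB: "period_ends (Rat_cusp 0) Inf_cusp" "period_ends (Rat_cusp (-1)) (Rat_cusp 1)" by (simp_all add: period_ends_def)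
  \<comment> \<open>\<open>cusp_value\<close> is a choice, so even a constant factor can be taken
    out only through uniqueness of the limit.\<close>
  have \<Phi>_value: "cusp_value (\<Phi> i) c = period_coeff k (snd i) * cusp_value (eichler (F (fst i)) (k - 2 - snd i)) c"
    if i: "i \<in> I" and c: "c = Inf_cusp \<or> c = Rat_cusp 0" for i c
  proof -
    have "\<exists>p. approaches p (Cusp c)"
      using c approaches_inf(1) approaches_int[of 0, unfolded of_int_0] by blast
    then obtain p where p: "approaches p (Cusp c)" by blast
    have "cusp_limit (eichler (F (fst i)) (k - 2 - snd i)) c (cusp_value (eichler (F (fst i)) (k - 2 - snd i)) c)"
      using c eichler_limits[OF F[OF idx(1)[OF i]] idx(2)[OF i] AB(1)] by auto
    from cusp_value_eqI[OF p cusp_limit_cmult[OF this]] show ?thesis by (simp add: \<Phi>_def)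
  qed
  have "12 * \<i> * (LINT \<tau>:std_domain|lebesgue. (\<Sum>j\<in>J. F j \<tau> * cnj (G j \<tau>)) * (\<tau> - cnj \<tau>) ^ (k - 2))
      = 6 * (2 * \<i> * (LINT \<tau>:std_domain|lebesgue. kernel \<tau> \<tau>))"
    by (simp add: kernel_def kernel)
  also have "\<dots> = pairing (cusp_int 0) cusp_inf (cusp_int (-1)) (cusp_int 1)" by (rule haberland_kernel)
  also have "\<dots> = (\<Sum>i\<in>I. (cusp_value (\<Phi> i) Inf_cusp - cusp_value (\<Phi> i) (Rat_cusp 0))
      * cnj (cusp_value (E i) (Rat_cusp 1) - cusp_value (E i) (Rat_cusp (-1))))"
    unfolding pairing_def xpsi_def sum_subtractf[symmetric] sum.distrib[symmetric]
    by (intro sum.cong refl) (simp add: algebra_simps)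
  also have "\<dots> = (\<Sum>i\<in>I. period_coeff k (snd i) * moment (k - 2 - snd i) (Rat_cusp 0) Inf_cusp (F (fst i))
          * cnj (moment (snd i) (Rat_cusp (-1)) (Rat_cusp 1) (G (fst i))))"
  proof (intro sum.cong refl)
    fix i assume i: "i \<in> I"
    show "(cusp_value (\<Phi> i) Inf_cusp - cusp_value (\<Phi> i) (Rat_cusp 0))
        * cnj (cusp_value (E i) (Rat_cusp 1) - cusp_value (E i) (Rat_cusp (-1)))
      = period_coeff k (snd i) * moment (k - 2 - snd i) (Rat_cusp 0) Inf_cusp (F (fst i))
          * cnj (moment (snd i) (Rat_cusp (-1)) (Rat_cusp 1) (G (fst i)))"
      unfolding moment_eq[OF F[OF idx(1)[OF i]] idx(2)[OF i] AB(1)] moment_eq[OF G[OF idx(1)[OF i]] idx(3)[OF i] AB(2)]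
      using \<Phi>_value[OF i] by (simp add: E_def right_diff_distrib)
  qed
  also have "\<dots> = (\<Sum>j\<in>J. \<Sum>n\<in>{0..k-2}. period_coeff k n * moment (k - 2 - n) (Rat_cusp 0) Inf_cusp (F j)
          * cnj (moment n (Rat_cusp (-1)) (Rat_cusp 1) (G j)))"
    unfolding I_def sum.cartesian_product by (intro sum.cong refl) auto
  finally show ?thesis .
qed

section \<open>Level and character\<close>

lemma dirichlet_character_mod:
  assumes "dirichlet_character N chi" shows "chi (a mod int N) = chi a"
proof -
  have per: "chi (a + int N) = chi a" for a using assms by (simp add: dirichlet_character_def)
  have nat: "chi (a + int m * int N) = chi a" for a m
  proof (induction m)
    case (Suc m)
    have "chi (a + int (Suc m) * int N) = chi ((a + int m * int N) + int N)" by (simp add: algebra_simps)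
    thus ?case using per Suc by simp
  qed simp
  have "chi (b + q * int N) = chi b" for b q
  proof (cases "q \<ge> 0")
    case True
    thus ?thesis using nat[of b "nat q"] by simp
  next
    case False
    thus ?thesis using nat[of "b + q * int N" "nat (- q)"] by simp
  qed
  from this[of "a mod int N" "a div int N"] show ?thesis by (simp add: mult.commute)
qed

text \<open>By the pigeonhole principle two powers of \<open>a\<close> agree modulo
  \<open>N\<close>, so a positive power of \<open>chi a\<close> is one.\<close>

lemma dirichlet_character_norm:
  assumes chi: "dirichlet_character N chi" and N: "N \<ge> 1" and a: "coprime a (int N)"
  shows "norm (chi a) = 1"
proof -
  have mult: "chi (a * b) = chi a * chi b" for a b using chi by (simp add: dirichlet_character_def)
  have nz: "chi b \<noteq> 0" if "coprime b (int N)" for b using chi that by (simp add: dirichlet_character_def)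
  have "chi 1 * chi 1 = chi 1 * 1" using mult[of 1 1] by simp
  hence one: "chi 1 = 1" using nz[of 1] by simp
  have pow: "chi (a ^ n) = chi a ^ n" for n by (induction n) (simp_all add: one mult)
  have "range (\<lambda>n::nat. a ^ n mod int N) \<subseteq> {0..<int N}" using N by auto
  hence "finite (range (\<lambda>n::nat. a ^ n mod int N))" by (rule finite_subset) simp
  hence "\<not> inj (\<lambda>n::nat. a ^ n mod int N)" using finite_imageD[of _ "UNIV::nat set"] by auto
  then obtain m n :: nat where mn: "m < n" "a ^ m mod int N = a ^ n mod int N"
    unfolding inj_def by (metis linorder_neqE_nat)
  hence "chi (a ^ m) = chi (a ^ n)" using dirichlet_character_mod[OF chi] by metis
  hence "chi a ^ m * 1 = chi a ^ (m + (n - m))" using mn(1) by (simp add: pow)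
  hence "chi a ^ m * 1 = chi a ^ m * chi a ^ (n - m)" by (simp only: power_add)
  hence "chi a ^ (n - m) = 1" using nz[OF a] by simp
  hence "norm (chi a) ^ (n - m) = 1" by (simp flip: norm_power)
  thus ?thesis using mn(1) power_eq_1_iff[of "norm (chi a)" "n - m"] by simp
qed

text \<open>A common divisor of the lower right entry and \<open>N\<close> divides the whole lower
  row, hence the determinant.\<close>

lemma Gamma0_coprime: "A \<in> Gamma0 N \<Longrightarrow> coprime (A $ 2 $ 2) (int N)"
proof (rule coprimeI)
  fix c assume A: "A \<in> Gamma0 N" and c: "c dvd A $ 2 $ 2" "c dvd int N"
  have "c dvd A $ 2 $ 1" using A c dvd_trans by (auto simp: Gamma0_def)
  hence "c dvd A $ 1 $ 1 * A $ 2 $ 2 - A $ 1 $ 2 * A $ 2 $ 1" using c by simp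
  thus "is_unit c" using A by (simp add: Gamma0_def SL2Z_iff)
qed

lemma cusp_forms_slash_Gamma0:
  assumes "f \<in> cusp_forms k N chi" "A \<in> Gamma0 N" "\<tau> \<in> uhp"
  shows "slash k f A \<tau> = chi (A $ 2 $ 2) * f \<tau>"
  using assms by (auto simp: cusp_forms_def modular_forms_def)

text \<open>Both forms acquire the same value of \<open>chi\<close>, one of them conjugated; its
  modulus is one, so the product does not notice the left factor.\<close>

lemma cusp_forms_slash_pair_left:
  assumes chi: "dirichlet_character N chi" and N: "N \<ge> 1"
    and f: "f \<in> cusp_forms k N chi" and g: "g \<in> cusp_forms k N chi"
    and h: "h \<in> Gamma0 N" and B: "B \<in> carrier SL2Z" and \<tau>: "\<tau> \<in> uhp" "z \<in> uhp"
  shows "slash k f (h ** B) \<tau> * cnj (slash k g (h ** B) z) = slash k f B \<tau> * cnj (slash k g B z)"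
proof -
  have *: "slash k f' (h ** B) w = chi (h $ 2 $ 2) * slash k f' B w" if "f' \<in> cusp_forms k N chi" "w \<in> uhp" for f' w
    unfolding slash_mult[OF Gamma0_SL2Z[OF h] B that(2)] slash_def[of k "slash k f' h"]
    using cusp_forms_slash_Gamma0[OF that(1) h mobius_uhp[OF B that(2)]] by (simp add: slash_def)
  have "chi (h $ 2 $ 2) * cnj (chi (h $ 2 $ 2)) = 1"
    using dirichlet_character_norm[OF chi N Gamma0_coprime[OF h]]
    by (simp add: complex_norm_square[symmetric] flip: of_real_power)
  thus ?thesis unfolding *[OF f \<tau>(1)] *[OF g \<tau>(2)] by (simp add: mult_ac)
qed

text \<open>The automorphy factors of \<open>f\<close> and of the conjugate of \<open>g\<close>
  together form the \<open>k\<close>-th power of the squared modulus by which the height is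
  divided.\<close>

lemma slash_pair_Im:
  assumes A: "A \<in> carrier SL2Z" and \<tau>: "\<tau> \<in> uhp"
  shows "f (mobius A \<tau>) * cnj (g (mobius A \<tau>)) * of_real (Im (mobius A \<tau>) ^ k)
    = slash k f A \<tau> * cnj (slash k g A \<tau>) * of_real (Im \<tau> ^ k)"
proof -
  have nz: "aut_factor A \<tau> \<noteq> 0" by (rule aut_factor_nonzero[OF A \<tau>])
  have "of_real (Im (mobius A \<tau>)) = of_real (Im \<tau>) / (aut_factor A \<tau> * cnj (aut_factor A \<tau>))"
    unfolding Im_mobius[OF A] of_real_divide complex_norm_square ..
  hence "of_real (Im (mobius A \<tau>) ^ k) = of_real (Im \<tau> ^ k) / (aut_factor A \<tau> ^ k * cnj (aut_factor A \<tau>) ^ k)"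
    by (simp only: of_real_power power_divide power_mult_distrib)
  thus ?thesis
    using nz by (simp add: slash_mobius[OF A \<tau>, where k = k])
qed

text \<open>The power of the height is written as \<open>\<tau> ^ (k - 2)\<close> times the same
  power of \<open>Im \<tau> / \<tau>\<close>. The former is absorbed by the decay of
  \<open>F\<close>, the latter has modulus at most one.\<close>

lemma petersson_integrand_integrable:
  assumes F: "cuspidal k F" and G: "cuspidal k G" and k: "k \<ge> 2"
  shows "set_integrable lebesgue std_domain (\<lambda>\<tau>. F \<tau> * cnj (G \<tau>) * of_real (Im \<tau> ^ (k - 2)))"
proof (rule strip_decay_integrable)
  have "F holomorphic_on uhp" "G holomorphic_on uhp" using F G by (auto simp: cuspidal_def)
  hence c: "continuous_on uhp F" "continuous_on uhp G" by (auto intro: holomorphic_on_imp_continuous_on)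
  show "continuous_on uhp (\<lambda>\<tau>. F \<tau> * cnj (G \<tau>) * of_real (Im \<tau> ^ (k - 2)))"
    by (intro continuous_intros c)
  show "std_domain \<in> sets lebesgue" using open_std_domain by (simp add: borel_open)
  show "std_domain \<subseteq> strip" using std_domain_above_arc above_arc_strip by blast
  have "rapid_decay (\<lambda>\<tau>. \<tau> ^ (k - 2) * F \<tau>)" "rapid_decay G"
    using rapid_decay_power[OF F, of "k - 2"] rapid_decay_power[OF G, of 0] k by simp_all
  note d = rapid_decay_strip[OF this(1)] rapid_decay_strip[OF this(2)]
  obtain M where M: "\<And>\<tau>. \<tau> \<in> strip \<Longrightarrow> norm (G \<tau>) \<le> M" using strip_decay_bounded[OF d(2)] by blast
  have "norm (cnj (G \<tau>) * (of_real (Im \<tau>) / \<tau>) ^ (k - 2)) \<le> M" if \<tau>: "\<tau> \<in> strip" for \<tau>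
  proof -
    have "\<bar>Im \<tau>\<bar> / norm \<tau> \<le> 1" using abs_Im_le_cmod[of \<tau>] by (simp add: divide_le_eq_1)
    hence "norm ((of_real (Im \<tau>) / \<tau>) ^ (k - 2)) \<le> 1"
      by (simp add: norm_power norm_divide power_le_one)
    hence "norm (cnj (G \<tau>) * (of_real (Im \<tau>) / \<tau>) ^ (k - 2)) \<le> norm (G \<tau>) * 1"
      unfolding norm_mult by (intro mult_mono) auto
    thus ?thesis using M[OF \<tau>] by simp
  qed
  from strip_decay_mult_bounded[OF d(1) this]
  have "strip_decay (\<lambda>\<tau>. \<tau> ^ (k - 2) * F \<tau> * (cnj (G \<tau>) * (of_real (Im \<tau>) / \<tau>) ^ (k - 2)))" .
  moreover have "\<tau> ^ (k - 2) * F \<tau> * (cnj (G \<tau>) * (of_real (Im \<tau>) / \<tau>) ^ (k - 2)) = F \<tau> * cnj (G \<tau>) * of_real (Im \<tau> ^ (k - 2))"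
    if "\<tau> \<in> strip" for \<tau>
  proof -
    have "\<tau> \<noteq> 0" using that by (auto simp: strip_def)
    thus ?thesis by (simp add: power_divide)
  qed
  ultimately show "strip_decay (\<lambda>\<tau>. F \<tau> * cnj (G \<tau>) * of_real (Im \<tau> ^ (k - 2)))"
    by (simp add: strip_decay_def)
qed

theorem corollary3p7:
  fixes k N r :: nat
    and chi :: "int \<Rightarrow> complex"
    and f g :: "complex \<Rightarrow> complex"
    and \<gamma> :: "nat \<Rightarrow> int ^ 2 ^ 2"
    and fj gj :: "nat \<Rightarrow> complex \<Rightarrow> complex"
  assumes "k \<ge> 2" and "N \<ge> 1"
    and "dirichlet_character N chi"
    and "f \<in> cusp_forms k N chi" and "g \<in> cusp_forms k N chi"
    and r_def: "r = Gamma0_index N"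
    and reps_in: "\<And>j. j \<in> {1..r} \<Longrightarrow> \<gamma> j \<in> carrier SL2Z"
    and reps_cover: "carrier SL2Z = (\<Union>j\<in>{1..r}. Gamma0 N #>\<^bsub>SL2Z\<^esub> \<gamma> j)"
    and reps_disjoint: "disjoint_family_on (\<lambda>j. Gamma0 N #>\<^bsub>SL2Z\<^esub> \<gamma> j) {1..r}"
    and fj_def: "\<And>j. j \<in> {1..r} \<Longrightarrow> fj j = slash k f (\<gamma> j)"
    and gj_def: "\<And>j. j \<in> {1..r} \<Longrightarrow> gj j = slash k g (\<gamma> j)"
  shows "6 * of_nat r * (2 * \<i>) ^ (k - 1) * petersson k N f g =
           (\<Sum>j\<in>{1..r}. line_integral (Rat_cusp 0) Inf_cusp (\<lambda>\<tau>.
              line_integral_cnj (Rat_cusp (-1)) (Rat_cusp 1) (\<lambda>\<tau>2.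
                fj j \<tau> * cnj (gj j \<tau>2) * (\<tau> - cnj \<tau>2) ^ (k - 2))))
       \<and> (\<Sum>j\<in>{1..r}. line_integral (Rat_cusp 0) Inf_cusp (\<lambda>\<tau>.
              line_integral_cnj (Rat_cusp (-1)) (Rat_cusp 1) (\<lambda>\<tau>2.
                fj j \<tau> * cnj (gj j \<tau>2) * (\<tau> - cnj \<tau>2) ^ (k - 2)))) =
         (\<Sum>j\<in>{1..r}. \<Sum>n\<in>{0..k - 2}.
            (-1) ^ n * of_nat ((k - 2) choose n) *
            moment (k - 2 - n) (Rat_cusp 0) Inf_cusp (fj j) *
            cnj (moment n (Rat_cusp (-1)) (Rat_cusp 1) (gj j)))"
proof -
  note k = assms(1) and N = assms(2) and chi = assms(3) and f = assms(4) and g = assms(5)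
  define J where "J = {1..r}"
  have coset: "Gamma0 N #>\<^bsub>SL2Z\<^esub> B = {h ** B | h. h \<in> Gamma0 N}" for B
    by (auto simp: r_coset_def SL2Z_def)
  interpret Gamma0_reps N J \<gamma>
  proof
    show "finite J" by (simp add: J_def)
    show "\<gamma> j \<in> carrier SL2Z" if "j \<in> J" for j using that reps_in by (simp add: J_def)
    show "\<exists>j\<in>J. \<exists>h\<in>Gamma0 N. A = h ** \<gamma> j" if "A \<in> carrier SL2Z" for A
    proof -
      have "A \<in> (\<Union>j\<in>{1..r}. Gamma0 N #>\<^bsub>SL2Z\<^esub> \<gamma> j)" using that reps_cover by (rule subst[rotated])
      thus ?thesis unfolding coset J_def by blast
    qed
    show "i = j" if "i \<in> J" "j \<in> J" "h \<in> Gamma0 N" "h' \<in> Gamma0 N" "h ** \<gamma> i = h' ** \<gamma> j" for i j h h'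
    proof (rule ccontr)
      assume "i \<noteq> j"
      hence "(Gamma0 N #>\<^bsub>SL2Z\<^esub> \<gamma> i) \<inter> (Gamma0 N #>\<^bsub>SL2Z\<^esub> \<gamma> j) = {}"
        using reps_disjoint that(1,2) unfolding disjoint_family_on_def J_def by blast
      moreover have "h ** \<gamma> i \<in> Gamma0 N #>\<^bsub>SL2Z\<^esub> \<gamma> i" unfolding coset using that by blast
      moreover have "h ** \<gamma> i \<in> Gamma0 N #>\<^bsub>SL2Z\<^esub> \<gamma> j" unfolding coset that(5) using that by blast
      ultimately show False by blast
    qed
  qed
  \<comment> \<open>The Petersson product divides by the index, and this step makes the division
    cancel. An empty family covers nothing, which also rules out the value 0 that
    \<open>card\<close> assigns to an infinite set.\<close>
  have "r \<noteq> 0"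
  proof
    assume "r = 0"
    hence "J = {}" by (simp add: J_def)
    thus False using reps_cover[of "mat 1"] by (auto simp: SL2Z_iff)
  qed
  have fj: "fj j = slash k f (\<gamma> j)" and gj: "gj j = slash k g (\<gamma> j)" if "j \<in> J" for j
    using that fj_def gj_def by (simp_all add: J_def)
  have F: "cuspidal k (fj j)" and G: "cuspidal k (gj j)" if "j \<in> J" for j
    unfolding fj[OF that] gj[OF that]
    by (intro cusp_forms_cuspidal[OF f N reps_SL2Z[OF that]] cusp_forms_cuspidal[OF g N reps_SL2Z[OF that]])+
  have inv: "(\<Sum>j\<in>J. slash k (fj j) A \<tau> * cnj (slash k (gj j) A z)) = (\<Sum>j\<in>J. fj j \<tau> * cnj (gj j z))"
    if A: "A \<in> carrier SL2Z" and \<tau>: "\<tau> \<in> uhp" "z \<in> uhp" for A \<tau> z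
  proof -
    have "(\<Sum>j\<in>J. slash k (fj j) A \<tau> * cnj (slash k (gj j) A z))
       = (\<Sum>j\<in>J. slash k f (\<gamma> j ** A) \<tau> * cnj (slash k g (\<gamma> j ** A) z))"
      by (intro sum.cong refl) (simp only: fj gj slash_mult[OF reps_SL2Z A] \<tau>)
    also have "\<dots> = (\<Sum>j\<in>J. slash k f (\<gamma> j) \<tau> * cnj (slash k g (\<gamma> j) z))"
      by (rule sum_reps_right_mult[OF A]) (rule cusp_forms_slash_pair_left[OF chi N f g _ _ \<tau>])
    also have "\<dots> = (\<Sum>j\<in>J. fj j \<tau> * cnj (gj j z))" by (intro sum.cong refl) (simp only: fj gj)
    finally show ?thesis .
  qed
  define \<phi> where "\<phi> = (\<lambda>\<tau>. f \<tau> * cnj (g \<tau>) * of_real (Im \<tau> ^ k))"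
  have hol: "f holomorphic_on uhp" "g holomorphic_on uhp" using f g by (auto simp: cusp_forms_def modular_forms_def)
  have c\<phi>: "continuous_on uhp \<phi>" unfolding \<phi>_def
    by (intro continuous_intros holomorphic_on_imp_continuous_on hol)
  have inv\<phi>: "\<phi> (mobius A \<tau>) = \<phi> \<tau>" if A: "A \<in> Gamma0 N" and \<tau>: "\<tau> \<in> uhp" for A \<tau>
  proof -
    have "slash k f A \<tau> * cnj (slash k g A \<tau>) = slash k f (mat 1) \<tau> * cnj (slash k g (mat 1) \<tau>)"
      using cusp_forms_slash_pair_left[OF chi N f g A Gamma0_SL2Z[OF one_in_Gamma0] \<tau> \<tau>] by simp
    thus ?thesis unfolding \<phi>_def slash_pair_Im[OF Gamma0_SL2Z[OF A] \<tau>] by (simp add: slash_def aut_factor_def)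
  qed
  \<comment> \<open>Two of the \<open>k\<close> powers of the height cancel against the hyperbolic
    measure.\<close>
  have piece: "\<phi> (mobius (\<gamma> j) \<tau>) / of_real ((Im \<tau>)\<^sup>2) = fj j \<tau> * cnj (gj j \<tau>) * of_real (Im \<tau> ^ (k - 2))"
    if j: "j \<in> J" and \<tau>: "\<tau> \<in> std_domain" for j \<tau>
  proof -
    have \<tau>: "\<tau> \<in> uhp" using \<tau> std_domain_subset_uhp by auto
    have y: "Im \<tau> \<noteq> 0" using \<tau> by (simp add: uhp_def)
    obtain m where m: "k = m + 2" using k by (metis add.commute le_Suc_ex)
    show ?thesis unfolding \<phi>_def slash_pair_Im[OF reps_SL2Z[OF j] \<tau>] fj[OF j] gj[OF j] m
      using y by (simp add: power_add power2_eq_square)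
  qed
  have std: "std_domain \<in> sets lebesgue" using open_std_domain by (simp add: borel_open)
  have int: "set_integrable lebesgue std_domain (\<lambda>\<tau>. fj j \<tau> * cnj (gj j \<tau>) * of_real (Im \<tau> ^ (k - 2)))" if "j \<in> J" for j
    by (rule petersson_integrand_integrable[OF F[OF that] G[OF that] k])
  have int': "set_integrable lebesgue std_domain (\<lambda>\<tau>. \<phi> (mobius (\<gamma> j) \<tau>) / of_real ((Im \<tau>)\<^sup>2))" if j: "j \<in> J" for j
    using int[OF j] piece[OF j] by (subst set_integrable_cong[OF refl refl]) auto
  have "quotient_integral (Gamma0 N) \<phi> = (\<Sum>j\<in>J. LINT \<tau>:std_domain|lebesgue. \<phi> (mobius (\<gamma> j) \<tau>) / of_real ((Im \<tau>)\<^sup>2))"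
    by (rule quotient_integral_eq[OF c\<phi> inv\<phi> int'])
  also have "\<dots> = (\<Sum>j\<in>J. LINT \<tau>:std_domain|lebesgue. fj j \<tau> * cnj (gj j \<tau>) * of_real (Im \<tau> ^ (k - 2)))"
    by (intro sum.cong refl set_lebesgue_integral_cong std) (use piece in auto)
  also have "\<dots> = (LINT \<tau>:std_domain|lebesgue. \<Sum>j\<in>J. fj j \<tau> * cnj (gj j \<tau>) * of_real (Im \<tau> ^ (k - 2)))"
    using int unfolding set_lebesgue_integral_def set_integrable_def scaleR_sum_right
    by (subst Bochner_Integration.integral_sum) auto
  finally have QI: "quotient_integral (Gamma0 N) \<phi> = (LINT \<tau>:std_domain|lebesgue. \<Sum>j\<in>J. fj j \<tau> * cnj (gj j \<tau>) * of_real (Im \<tau> ^ (k - 2)))" .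
  \<comment> \<open>On the diagonal the difference of a point and its conjugate is
    \<open>2 * \<i>\<close> times the height, which brings the power of \<open>2 * \<i>\<close> into
    the formula.\<close>
  have "(\<lambda>\<tau>. (\<Sum>j\<in>J. fj j \<tau> * cnj (gj j \<tau>)) * (\<tau> - cnj \<tau>) ^ (k - 2))
      = (\<lambda>\<tau>. (2 * \<i>) ^ (k - 2) * (\<Sum>j\<in>J. fj j \<tau> * cnj (gj j \<tau>) * of_real (Im \<tau> ^ (k - 2))))"
    unfolding sum_distrib_right[symmetric]
    by (rule ext) (simp add: complex_diff_cnj power_mult_distrib mult_ac)
  hence L: "(LINT \<tau>:std_domain|lebesgue. (\<Sum>j\<in>J. fj j \<tau> * cnj (gj j \<tau>)) * (\<tau> - cnj \<tau>) ^ (k - 2))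
      = (2 * \<i>) ^ (k - 2) * quotient_integral (Gamma0 N) \<phi>"
    unfolding QI by simp
  have k1: "k - 1 = Suc (k - 2)" using k by simp
  have "6 * of_nat r * (2 * \<i>) ^ (k - 1) * petersson k N f g = 6 * (2 * \<i>) ^ (k - 1) * quotient_integral (Gamma0 N) \<phi>"
    using \<open>r \<noteq> 0\<close> by (simp add: petersson_def r_def[symmetric] \<phi>_def)
  \<comment> \<open>One factor \<open>2 * \<i>\<close> turns 6 into \<open>12 * \<i>\<close>; the
    other \<open>k - 2\<close> belong to the integral.\<close>
  also have "\<dots> = 12 * \<i> * (LINT \<tau>:std_domain|lebesgue. (\<Sum>j\<in>J. fj j \<tau> * cnj (gj j \<tau>)) * (\<tau> - cnj \<tau>) ^ (k - 2))"
    unfolding L k1 by simp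
  also have "\<dots> = (\<Sum>j\<in>J. \<Sum>n\<in>{0..k-2}. period_coeff k n * moment (k - 2 - n) (Rat_cusp 0) Inf_cusp (fj j)
          * cnj (moment n (Rat_cusp (-1)) (Rat_cusp 1) (gj j)))"
    by (rule haberland_vector[OF finite_J k F G inv])
  finally have main: "6 * of_nat r * (2 * \<i>) ^ (k - 1) * petersson k N f g = \<dots>" .
  have "(\<Sum>j\<in>J. line_integral (Rat_cusp 0) Inf_cusp (\<lambda>\<tau>.
              line_integral_cnj (Rat_cusp (-1)) (Rat_cusp 1) (\<lambda>\<tau>2.
                fj j \<tau> * cnj (gj j \<tau>2) * (\<tau> - cnj \<tau>2) ^ (k - 2))))
      = (\<Sum>j\<in>J. \<Sum>n\<in>{0..k-2}. period_coeff k n * moment (k - 2 - n) (Rat_cusp 0) Inf_cusp (fj j)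
          * cnj (moment n (Rat_cusp (-1)) (Rat_cusp 1) (gj j)))"
    by (intro sum.cong refl double_line_integral F G k)
  with main show ?thesis unfolding J_def period_coeff_def by simp
qed

end
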